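(* Let $\Omega\subset\mathbb{R}^d$ be compact and convex with non-negligible interior, let $\mu,\nu\in\mathcal{P}(\Omega)$, and suppose $\mu\ll\mathcal{L}_d$. For all $\lambda>0$, the problem $$\inf_{\rho\in\mathcal{P}(\Omega)}\ \frac12 W_2^2(\mu,\rho)+\lambda W_1(\rho,\nu)$$ has a unique solution $\rho_\lambda$, which can also be expressed as the solution to $$\min_{\rho\in B_\lambda(\mu)} D_\lambda(\nu,\rho).$$ Consequently, if $\nu\in B_\lambda(\mu)$, then $\rho_\lambda=\nu$. On the other hand, if $\nu\notin B_\lambda(\mu)$, then there exists a Kantorovich potential $\varphi_\lambda$ for $W_2(\mu,\rho_\lambda)$ satisfying $\mathrm{Lip}(\varphi_\lambda)=\lambda$ and $$\int_\Omega\varphi_\lambda\,(d\nu-d\rho_\lambda)=\lambda W_1(\rho_\lambda,\nu).$$ Finally, the optimal transport map $T_\lambda$ for $W_2(\mu,\rho_\lambda)$ (sending $\mu$ to $\rho_\lambda$) satisfies $$\|I-T_\lambda\|_{L^\infty(\mu)}\le\lambda .$$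
   Context: $\mathcal{P}(\Omega)$ is the set of Borel probability measures on $\Omega$, $\mathcal{L}_d$ is Lebesgue measure, $|\cdot|$ is the Euclidean norm, $I$ is the identity map, and $W_p$ is the Wasserstein $p$ distance on $\mathcal{P}(\Omega)$ for the Euclidean distance. $\mathrm{Lip}(\varphi)$ is the (best) Lipschitz constant of $\varphi$ on $\Omega$, and $\lambda\text{-Lip}(\Omega)$ is the set of functions on $\Omega$ with Lipschitz constant at most $\lambda$. $\Pi(\mu,\rho)$ is the set of probability measures on $\Omega\times\Omega$ with marginals $\mu$ and $\rho$. Let $c_2(x,y)=\frac12|x-y|^2$ and $\varphi^{c_2}(x)=\inf_{y\in\Omega}\big(c_2(x,y)-\varphi(y)\big)$. A function $\varphi\in C(\Omega)$ is called a Kantorovich potential for $W_2(\mu,\rho)$ if $\int_\Omega\varphi^{c_2}\,d\mu+\int_\Omega\varphi\,d\rho=\frac12W_2^2(\mu,\rho)$. Equivalently, $\varphi\in\partial\big(\frac12W_2^2(\cdot,\mu)\big)(\rho)$, where $\frac12W_2^2(\cdot,\mu)$ is viewed as a convex functional on the finite signed Borel measures $\mathcal{M}(\Omega)=C(\Omega)^*$, equal to $+\infty$ off $\mathcal{P}(\Omega)$, and subgradients are taken in $C(\Omega)$. The Huber cost is $c_{2,\lambda}(x,y)=\frac12|x-y|^2$ if $|x-y|\le\lambda$ and $c_{2,\lambda}(x,y)=\lambda|x-y|-\frac{\lambda^2}{2}$ if $|x-y|\ge\lambda$. Its transport cost is $\mathcal{I}_{c_{2,\lambda}}(\mu,\rho)=\inf_{\gamma\in\Pi(\mu,\rho)}\int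 c_{2,\lambda}\,d\gamma$. Define $$B_\lambda(\mu)=\{\rho\in\mathcal{P}(\Omega)\mid \exists\,\gamma_0\in\Pi(\mu,\rho)\text{ optimal for }\mathcal{I}_{c_{2,\lambda}}(\mu,\rho)\text{ with }\mathrm{spt}(\gamma_0)\subset\{|x-y|\le\lambda\}\},$$ $$D_\lambda(\nu,\rho)=\tfrac12W_2^2(\nu,\mu)-\tfrac12W_2^2(\rho,\mu)-\sup\Big\{\int_\Omega\varphi\,d(\nu-\rho)\ \Big|\ \varphi\in\partial\big(\tfrac12W_2^2(\cdot,\mu)\big)(\rho)\cap\lambda\text{-Lip}(\Omega)\Big\},$$ with $\sup\emptyset=-\infty$ (so $D_\lambda$ may be $+\infty$). *)

theory Defs
  imports "HOL-Probability.Probability"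
begin

definition borel_probs :: "'a::topological_space set \<Rightarrow> 'a measure set" where
  "borel_probs \<Omega> = {\<rho>. prob_space \<rho> \<and> sets \<rho> = sets (restrict_space borel \<Omega>)}"

definition couplings ::
  "'a::topological_space set \<Rightarrow> 'a measure \<Rightarrow> 'a measure \<Rightarrow> ('a \<times> 'a) measure set" where
  "couplings \<Omega> \<mu> \<rho> =
     {\<gamma> \<in> borel_probs (\<Omega> \<times> \<Omega>).
        distr \<gamma> (restrict_space borel \<Omega>) fst = \<mu> \<and> distr \<gamma> (restrict_space borel \<Omega>) snd = \<rho>}"

(* Real-valued: for the continuous costs and compact \<Omega> used here every integral is finite,
   the set of couplings is nonempty and the costs are bounded below. *)
definition transport_cost ::
  "'a::topological_space set \<Rightarrow> ('a \<Rightarrow> 'a \<Rightarrow> real) \<Rightarrow> 'a measure \<Rightarrow> 'a measure \<Rightarrow> real" where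
  "transport_cost \<Omega> c \<mu> \<rho> = (INF \<gamma>\<in>couplings \<Omega> \<mu> \<rho>. \<integral>z. c (fst z) (snd z) \<partial>\<gamma>)"

definition wasserstein ::
  "'a::real_normed_vector set \<Rightarrow> real \<Rightarrow> 'a measure \<Rightarrow> 'a measure \<Rightarrow> real" where
  "wasserstein \<Omega> p \<mu> \<rho> = transport_cost \<Omega> (\<lambda>x y. norm (x - y) powr p) \<mu> \<rho> powr (1 / p)"

definition c2 :: "'a::real_normed_vector \<Rightarrow> 'a \<Rightarrow> real" where
  "c2 x y = 1 / 2 * norm (x - y) ^ 2"

definition c2_transform :: "'a::real_normed_vector set \<Rightarrow> ('a \<Rightarrow> real) \<Rightarrow> 'a \<Rightarrow> real" where
  "c2_transform \<Omega> \<phi> x = (INF y\<in>\<Omega>. c2 x y - \<phi> y)"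

definition kantorovich_potential ::
  "'a::real_normed_vector set \<Rightarrow> 'a measure \<Rightarrow> 'a measure \<Rightarrow> ('a \<Rightarrow> real) \<Rightarrow> bool" where
  "kantorovich_potential \<Omega> \<mu> \<rho> \<phi> \<longleftrightarrow>
     continuous_on \<Omega> \<phi> \<and>
     (\<integral>x. c2_transform \<Omega> \<phi> x \<partial>\<mu>) + (\<integral>x. \<phi> x \<partial>\<rho>) = 1 / 2 * (wasserstein \<Omega> 2 \<mu> \<rho>)\<^sup>2"

(* Extended-real valued, so that the constant of a non-Lipschitz function is \<infinity>. *)
definition lip_const :: "'a::metric_space set \<Rightarrow> ('a \<Rightarrow> real) \<Rightarrow> ereal" where
  "lip_const \<Omega> \<phi> = (INF L\<in>{L. L-lipschitz_on \<Omega> \<phi>}. ereal L)"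

(* The finite signed Borel measures on a compact \<Omega>, as the bounded linear functionals on C(\<Omega>)
   with the sup norm.  Functions on \<Omega> are total functions here; the bound makes
   a functional depend only on the restriction to \<Omega> of its (continuous) argument. *)
definition signed_measures :: "'a::topological_space set \<Rightarrow> (('a \<Rightarrow> real) \<Rightarrow> real) set" where
  "signed_measures \<Omega> =
     {L. (\<forall>f g. continuous_on \<Omega> f \<longrightarrow> continuous_on \<Omega> g \<longrightarrow> L (\<lambda>x. f x + g x) = L f + L g) \<and>
         (\<forall>a f. continuous_on \<Omega> f \<longrightarrow> L (\<lambda>x. a * f x) = a * L f) \<and>
         (\<exists>C. \<forall>f. continuous_on \<Omega> f \<longrightarrow> \<bar>L f\<bar> \<le> C * (SUP x\<in>\<Omega>. \<bar>f x\<bar>))}"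

definition as_functional :: "'a measure \<Rightarrow> ('a \<Rightarrow> real) \<Rightarrow> real" where
  "as_functional \<rho> f = (\<integral>x. f x \<partial>\<rho>)"

definition subdifferential ::
  "'a::topological_space set \<Rightarrow> ((('a \<Rightarrow> real) \<Rightarrow> real) \<Rightarrow> ereal) \<Rightarrow> (('a \<Rightarrow> real) \<Rightarrow> real) \<Rightarrow> ('a \<Rightarrow> real) set"
  where
  "subdifferential \<Omega> F L\<^sub>0 =
     {\<phi>. continuous_on \<Omega> \<phi> \<and> (\<forall>L\<in>signed_measures \<Omega>. F L \<ge> F L\<^sub>0 + ereal (L \<phi> - L\<^sub>0 \<phi>))}"

(* At most one \<rho> represents L, so the infimum is the value at that \<rho>;
   it is \<infinity> (an empty infimum) if L is not a probability measure. *)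
definition half_W2_sq ::
  "'a::real_normed_vector set \<Rightarrow> 'a measure \<Rightarrow> (('a \<Rightarrow> real) \<Rightarrow> real) \<Rightarrow> ereal" where
  "half_W2_sq \<Omega> \<mu> L =
     (INF \<rho>\<in>{\<rho> \<in> borel_probs \<Omega>. \<forall>f. continuous_on \<Omega> f \<longrightarrow> L f = as_functional \<rho> f}.
        ereal (1 / 2 * (wasserstein \<Omega> 2 \<rho> \<mu>)\<^sup>2))"

definition huber :: "real \<Rightarrow> 'a::real_normed_vector \<Rightarrow> 'a \<Rightarrow> real" where
  "huber lam x y =
     (if norm (x - y) \<le> lam then 1 / 2 * norm (x - y) ^ 2 else lam * norm (x - y) - lam\<^sup>2 / 2)"

definition measure_support :: "'a::topological_space measure \<Rightarrow> 'a set" where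
  "measure_support \<gamma> =
     {z \<in> space \<gamma>. \<forall>U. open U \<longrightarrow> z \<in> U \<longrightarrow> emeasure \<gamma> (U \<inter> space \<gamma>) > 0}"

definition B_set ::
  "'a::real_normed_vector set \<Rightarrow> real \<Rightarrow> 'a measure \<Rightarrow> 'a measure set" where
  "B_set \<Omega> lam \<mu> =
     {\<rho> \<in> borel_probs \<Omega>.
        \<exists>\<gamma>\<in>couplings \<Omega> \<mu> \<rho>.
          (\<integral>z. huber lam (fst z) (snd z) \<partial>\<gamma>) = transport_cost \<Omega> (huber lam) \<mu> \<rho> \<and>
          measure_support \<gamma> \<subseteq> {(x, y). norm (x - y) \<le> lam}}"

definition D_fun ::
  "'a::real_normed_vector set \<Rightarrow> real \<Rightarrow> 'a measure \<Rightarrow> 'a measure \<Rightarrow> 'a measure \<Rightarrow> ereal" where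
  "D_fun \<Omega> lam \<mu> \<nu> \<rho> =
     ereal (1 / 2 * (wasserstein \<Omega> 2 \<nu> \<mu>)\<^sup>2 - 1 / 2 * (wasserstein \<Omega> 2 \<rho> \<mu>)\<^sup>2) -
     (SUP \<phi>\<in>subdifferential \<Omega> (half_W2_sq \<Omega> \<mu>) (as_functional \<rho>) \<inter> {\<phi>. lam-lipschitz_on \<Omega> \<phi>}.
        ereal ((\<integral>x. \<phi> x \<partial>\<nu>) - (\<integral>x. \<phi> x \<partial>\<rho>)))"

definition optimal_map ::
  "'a::real_normed_vector set \<Rightarrow> 'a measure \<Rightarrow> 'a measure \<Rightarrow> ('a \<Rightarrow> 'a) \<Rightarrow> bool" where
  "optimal_map \<Omega> \<mu> \<rho> T \<longleftrightarrow>
     T \<in> measurable \<mu> (restrict_space borel \<Omega>) \<and>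
     distr \<mu> (restrict_space borel \<Omega>) T = \<rho> \<and>
     (\<integral>x. c2 x (T x) \<partial>\<mu>) = 1 / 2 * (wasserstein \<Omega> 2 \<mu> \<rho>)\<^sup>2"

end

theory Submission
  imports Defs "HOL-Complex_Analysis.Great_Picard"
begin

text \<open>
  Write \<open>\<phi>\<^sup>c\<close> for the quadratic transform of \<open>\<phi>\<close> and
  \<open>J \<phi> = \<integral> \<phi>\<^sup>c d\<mu> + \<integral> \<phi> d\<nu>\<close> for the dual functional on \<open>\<lambda>\<close>-Lipschitz functions. The sum of the weak
  duality inequalities \<open>\<integral> \<phi>\<^sup>c d\<mu> + \<integral> \<phi> d\<rho> \<le> W\<^sub>2\<^sup>2(\<mu>,\<rho>)/2\<close> and \<open>\<integral> \<phi> d(\<nu> - \<rho>) \<le> \<lambda> W\<^sub>1(\<rho>,\<nu>)\<close> says that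
  \<open>J \<phi>\<close> bounds the regularized cost of every \<open>\<rho>\<close> from below, with equality only if \<open>\<phi>\<close> is a Kantorovich
  potential for \<open>\<rho>\<close>. The problem is thus to find \<open>\<phi>\<close> and \<open>\<rho>\<close> with equality.

  By Arzela-Ascoli \<open>J\<close> has a maximizer \<open>\<phi>\<close> among the \<open>\<lambda>\<close>-Lipschitz functions. Since \<open>\<mu>\<close> is absolutely
  continuous, the infimum that defines \<open>\<phi>\<^sup>c x\<close> is attained at exactly one point \<open>T x\<close> for almost every \<open>x\<close>:
  the set-valued map of minimizers is monotone, and a monotone map cannot jump by a fixed amount in a fixed
  direction on a set of positive measure (\<open>c2_argmin_jump_null\<close>). Hence the derivative of
  \<open>\<phi> \<mapsto> \<integral> \<phi>\<^sup>c d\<mu>\<close> in a direction \<open>\<eta>\<close> is \<open>- \<integral> \<eta> \<circ> T d\<mu>\<close> (\<open>c2_transform_first_variation\<close>). Let \<open>\<rho>\<close> be the image of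
  \<open>\<mu>\<close> under \<open>T\<close>. Then \<open>\<phi>\<close> is a potential for \<open>\<rho>\<close> and \<open>T\<close> is optimal. The first order condition for the maximum
  of \<open>J\<close> says that \<open>\<phi>\<close> also maximizes \<open>\<integral> \<phi>' d(\<nu> - \<rho>)\<close> over \<open>\<lambda>\<close>-Lipschitz \<open>\<phi>'\<close>, so that
  \<open>\<integral> \<phi> d(\<nu> - \<rho>) = \<lambda> W\<^sub>1(\<rho>,\<nu>)\<close> by Kantorovich-Rubinstein, and equality holds for \<open>\<rho>\<close>. Uniqueness comes from the
  same derivative: if \<open>\<phi>\<close> is a potential for \<open>\<rho>'\<close>, then \<open>\<phi>\<close> maximizes \<open>\<integral> \<phi>\<^sup>c d\<mu> + \<integral> \<phi> d\<rho>'\<close> over all continuous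
  functions, and the first order condition is \<open>\<integral> \<eta> d\<rho>' = \<integral> \<eta> \<circ> T d\<mu>\<close> (\<open>potential_determines_target\<close>).

  The rest follows from this picture. A point \<open>x\<close> is moved by at most \<open>\<lambda>\<close>, since going further along the
  segment costs more than a \<open>\<lambda>\<close>-Lipschitz \<open>\<phi>\<close> returns. The Huber cost is the infimal convolution of the quadratic
  cost with \<open>\<lambda>|y - z|\<close>, so \<open>\<phi>\<^sup>c x + \<phi> z\<close> is at most the Huber cost and \<open>\<rho>\<close> lies in \<open>B\<^sub>\<lambda>(\<mu>)\<close>. Conversely, for \<open>\<nu>\<close>
  in \<open>B\<^sub>\<lambda>(\<mu>)\<close> Huber duality gives \<open>W\<^sub>2\<^sup>2(\<mu>,\<nu>)/2 \<le> max J\<close>, so \<open>\<nu>\<close> is itself the minimizer. If the best Lipschitz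
  constant of \<open>\<phi>\<close> were smaller than \<open>\<lambda>\<close>, then \<open>W\<^sub>1(\<rho>,\<nu>) = 0\<close>. Finally the subgradients in \<open>D\<^sub>\<lambda>\<close> are exactly the
  Kantorovich potentials, which turns \<open>D\<^sub>\<lambda>(\<nu>,\<rho>')\<close> into \<open>W\<^sub>2\<^sup>2(\<mu>,\<nu>)/2\<close> minus the supremum of \<open>J\<close> over the
  \<open>\<lambda>\<close>-Lipschitz potentials of \<open>\<rho>'\<close>; it is least exactly when a maximizer of \<open>J\<close> is a potential of \<open>\<rho>'\<close>.

  The two strong dualities, for the Huber cost and for the distance, are instances of
  \<open>approximate_transport_duality\<close>. Its proof discretizes both measures and solves the finite problem with an
  entropic penalty, where the first order condition of the smooth dual is an explicit coupling.
\<close>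

section \<open>Borel probability measures on a compact set\<close>

abbreviation borel_on :: "'a::topological_space set \<Rightarrow> 'a measure" where
  "borel_on X \<equiv> restrict_space borel X"

lemma borel_probsD:
  assumes "\<rho> \<in> borel_probs X"
  shows "prob_space \<rho>" "sets \<rho> = sets (borel_on X)" "space \<rho> = X"
proof -
  show "prob_space \<rho>" and s: "sets \<rho> = sets (borel_on X)"
    using assms by (simp_all add: borel_probs_def)
  show "space \<rho> = X"
    using sets_eq_imp_space_eq[OF s] by (simp only: space_restrict_space space_borel Int_UNIV_right)
qed

lemma borel_probs_nonempty: "\<rho> \<in> borel_probs X \<Longrightarrow> X \<noteq> {}"
  using prob_space.not_empty[OF borel_probsD(1)] borel_probsD(3) by metis

lemma measurable_borel_probs:
  assumes "\<rho> \<in> borel_probs X"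
  shows "measurable \<rho> N = measurable (borel_on X) N"
  by (rule measurable_cong_sets) (simp_all add: borel_probsD(2)[OF assms])

lemma continuous_on_measurable_borel_probs:
  assumes "\<rho> \<in> borel_probs X" "continuous_on X f"
  shows "f \<in> borel_measurable \<rho>"
  using assms by (simp add: measurable_borel_probs borel_measurable_continuous_on_restrict)

lemma bounded_integrable_borel_probs:
  fixes f :: "'a::topological_space \<Rightarrow> real"
  assumes \<rho>: "\<rho> \<in> borel_probs X" and f: "f \<in> borel_measurable \<rho>" "bounded (f ` X)"
  shows "integrable \<rho> f"
proof -
  interpret prob_space \<rho> using borel_probsD[OF \<rho>] by simp
  obtain B where "\<forall>x\<in>X. \<bar>f x\<bar> \<le> B" using f(2) by (auto simp: bounded_iff)
  then show ?thesis
    using f borel_probsD(3)[OF \<rho>] by (intro integrable_const_bound[of f B]) auto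
qed

lemma continuous_on_integrable_borel_probs:
  fixes f :: "'a::topological_space \<Rightarrow> real"
  assumes "\<rho> \<in> borel_probs X" "compact X" "continuous_on X f"
  shows "integrable \<rho> f"
  using assms continuous_on_measurable_borel_probs compact_continuous_image compact_imp_bounded
    bounded_integrable_borel_probs by blast

text \<open>A finite Borel measure is inner regular, so it is determined by its values on compact sets \<open>K\<close>, and the
indicator of \<open>K\<close> is the decreasing limit of the Lipschitz functions \<open>max 0 (1 - n * infdist x K)\<close>.\<close>

lemma borel_probs_eqI:
  fixes X :: "'a::{second_countable_topology, complete_space} set"
  assumes X: "compact X" and \<rho>: "\<rho> \<in> borel_probs X" and \<rho>': "\<rho>' \<in> borel_probs X"
    and eq: "\<And>(f :: 'a \<Rightarrow> real) L. L-lipschitz_on UNIV f \<Longrightarrow> (\<integral>x. f x \<partial>\<rho>) = (\<integral>x. f x \<partial>\<rho>')"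
  shows "\<rho> = \<rho>'"
proof -
  have Xb: "X \<in> sets borel" using X by (simp add: borel_closed compact_imp_closed)
  have conv: "(\<lambda>n. \<integral>x. max 0 (1 - real n * infdist x K) \<partial>\<kappa>) \<longlonglongrightarrow> measure \<kappa> (K \<inter> X)"
    if \<kappa>: "\<kappa> \<in> borel_probs X" and K: "compact K" "K \<noteq> {}" for \<kappa> K
  proof -
    interpret prob_space \<kappa> using borel_probsD[OF \<kappa>] by simp
    have KM: "K \<inter> X \<in> sets \<kappa>"
      using borel_probsD(2)[OF \<kappa>] K Xb by (auto simp: sets_restrict_space borel_closed compact_imp_closed)
    have "(\<lambda>n. \<integral>x. max 0 (1 - real n * infdist x K) \<partial>\<kappa>) \<longlonglongrightarrow> (\<integral>x. indicator (K \<inter> X) x \<partial>\<kappa>)"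
    proof (rule integral_dominated_convergence[where w = "\<lambda>_. 1"])
      show "AE x in \<kappa>. (\<lambda>n. max 0 (1 - real n * infdist x K)) \<longlonglongrightarrow> indicator (K \<inter> X) x"
      proof (rule AE_I2)
        fix x assume "x \<in> space \<kappa>"
        then have x: "x \<in> X" using borel_probsD(3)[OF \<kappa>] by simp
        show "(\<lambda>n. max 0 (1 - real n * infdist x K)) \<longlonglongrightarrow> indicator (K \<inter> X) x"
        proof (cases "x \<in> K")
          case False
          then have "infdist x K > 0"
            using K in_closed_iff_infdist_zero[of K x] infdist_nonneg[of x K]
            by (auto simp: compact_imp_closed less_le)
          then obtain N where N: "1 < real N * infdist x K" using reals_Archimedean3 by blast
          have "max 0 (1 - real n * infdist x K) = 0" if "n \<ge> N" for n
          proof -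
            have "real N * infdist x K \<le> real n * infdist x K"
              using that by (intro mult_right_mono) (auto simp: infdist_nonneg)
            with N show ?thesis by simp
          qed
          then have "\<forall>\<^sub>F n in sequentially. max 0 (1 - real n * infdist x K) = 0"
            by (auto simp: eventually_sequentially)
          then show ?thesis using False by (simp add: tendsto_eventually)
        qed (use x in simp)
      qed
      show "(indicator (K \<inter> X) :: _ \<Rightarrow> real) \<in> borel_measurable \<kappa>" using KM by simp
      show "(\<lambda>x. max 0 (1 - real n * infdist x K)) \<in> borel_measurable \<kappa>" for n
        by (intro continuous_on_measurable_borel_probs[OF \<kappa>] continuous_intros)
    qed (simp_all add: infdist_nonneg)
    also have "(\<integral>x. indicator (K \<inter> X) x \<partial>\<kappa>) = measure \<kappa> (K \<inter> X)" using KM by simp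
    finally show ?thesis .
  qed
  have K_eq: "measure \<rho> (K \<inter> X) = measure \<rho>' (K \<inter> X)" if "compact K" for K
  proof (cases "K = {}")
    case False
    have "(real n)-lipschitz_on UNIV (\<lambda>x. max 0 (1 - real n * infdist x K))" for n
    proof (rule lipschitz_onI)
      fix x y
      have "\<bar>real n * infdist x K - real n * infdist y K\<bar> \<le> real n * dist x y"
        using infdist_triangle_abs[of x K y] by (simp flip: right_diff_distrib add: abs_mult mult_left_mono)
      then show "dist (max 0 (1 - real n * infdist x K)) (max 0 (1 - real n * infdist y K))
          \<le> real n * dist x y"
        by (auto simp: dist_real_def max_def abs_if split: if_splits)
    qed simp
    from eq[OF this] show ?thesis
      by (intro LIMSEQ_unique[OF conv[OF \<rho> that False]]) (use conv[OF \<rho>' that False] in simp)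
  qed simp
  interpret \<rho>: prob_space \<rho> using borel_probsD[OF \<rho>] by simp
  interpret \<rho>': prob_space \<rho>' using borel_probsD[OF \<rho>'] by simp
  have meas: "(\<lambda>x. x) \<in> measurable \<kappa> borel" if "\<kappa> \<in> borel_probs X" for \<kappa>
    using that by (simp add: measurable_borel_probs measurable_restrict_space1)
  have em: "emeasure (distr \<kappa> borel (\<lambda>x. x)) B = emeasure \<kappa> (B \<inter> X)"
    if "\<kappa> \<in> borel_probs X" "B \<in> sets borel" for \<kappa> B
    using that borel_probsD(3)[OF that(1)] by (simp add: emeasure_distr meas)
  have fin: "emeasure (distr \<kappa> borel (\<lambda>x. x)) (space (distr \<kappa> borel (\<lambda>x. x))) \<noteq> \<infinity>"
    if "\<kappa> \<in> borel_probs X" for \<kappa>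
    using prob_space.emeasure_space_1[OF prob_space.prob_space_distr[OF borel_probsD(1)[OF that] meas[OF that]]]
    by simp
  show ?thesis
  proof (rule measure_eqI)
    show "sets \<rho> = sets \<rho>'" using borel_probsD[OF \<rho>] borel_probsD[OF \<rho>'] by simp
    fix A assume "A \<in> sets \<rho>"
    then have A: "A \<in> sets borel" "A \<subseteq> X"
      using borel_probsD[OF \<rho>] Xb by (auto simp: sets_restrict_space)
    have "emeasure (distr \<rho> borel (\<lambda>x. x)) A = emeasure (distr \<rho>' borel (\<lambda>x. x)) A"
    proof -
      have "emeasure (distr \<rho> borel (\<lambda>x. x)) K = emeasure (distr \<rho>' borel (\<lambda>x. x)) K" if "compact K" for K
        using K_eq[OF that] em[OF \<rho> borel_compact[OF that]] em[OF \<rho>' borel_compact[OF that]]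
        by (simp only: \<rho>.emeasure_eq_measure \<rho>'.emeasure_eq_measure)
      then have "emeasure (distr \<rho> borel (\<lambda>x. x)) ` {K. K \<subseteq> A \<and> compact K} =
          emeasure (distr \<rho>' borel (\<lambda>x. x)) ` {K. K \<subseteq> A \<and> compact K}"
        by (intro image_cong) auto
      then show ?thesis
        by (simp only: inner_regular[OF sets_distr fin[OF \<rho>] A(1)] inner_regular[OF sets_distr fin[OF \<rho>'] A(1)])
    qed
    then show "emeasure \<rho> A = emeasure \<rho>' A"
      using em[OF \<rho> A(1)] em[OF \<rho>' A(1)] A(2) by (simp add: Int_absorb2)
  qed
qed

lemma sets_pair_restrict_borel:
  fixes A :: "'a::second_countable_topology set" and B :: "'b::second_countable_topology set"
  shows "sets (borel_on A \<Otimes>\<^sub>M borel_on B) = sets (borel_on (A \<times> B))"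
    (is "sets ?P = sets ?R")
proof
  show "sets ?P \<subseteq> sets ?R"
  proof (rule sets_pair_in_sets)
    fix a b assume "a \<in> sets (borel_on A)" "b \<in> sets (borel_on B)"
    then obtain a' b' where "a' \<in> sets borel" "b' \<in> sets borel" "a = A \<inter> a'" "b = B \<inter> b'"
      by (auto simp: sets_restrict_space)
    moreover have "(A \<inter> a') \<times> (B \<inter> b') = (A \<times> B) \<inter> (a' \<times> b')" by auto
    moreover have "a' \<times> b' \<in> sets borel" if "a' \<in> sets borel" "b' \<in> sets borel"
      using pair_measureI[OF that] unfolding borel_prod .
    ultimately show "a \<times> b \<in> sets ?R" by (auto simp: sets_restrict_space)
  qed
  have m: "(\<lambda>z. (fst z, snd z)) \<in> measurable ?P (borel \<Otimes>\<^sub>M borel)"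
    by (intro measurable_Pair measurable_compose[OF measurable_fst] measurable_compose[OF measurable_snd]
        measurable_restrict_space1) auto
  show "sets ?R \<subseteq> sets ?P"
  proof
    fix S assume "S \<in> sets ?R"
    then obtain S' where S': "S' \<in> sets borel" "S = A \<times> B \<inter> S'" by (auto simp: sets_restrict_space)
    have "(\<lambda>z. (fst z, snd z)) -` S' \<inter> space ?P \<in> sets ?P"
      using S' by (intro measurable_sets[OF m]) (simp only: borel_prod)
    also have "(\<lambda>z. (fst z, snd z)) -` S' \<inter> space ?P = S"
      using S' by (auto simp: space_pair_measure space_restrict_space)
    finally show "S \<in> sets ?P" .
  qed
qed

section \<open>Couplings and transport costs\<close>

lemma couplingsD:
  assumes "\<gamma> \<in> couplings X \<mu> \<rho>"
  shows "\<gamma> \<in> borel_probs (X \<times> X)" "distr \<gamma> (borel_on X) fst = \<mu>"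
    "distr \<gamma> (borel_on X) snd = \<rho>"
  using assms by (auto simp: couplings_def)

lemma measurable_fst_snd_restrict_borel:
  fixes X :: "'a::second_countable_topology set"
  assumes "\<gamma> \<in> borel_probs (X \<times> X)"
  shows "fst \<in> measurable \<gamma> (borel_on X)" "snd \<in> measurable \<gamma> (borel_on X)"
proof -
  have s: "sets \<gamma> = sets (borel_on X \<Otimes>\<^sub>M borel_on X)"
    using borel_probsD(2)[OF assms] by (simp only: sets_pair_restrict_borel)
  show "fst \<in> measurable \<gamma> (borel_on X)"
    by (subst measurable_cong_sets[OF s refl]) (rule measurable_fst)
  show "snd \<in> measurable \<gamma> (borel_on X)"
    by (subst measurable_cong_sets[OF s refl]) (rule measurable_snd)
qed

lemma coupling_marginals:
  fixes X :: "'a::second_countable_topology set" and f :: "'a \<Rightarrow> real"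
  assumes \<gamma>: "\<gamma> \<in> couplings X \<mu> \<rho>"
  shows "f \<in> borel_measurable \<mu> \<Longrightarrow> (\<integral>z. f (fst z) \<partial>\<gamma>) = (\<integral>x. f x \<partial>\<mu>)"
    "f \<in> borel_measurable \<rho> \<Longrightarrow> (\<integral>z. f (snd z) \<partial>\<gamma>) = (\<integral>x. f x \<partial>\<rho>)"
    "integrable \<mu> f \<Longrightarrow> integrable \<gamma> (\<lambda>z. f (fst z))"
    "integrable \<rho> f \<Longrightarrow> integrable \<gamma> (\<lambda>z. f (snd z))"
proof -
  note m = measurable_fst_snd_restrict_borel[OF couplingsD(1)[OF \<gamma>]]
  note d = couplingsD(2,3)[OF \<gamma>, symmetric]
  show "f \<in> borel_measurable \<mu> \<Longrightarrow> (\<integral>z. f (fst z) \<partial>\<gamma>) = (\<integral>x. f x \<partial>\<mu>)"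
    unfolding d(1) by (subst integral_distr[OF m(1)]) auto
  show "f \<in> borel_measurable \<rho> \<Longrightarrow> (\<integral>z. f (snd z) \<partial>\<gamma>) = (\<integral>x. f x \<partial>\<rho>)"
    unfolding d(2) by (subst integral_distr[OF m(2)]) auto
  show "integrable \<mu> f \<Longrightarrow> integrable \<gamma> (\<lambda>z. f (fst z))"
    unfolding d(1) by (rule integrable_distr[OF m(1)])
  show "integrable \<rho> f \<Longrightarrow> integrable \<gamma> (\<lambda>z. f (snd z))"
    unfolding d(2) by (rule integrable_distr[OF m(2)])
qed

text \<open>The couplings constructed from duality are absolutely continuous with respect to the product measure. For such
measures the marginal conditions are conditions on the density. They are asymmetric because the density of
\<open>approximate_transport_duality\<close> vanishes over cells without \<open>\<nu>\<close>-mass.\<close>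

lemma density_coupling:
  fixes X :: "'a::second_countable_topology set"
  assumes \<mu>: "\<mu> \<in> borel_probs X" and \<nu>: "\<nu> \<in> borel_probs X"
    and w: "w \<in> borel_measurable (\<mu> \<Otimes>\<^sub>M \<nu>)"
    and w1: "\<And>x. x \<in> X \<Longrightarrow> (\<integral>\<^sup>+z. w (x, z) \<partial>\<nu>) = 1" and w2: "AE z in \<nu>. (\<integral>\<^sup>+x. w (x, z) \<partial>\<mu>) = 1"
  shows "density (\<mu> \<Otimes>\<^sub>M \<nu>) w \<in> couplings X \<mu> \<nu>"
proof -
  interpret \<mu>: prob_space \<mu> using borel_probsD[OF \<mu>] by simp
  interpret \<nu>: prob_space \<nu> using borel_probsD[OF \<nu>] by simp
  interpret P: pair_sigma_finite \<mu> \<nu> ..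
  let ?\<gamma> = "density (\<mu> \<Otimes>\<^sub>M \<nu>) w"
  have sp: "space \<mu> = X" "space \<nu> = X" using borel_probsD(3) \<mu> \<nu> by auto
  have s: "sets \<mu> = sets (borel_on X)" "sets \<nu> = sets (borel_on X)"
    using borel_probsD(2) \<mu> \<nu> by auto
  have s\<gamma>: "sets ?\<gamma> = sets (borel_on (X \<times> X))"
    by (simp only: sets_density sets_pair_measure_cong[OF s] sets_pair_restrict_borel)
  have fstA: "emeasure ?\<gamma> (A \<times> X) = emeasure \<mu> A" if A: "A \<in> sets \<mu>" for A
  proof -
    have A': "A \<times> X \<in> sets (\<mu> \<Otimes>\<^sub>M \<nu>)" using A sp(2) sets.top[of \<nu>] by (intro pair_measureI) auto
    then have "emeasure ?\<gamma> (A \<times> X) = (\<integral>\<^sup>+p. w p * indicator (A \<times> X) p \<partial>(\<mu> \<Otimes>\<^sub>M \<nu>))"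
      using w by (intro emeasure_density) auto
    also have "\<dots> = (\<integral>\<^sup>+x. \<integral>\<^sup>+z. w (x, z) * indicator (A \<times> X) (x, z) \<partial>\<nu> \<partial>\<mu>)"
      using w A' by (subst \<nu>.nn_integral_fst[symmetric]) auto
    also have "\<dots> = (\<integral>\<^sup>+x. indicator A x \<partial>\<mu>)"
    proof (intro nn_integral_cong)
      fix x assume "x \<in> space \<mu>"
      then have x: "x \<in> X" by (simp add: sp)
      have "(\<integral>\<^sup>+z. w (x, z) * indicator (A \<times> X) (x, z) \<partial>\<nu>) = (\<integral>\<^sup>+z. w (x, z) * indicator A x \<partial>\<nu>)"
        by (intro nn_integral_cong) (auto simp: indicator_def sp)
      also have "\<dots> = indicator A x"
        using w1[OF x] by (simp split: split_indicator)
      finally show "(\<integral>\<^sup>+z. w (x, z) * indicator (A \<times> X) (x, z) \<partial>\<nu>) = indicator A x" .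
    qed
    finally show ?thesis using A by simp
  qed
  have sndA: "emeasure ?\<gamma> (X \<times> A) = emeasure \<nu> A" if A: "A \<in> sets \<nu>" for A
  proof -
    have A': "X \<times> A \<in> sets (\<mu> \<Otimes>\<^sub>M \<nu>)" using A sp(1) sets.top[of \<mu>] by (intro pair_measureI) auto
    then have "emeasure ?\<gamma> (X \<times> A) = (\<integral>\<^sup>+p. w p * indicator (X \<times> A) p \<partial>(\<mu> \<Otimes>\<^sub>M \<nu>))"
      using w by (intro emeasure_density) auto
    also have "\<dots> = (\<integral>\<^sup>+z. \<integral>\<^sup>+x. w (x, z) * indicator (X \<times> A) (x, z) \<partial>\<mu> \<partial>\<nu>)"
      using w A' by (subst P.nn_integral_snd[symmetric]) auto
    also have "\<dots> = (\<integral>\<^sup>+z. indicator A z \<partial>\<nu>)"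
    proof (intro nn_integral_cong_AE, use w2 in eventually_elim)
      fix z assume z: "(\<integral>\<^sup>+x. w (x, z) \<partial>\<mu>) = 1"
      have "(\<integral>\<^sup>+x. w (x, z) * indicator (X \<times> A) (x, z) \<partial>\<mu>) = (\<integral>\<^sup>+x. w (x, z) * indicator A z \<partial>\<mu>)"
        by (intro nn_integral_cong) (auto simp: indicator_def sp)
      also have "\<dots> = indicator A z"
        using z by (simp split: split_indicator)
      finally show "(\<integral>\<^sup>+x. w (x, z) * indicator (X \<times> A) (x, z) \<partial>\<mu>) = indicator A z" .
    qed
    finally show ?thesis using A by simp
  qed
  have sp\<gamma>: "space ?\<gamma> = X \<times> X" by (simp add: space_pair_measure sp)
  have "prob_space ?\<gamma>"
    using fstA[OF sets.top] \<mu>.emeasure_space_1 by (intro prob_spaceI) (simp only: sp sp\<gamma>)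
  then have \<gamma>: "?\<gamma> \<in> borel_probs (X \<times> X)" using s\<gamma> by (simp only: borel_probs_def) simp
  note m = measurable_fst_snd_restrict_borel[OF \<gamma>]
  have "distr ?\<gamma> (borel_on X) fst = \<mu>"
  proof (rule measure_eqI)
    fix A assume "A \<in> sets (distr ?\<gamma> (borel_on X) fst)"
    then have A: "A \<in> sets (borel_on X)" "A \<in> sets \<mu>" by (simp_all add: s)
    then have "fst -` A \<inter> space ?\<gamma> = A \<times> X"
      using sets.sets_into_space[OF A(2)] unfolding sp\<gamma> sp by auto
    then show "emeasure (distr ?\<gamma> (borel_on X) fst) A = emeasure \<mu> A"
      using A fstA by (simp only: emeasure_distr[OF m(1)])
  qed (simp add: s)
  moreover have "distr ?\<gamma> (borel_on X) snd = \<nu>"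
  proof (rule measure_eqI)
    fix A assume "A \<in> sets (distr ?\<gamma> (borel_on X) snd)"
    then have A: "A \<in> sets (borel_on X)" "A \<in> sets \<nu>" by (simp_all add: s)
    then have "snd -` A \<inter> space ?\<gamma> = X \<times> A"
      using sets.sets_into_space[OF A(2)] unfolding sp\<gamma> sp by auto
    then show "emeasure (distr ?\<gamma> (borel_on X) snd) A = emeasure \<nu> A"
      using A sndA by (simp only: emeasure_distr[OF m(2)])
  qed (simp add: s)
  ultimately show ?thesis using \<gamma> by (simp add: couplings_def)
qed

lemma couplings_nonempty:
  fixes X :: "'a::second_countable_topology set"
  assumes \<mu>: "\<mu> \<in> borel_probs X" and \<nu>: "\<nu> \<in> borel_probs X"
  shows "couplings X \<mu> \<nu> \<noteq> {}"
proof -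
  have "density (\<mu> \<Otimes>\<^sub>M \<nu>) (\<lambda>_. 1) \<in> couplings X \<mu> \<nu>"
    using borel_probsD(1)[OF \<mu>] borel_probsD(1)[OF \<nu>]
    by (intro density_coupling[OF \<mu> \<nu>]) (auto simp: prob_space.emeasure_space_1)
  then show ?thesis by auto
qed

lemma map_coupling:
  fixes X :: "'a::second_countable_topology set"
  assumes \<mu>: "\<mu> \<in> borel_probs X" and T: "T \<in> measurable \<mu> (borel_on X)"
  shows "distr \<mu> (borel_on (X \<times> X)) (\<lambda>x. (x, T x))
      \<in> couplings X \<mu> (distr \<mu> (borel_on X) T)"
    and "(\<lambda>x. (x, T x)) \<in> measurable \<mu> (borel_on (X \<times> X))"
    and "distr \<mu> (borel_on X) T \<in> borel_probs X"
proof -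
  interpret \<mu>: prob_space \<mu> using borel_probsD[OF \<mu>] by simp
  let ?\<gamma> = "distr \<mu> (borel_on (X \<times> X)) (\<lambda>x. (x, T x))"
  have id: "(\<lambda>x. x) \<in> measurable \<mu> (borel_on X)"
    by (simp add: measurable_borel_probs[OF \<mu>])
  show m: "(\<lambda>x. (x, T x)) \<in> measurable \<mu> (borel_on (X \<times> X))"
    using measurable_Pair[OF id T] measurable_cong_sets[OF refl sets_pair_restrict_borel[of X X], of \<mu>] by simp
  show "distr \<mu> (borel_on X) T \<in> borel_probs X"
    using \<mu>.prob_space_distr[OF T] by (simp add: borel_probs_def)
  have \<gamma>: "?\<gamma> \<in> borel_probs (X \<times> X)"
    using \<mu>.prob_space_distr[OF m] by (simp add: borel_probs_def)
  have mm: "fst \<in> measurable (borel_on (X \<times> X)) (borel_on X)"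
    "snd \<in> measurable (borel_on (X \<times> X)) (borel_on X)"
    using measurable_fst_snd_restrict_borel[OF \<gamma>] by (simp_all add: measurable_borel_probs[OF \<gamma>])
  have "distr \<mu> (borel_on X) (\<lambda>x. x) = \<mu>"
    by (rule distr_id2) (simp add: borel_probsD[OF \<mu>])
  then show "?\<gamma> \<in> couplings X \<mu> (distr \<mu> (borel_on X) T)"
    using \<gamma> by (simp add: couplings_def distr_distr[OF mm(1) m] distr_distr[OF mm(2) m] comp_def)
qed

lemma couplings_swap:
  fixes X :: "'a::second_countable_topology set"
  assumes \<gamma>: "\<gamma> \<in> couplings X \<mu> \<rho>"
  shows "distr \<gamma> (borel_on (X \<times> X)) (\<lambda>z. (snd z, fst z)) \<in> couplings X \<rho> \<mu>"
    and "(\<lambda>z. (snd z, fst z)) \<in> measurable \<gamma> (borel_on (X \<times> X))"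
proof -
  note \<gamma>b = couplingsD(1)[OF \<gamma>]
  interpret \<gamma>: prob_space \<gamma> using borel_probsD[OF \<gamma>b] by simp
  note m = measurable_fst_snd_restrict_borel[OF \<gamma>b]
  show sw: "(\<lambda>z. (snd z, fst z)) \<in> measurable \<gamma> (borel_on (X \<times> X))"
    using measurable_Pair[OF m(2,1)] measurable_cong_sets[OF refl sets_pair_restrict_borel[of X X], of \<gamma>]
    by simp
  have s: "distr \<gamma> (borel_on (X \<times> X)) (\<lambda>z. (snd z, fst z)) \<in> borel_probs (X \<times> X)"
    using \<gamma>.prob_space_distr[OF sw] by (simp add: borel_probs_def)
  have mm: "fst \<in> measurable (borel_on (X \<times> X)) (borel_on X)"
    "snd \<in> measurable (borel_on (X \<times> X)) (borel_on X)"
    using m by (simp_all add: measurable_borel_probs[OF \<gamma>b])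
  show "distr \<gamma> (borel_on (X \<times> X)) (\<lambda>z. (snd z, fst z)) \<in> couplings X \<rho> \<mu>"
    using s couplingsD(2,3)[OF \<gamma>]
    by (simp add: couplings_def distr_distr[OF mm(1) sw] distr_distr[OF mm(2) sw] comp_def)
qed

lemma coupling_cost_integrable:
  fixes X :: "'a::second_countable_topology set" and c :: "'a \<Rightarrow> 'a \<Rightarrow> real"
  assumes "compact X" "continuous_on (X \<times> X) (\<lambda>z. c (fst z) (snd z))" "\<gamma> \<in> couplings X \<mu> \<rho>"
  shows "integrable \<gamma> (\<lambda>z. c (fst z) (snd z))"
  using assms couplingsD(1) by (intro continuous_on_integrable_borel_probs[of _ "X \<times> X"] compact_Times) auto

lemma transport_cost_le:
  fixes X :: "'a::second_countable_topology set" and c :: "'a \<Rightarrow> 'a \<Rightarrow> real"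
  assumes X: "compact X" and c: "continuous_on (X \<times> X) (\<lambda>z. c (fst z) (snd z))"
    and \<gamma>: "\<gamma> \<in> couplings X \<mu> \<rho>"
  shows "transport_cost X c \<mu> \<rho> \<le> (\<integral>z. c (fst z) (snd z) \<partial>\<gamma>)"
proof -
  have "bounded ((\<lambda>z. c (fst z) (snd z)) ` (X \<times> X))"
    using X c by (intro compact_imp_bounded compact_continuous_image compact_Times)
  then obtain B where B: "\<And>z. z \<in> X \<times> X \<Longrightarrow> \<bar>c (fst z) (snd z)\<bar> \<le> B"
    unfolding bounded_iff by fastforce
  have "- B \<le> (\<integral>z. c (fst z) (snd z) \<partial>\<gamma>')" if \<gamma>': "\<gamma>' \<in> couplings X \<mu> \<rho>" for \<gamma>'
  proof -
    interpret prob_space \<gamma>' using borel_probsD(1) couplingsD(1)[OF \<gamma>'] by blast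
    have "- B = (\<integral>z. - B \<partial>\<gamma>')" by (simp add: prob_space)
    also have "\<dots> \<le> (\<integral>z. c (fst z) (snd z) \<partial>\<gamma>')"
      using B borel_probsD(3)[OF couplingsD(1)[OF \<gamma>']]
      by (intro integral_mono coupling_cost_integrable[OF X c \<gamma>']) (auto simp: abs_le_iff minus_le_iff)
    finally show ?thesis .
  qed
  then show ?thesis
    unfolding transport_cost_def using \<gamma> by (intro cINF_lower bdd_belowI2) auto
qed

lemma transport_cost_greatest:
  fixes X :: "'a::second_countable_topology set"
  assumes "\<mu> \<in> borel_probs X" "\<rho> \<in> borel_probs X"
    and "\<And>\<gamma>. \<gamma> \<in> couplings X \<mu> \<rho> \<Longrightarrow> m \<le> (\<integral>z. c (fst z) (snd z) \<partial>\<gamma>)"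
  shows "m \<le> transport_cost X c \<mu> \<rho>"
  unfolding transport_cost_def using assms couplings_nonempty by (intro cINF_greatest) auto

lemma coupling_dual_le:
  fixes X :: "'a::second_countable_topology set" and c :: "'a \<Rightarrow> 'a \<Rightarrow> real"
  assumes X: "compact X" and c: "continuous_on (X \<times> X) (\<lambda>z. c (fst z) (snd z))"
    and \<gamma>: "\<gamma> \<in> couplings X \<mu> \<rho>" and \<psi>: "integrable \<mu> \<psi>" and \<phi>: "integrable \<rho> \<phi>"
    and le: "\<And>x y. x \<in> X \<Longrightarrow> y \<in> X \<Longrightarrow> \<psi> x + \<phi> y \<le> c x y"
  shows "(\<integral>x. \<psi> x \<partial>\<mu>) + (\<integral>y. \<phi> y \<partial>\<rho>) \<le> (\<integral>z. c (fst z) (snd z) \<partial>\<gamma>)"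
proof -
  note i = coupling_marginals(3)[OF \<gamma> \<psi>] coupling_marginals(4)[OF \<gamma> \<phi>]
  have "(\<integral>x. \<psi> x \<partial>\<mu>) + (\<integral>y. \<phi> y \<partial>\<rho>) = (\<integral>z. \<psi> (fst z) + \<phi> (snd z) \<partial>\<gamma>)"
    using coupling_marginals(1)[OF \<gamma>, of \<psi>] coupling_marginals(2)[OF \<gamma>, of \<phi>] \<psi> \<phi> i by simp
  also have "\<dots> \<le> (\<integral>z. c (fst z) (snd z) \<partial>\<gamma>)"
    using le borel_probsD(3)[OF couplingsD(1)[OF \<gamma>]] i
    by (intro integral_mono Bochner_Integration.integrable_add coupling_cost_integrable[OF X c \<gamma>]) auto
  finally show ?thesis .
qed

text \<open>Weak duality: both integrals can be taken with respect to any coupling.\<close>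

lemma dual_le_transport_cost:
  fixes X :: "'a::second_countable_topology set" and c :: "'a \<Rightarrow> 'a \<Rightarrow> real"
  assumes "compact X" "continuous_on (X \<times> X) (\<lambda>z. c (fst z) (snd z))"
    and "\<mu> \<in> borel_probs X" "\<rho> \<in> borel_probs X" "integrable \<mu> \<psi>" "integrable \<rho> \<phi>"
    and "\<And>x y. x \<in> X \<Longrightarrow> y \<in> X \<Longrightarrow> \<psi> x + \<phi> y \<le> c x y"
  shows "(\<integral>x. \<psi> x \<partial>\<mu>) + (\<integral>y. \<phi> y \<partial>\<rho>) \<le> transport_cost X c \<mu> \<rho>"
  using assms by (intro transport_cost_greatest coupling_dual_le)

lemma transport_cost_map_le:
  fixes X :: "'a::second_countable_topology set" and c :: "'a \<Rightarrow> 'a \<Rightarrow> real"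
  assumes X: "compact X" and c: "continuous_on (X \<times> X) (\<lambda>z. c (fst z) (snd z))"
    and \<mu>: "\<mu> \<in> borel_probs X" and T: "T \<in> measurable \<mu> (borel_on X)"
  shows "transport_cost X c \<mu> (distr \<mu> (borel_on X) T) \<le> (\<integral>x. c x (T x) \<partial>\<mu>)"
    and "integrable \<mu> (\<lambda>x. c x (T x))"
proof -
  note m = map_coupling[OF \<mu> T]
  have meas: "(\<lambda>z. c (fst z) (snd z)) \<in> borel_measurable (borel_on (X \<times> X))"
    by (rule borel_measurable_continuous_on_restrict[OF c])
  show "transport_cost X c \<mu> (distr \<mu> (borel_on X) T) \<le> (\<integral>x. c x (T x) \<partial>\<mu>)"
    using transport_cost_le[OF X c m(1)] integral_distr[OF m(2) meas] by simp
  show "integrable \<mu> (\<lambda>x. c x (T x))"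
    using coupling_cost_integrable[OF X c m(1)] integrable_distr_eq[OF m(2) meas] by simp
qed

lemma transport_cost_sym_le:
  fixes X :: "'a::second_countable_topology set" and c :: "'a \<Rightarrow> 'a \<Rightarrow> real"
  assumes X: "compact X" and c: "continuous_on (X \<times> X) (\<lambda>z. c (fst z) (snd z))"
    and sym: "\<And>x y. c x y = c y x"
    and "\<mu> \<in> borel_probs X" "\<rho> \<in> borel_probs X"
  shows "transport_cost X c \<mu> \<rho> \<le> transport_cost X c \<rho> \<mu>"
proof (rule transport_cost_greatest)
  fix \<gamma> assume \<gamma>: "\<gamma> \<in> couplings X \<rho> \<mu>"
  note m = couplings_swap[OF \<gamma>]
  have meas: "(\<lambda>z. c (fst z) (snd z)) \<in> borel_measurable (borel_on (X \<times> X))"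
    by (rule borel_measurable_continuous_on_restrict[OF c])
  show "transport_cost X c \<mu> \<rho> \<le> (\<integral>z. c (fst z) (snd z) \<partial>\<gamma>)"
    using transport_cost_le[OF X c m(1)] integral_distr[OF m(2) meas] sym by simp
qed (use assms in auto)

lemma half_wasserstein2_sq:
  fixes X :: "'a::{real_normed_vector, second_countable_topology} set"
  assumes X: "compact X" and \<mu>: "\<mu> \<in> borel_probs X" and \<rho>: "\<rho> \<in> borel_probs X"
  shows "1 / 2 * (wasserstein X 2 \<mu> \<rho>)\<^sup>2 = transport_cost X c2 \<mu> \<rho>"
proof -
  let ?p = "\<lambda>x y :: 'a. norm (x - y) powr 2"
  have p: "?p x y = 2 * c2 x y" for x y by (simp add: c2_def)
  have c: "continuous_on (X \<times> X) (\<lambda>z. c2 (fst z) (snd z))"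
    unfolding c2_def by (intro continuous_intros)
  then have cp: "continuous_on (X \<times> X) (\<lambda>z. ?p (fst z) (snd z))"
    unfolding p by (intro continuous_intros)
  have "0 \<le> transport_cost X ?p \<mu> \<rho>"
    by (intro transport_cost_greatest[OF \<mu> \<rho>]) simp
  then have "(wasserstein X 2 \<mu> \<rho>)\<^sup>2 = transport_cost X ?p \<mu> \<rho>"
    unfolding wasserstein_def by (simp add: powr_half_sqrt)
  moreover have "transport_cost X ?p \<mu> \<rho> / 2 \<le> transport_cost X c2 \<mu> \<rho>"
  proof (intro transport_cost_greatest[OF \<mu> \<rho>])
    fix \<gamma> assume "\<gamma> \<in> couplings X \<mu> \<rho>"
    from transport_cost_le[OF X cp this] show "transport_cost X ?p \<mu> \<rho> / 2 \<le> (\<integral>z. c2 (fst z) (snd z) \<partial>\<gamma>)"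
      by (simp only: p) simp
  qed
  moreover have "2 * transport_cost X c2 \<mu> \<rho> \<le> transport_cost X ?p \<mu> \<rho>"
  proof (intro transport_cost_greatest[OF \<mu> \<rho>])
    fix \<gamma> assume "\<gamma> \<in> couplings X \<mu> \<rho>"
    from transport_cost_le[OF X c this] show "2 * transport_cost X c2 \<mu> \<rho> \<le> (\<integral>z. ?p (fst z) (snd z) \<partial>\<gamma>)"
      by (simp only: p) simp
  qed
  ultimately show ?thesis by simp
qed

lemma wasserstein1:
  fixes X :: "'a::{real_normed_vector, second_countable_topology} set"
  assumes "\<mu> \<in> borel_probs X" "\<rho> \<in> borel_probs X"
  shows "wasserstein X 1 \<mu> \<rho> = transport_cost X (\<lambda>x y. norm (x - y)) \<mu> \<rho>"
proof -
  have "0 \<le> transport_cost X (\<lambda>x y. norm (x - y)) \<mu> \<rho>"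
    using assms by (intro transport_cost_greatest) auto
  then show ?thesis by (simp add: wasserstein_def)
qed

section \<open>Strong duality up to a small gap\<close>

text \<open>Duality for the finite transport problem, with a gap. Replace the constraint \<open>\<psi> i \<le> min\<^sub>j (c i j - \<phi> j)\<close> by the soft
minimum \<open>\<psi> i = - \<tau> ln (\<Sum>j. exp ((\<phi> j - c i j) / \<tau>))\<close>, which lies below the true minimum, so feasibility is
preserved. The dual functional \<open>G\<close> becomes smooth. At its maximum the vanishing partial derivatives are the column
constraints for the conditional probabilities \<open>s i j = exp ((\<psi> i + \<phi> j - c i j) / \<tau>)\<close>. Solving this formula for
\<open>c i j\<close> shows that the gap is \<open>\<tau>\<close> times an entropy, and \<open>- s ln s \<le> 1\<close> bounds the entropy by the number of columns.\<close>

lemma finite_transport_duality: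
  fixes a :: "'i \<Rightarrow> real" and b :: "'j \<Rightarrow> real" and c :: "'i \<Rightarrow> 'j \<Rightarrow> real"
  assumes I: "finite I" and J: "finite J"
    and a: "\<And>i. i \<in> I \<Longrightarrow> a i \<ge> 0" "sum a I = 1"
    and b: "\<And>j. j \<in> J \<Longrightarrow> b j > 0" "sum b J = 1" and "e > 0"
  obtains s \<phi> \<psi> where "\<And>i j. i \<in> I \<Longrightarrow> j \<in> J \<Longrightarrow> s i j \<ge> 0"
    "\<And>i. i \<in> I \<Longrightarrow> (\<Sum>j\<in>J. s i j) = 1" "\<And>j. j \<in> J \<Longrightarrow> (\<Sum>i\<in>I. a i * s i j) = b j"
    "\<And>i j. i \<in> I \<Longrightarrow> j \<in> J \<Longrightarrow> \<psi> i + \<phi> j \<le> c i j"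
    "(\<Sum>i\<in>I. \<Sum>j\<in>J. a i * s i j * c i j) \<le> (\<Sum>i\<in>I. a i * \<psi> i) + (\<Sum>j\<in>J. b j * \<phi> j) + e"
proof -
  have Jne: "J \<noteq> {}" using b by auto
  define \<tau> where "\<tau> = e / card J"
  have \<tau>: "\<tau> > 0" using \<open>e > 0\<close> Jne J by (simp add: \<tau>_def card_gt_0_iff)
  define Z where "Z = (\<lambda>\<phi> i. \<Sum>j\<in>J. exp ((\<phi> j - c i j) / \<tau>))"
  define G where "G = (\<lambda>\<phi>. (\<Sum>j\<in>J. b j * \<phi> j) - \<tau> * (\<Sum>i\<in>I. a i * ln (Z \<phi> i)))"
  have Zpos: "Z \<phi> i > 0" for \<phi> i
    unfolding Z_def using J Jne by (intro sum_pos) auto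
  have term_le: "(\<phi> j - c i j) / \<tau> \<le> ln (Z \<phi> i)" if "j \<in> J" for \<phi> i j
  proof -
    have "exp ((\<phi> j - c i j) / \<tau>) \<le> Z \<phi> i"
      unfolding Z_def using J that by (intro member_le_sum) auto
    then show ?thesis using Zpos[of \<phi> i] by (simp add: ln_ge_iff)
  qed
  have G_cong: "G \<phi> = G \<phi>'" if "\<And>j. j \<in> J \<Longrightarrow> \<phi> j = \<phi>' j" for \<phi> \<phi>'
    unfolding G_def Z_def using that by simp
  have G_shift: "G (\<lambda>j. \<phi> j + k) = G \<phi>" for \<phi> k
  proof -
    have "Z (\<lambda>j. \<phi> j + k) i = exp (k / \<tau>) * Z \<phi> i" for i
      unfolding Z_def sum_distrib_left
      by (intro sum.cong refl) (simp add: mult_exp_exp diff_divide_distrib add_divide_distrib algebra_simps)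
    then have "ln (Z (\<lambda>j. \<phi> j + k) i) = k / \<tau> + ln (Z \<phi> i)" for i
      using Zpos[of \<phi> i] by (simp add: ln_mult)
    moreover have "(\<Sum>i\<in>I. a i * (k / \<tau>)) = k / \<tau>" "(\<Sum>j\<in>J. b j * k) = k"
      using a(2) b(2) by (simp_all flip: sum_distrib_right sum_divide_distrib)
    ultimately show ?thesis
      unfolding G_def using \<tau> by (simp add: distrib_left sum.distrib)
  qed
  \<comment> \<open>The maximum over a large box is global: after a shift the smallest coordinate is 0, and a large
    largest coordinate makes G small because every weight is positive.\<close>
  define C where "C = (\<Sum>i\<in>I. \<Sum>j\<in>J. \<bar>c i j\<bar>)"
  have C: "c i j \<le> C" if "i \<in> I" "j \<in> J" for i j
  proof -
    have "\<bar>c i j\<bar> \<le> (\<Sum>j\<in>J. \<bar>c i j\<bar>)" using J that by (intro member_le_sum) auto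
    also have "\<dots> \<le> C" unfolding C_def using I that
      by (intro member_le_sum[of i I "\<lambda>i. \<Sum>j\<in>J. \<bar>c i j\<bar>"]) (auto intro!: sum_nonneg)
    finally show ?thesis by simp
  qed
  define \<beta> where "\<beta> = Min (b ` J)"
  have \<beta>: "\<beta> > 0" "\<And>j. j \<in> J \<Longrightarrow> \<beta> \<le> b j"
    unfolding \<beta>_def using J Jne b by auto
  define R where "R = max 0 ((C - G (\<lambda>_. 0)) / \<beta>)"
  define K :: "('j \<Rightarrow> real) set" where "K = (\<Pi>\<^sub>E j\<in>UNIV. if j \<in> J then {0..R} else {0})"
  have "compactin (product_topology (\<lambda>_. euclidean) UNIV) K"
    unfolding K_def compactin_PiE by auto
  then have "compact K" by (simp add: euclidean_product_topology)
  moreover have K0: "(\<lambda>_. 0) \<in> K" by (auto simp: K_def R_def)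
  moreover have "continuous_on K G"
    unfolding G_def Z_def
    by (intro continuous_intros continuous_on_subset[OF continuous_on_product_coordinates])
       (use Zpos \<tau> in \<open>auto simp: Z_def less_imp_neq[symmetric]\<close>)
  ultimately obtain \<phi> where \<phi>: "\<phi> \<in> K" "\<And>\<phi>'. \<phi>' \<in> K \<Longrightarrow> G \<phi>' \<le> G \<phi>"
    using continuous_attains_sup[of K G] by auto
  have max: "G \<phi>' \<le> G \<phi>" for \<phi>'
  proof -
    define m where "m = Min (\<phi>' ` J)"
    define \<eta> where "\<eta> = (\<lambda>j. if j \<in> J then \<phi>' j + - m else 0)"
    have "G \<eta> = G \<phi>'" using G_cong[of \<eta> "\<lambda>j. \<phi>' j + - m"] G_shift[of \<phi>' "-m"] by (auto simp: \<eta>_def)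
    moreover have "G \<eta> \<le> G \<phi>"
    proof (cases "\<eta> \<in> K")
      case False
      have \<eta>0: "\<eta> j \<ge> 0" for j using J by (auto simp: \<eta>_def m_def)
      obtain j0 where j0: "j0 \<in> J" "\<phi>' j0 = m" using Min_in[of "\<phi>' ` J"] J Jne unfolding m_def by fastforce
      define M where "M = Max (\<eta> ` J)"
      obtain k where k: "k \<in> J" "\<eta> k = M" using Max_in[of "\<eta> ` J"] J Jne unfolding M_def by fastforce
      have M: "\<eta> j \<le> M" if "j \<in> J" for j using that J by (auto simp: M_def)
      have "R < M"
      proof (rule ccontr)
        assume "\<not> R < M"
        then have "\<eta> j \<le> R" if "j \<in> J" for j using M[OF that] by simp
        moreover have "\<eta> j = 0" if "j \<notin> J" for j using that by (simp add: \<eta>_def)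
        ultimately have "\<eta> \<in> K" using \<eta>0 by (simp add: K_def PiE_iff)
        with False show False by simp
      qed
      have "(\<Sum>i\<in>I. a i * ((M - C) / \<tau>)) \<le> (\<Sum>i\<in>I. a i * ln (Z \<eta> i))"
      proof (intro sum_mono mult_left_mono a)
        fix i assume "i \<in> I"
        have "(M - C) / \<tau> \<le> (\<eta> k - c i k) / \<tau>" using C[OF \<open>i \<in> I\<close> k(1)] k \<tau> by (simp add: divide_right_mono)
        then show "(M - C) / \<tau> \<le> ln (Z \<eta> i)" using term_le[OF k(1), of \<eta> i] by simp
      qed
      then have 1: "M - C \<le> \<tau> * (\<Sum>i\<in>I. a i * ln (Z \<eta> i))"
        using a(2) \<tau> by (subst (asm) sum_distrib_right[symmetric]) (simp add: pos_divide_le_eq mult.commute)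
      have "(\<Sum>j\<in>J. b j * \<eta> j) = (\<Sum>j\<in>J - {j0}. b j * \<eta> j)"
        using J j0 by (subst sum.remove[of J j0]) (auto simp: \<eta>_def)
      also have "\<dots> \<le> (\<Sum>j\<in>J - {j0}. b j * M)"
        using b M by (intro sum_mono mult_left_mono) (auto intro: less_imp_le)
      also have "\<dots> = (1 - b j0) * M"
        using J j0 b(2) by (simp flip: sum_distrib_right add: sum_diff1)
      also have "\<dots> \<le> (1 - \<beta>) * M"
        using \<beta>(2)[OF j0(1)] \<open>R < M\<close> by (intro mult_right_mono) (auto simp: R_def)
      finally have "G \<eta> \<le> C - \<beta> * M" using 1 by (simp add: G_def algebra_simps)
      also have "(C - G (\<lambda>_. 0)) / \<beta> \<le> M" using \<open>R < M\<close> by (simp add: R_def)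
      then have "C - \<beta> * M \<le> G (\<lambda>_. 0)" using \<beta>(1) by (simp add: pos_divide_le_eq mult.commute)
      finally show ?thesis using \<phi>(2)[OF K0] by simp
    qed (use \<phi> in auto)
    ultimately show ?thesis by simp
  qed
  define s where "s = (\<lambda>i j. exp ((\<phi> j - c i j) / \<tau>) / Z \<phi> i)"
  have spos: "s i j > 0" for i j using Zpos by (simp add: s_def)
  have s1: "(\<Sum>j\<in>J. s i j) = 1" for i
    using Zpos[of \<phi> i] by (simp add: s_def Z_def flip: sum_divide_distrib)
  have marg: "(\<Sum>i\<in>I. a i * s i j) = b j" if "j \<in> J" for j
  proof -
    define d where "d = (\<lambda>k. if k = j then 1 else 0 :: real)"
    define f where "f = (\<lambda>t. G (\<lambda>k. \<phi> k + t * d k))"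
    have "(f has_real_derivative (\<Sum>k\<in>J. b k * d k) -
        \<tau> * (\<Sum>i\<in>I. a i * ((\<Sum>k\<in>J. exp ((\<phi> k - c i k) / \<tau>) * (d k / \<tau>)) / Z \<phi> i))) (at 0)"
      unfolding f_def G_def Z_def using Zpos[of \<phi>, unfolded Z_def] \<tau>
      by (auto intro!: derivative_eq_intros sum.cong simp: field_simps)
    then have "(\<Sum>k\<in>J. b k * d k) -
        \<tau> * (\<Sum>i\<in>I. a i * ((\<Sum>k\<in>J. exp ((\<phi> k - c i k) / \<tau>) * (d k / \<tau>)) / Z \<phi> i)) = 0"
      by (rule DERIV_local_max[of _ _ _ 1]) (use max in \<open>auto simp: f_def\<close>)
    moreover have "(\<Sum>k\<in>J. b k * d k) = b j" using J that by (simp add: d_def if_distrib[of "\<lambda>x. _ * x"] cong: if_cong)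
    moreover have "(\<Sum>k\<in>J. exp ((\<phi> k - c i k) / \<tau>) * (d k / \<tau>)) = exp ((\<phi> j - c i j) / \<tau>) / \<tau>" for i
      using J that by (simp add: d_def if_distrib[of "\<lambda>x. x / \<tau>"] if_distrib[of "\<lambda>x. _ * x"] cong: if_cong)
    ultimately have "b j - \<tau> * (\<Sum>i\<in>I. a i * (exp ((\<phi> j - c i j) / \<tau>) / \<tau> / Z \<phi> i)) = 0" by simp
    then show ?thesis using \<tau> by (simp add: s_def sum_distrib_left)
  qed
  define \<psi> where "\<psi> = (\<lambda>i. - \<tau> * ln (Z \<phi> i))"
  have feas: "\<psi> i + \<phi> j \<le> c i j" if "j \<in> J" for i j
    using term_le[OF that, of \<phi> i] \<tau> by (simp add: \<psi>_def pos_divide_le_eq algebra_simps)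
  have cost: "s i j * c i j \<le> s i j * \<psi> i + s i j * \<phi> j + \<tau>" for i j
  proof -
    have "ln (s i j) = (\<phi> j - c i j) / \<tau> - ln (Z \<phi> i)"
      using Zpos[of \<phi> i] by (simp add: s_def ln_div)
    then have "\<tau> * ln (s i j) = \<tau> * ((\<phi> j - c i j) / \<tau>) - \<tau> * ln (Z \<phi> i)"
      by (simp only: right_diff_distrib)
    then have "c i j = \<phi> j + \<psi> i - \<tau> * ln (s i j)" using \<tau> by (simp add: \<psi>_def)
    then have "s i j * c i j = s i j * (\<phi> j + \<psi> i - \<tau> * ln (s i j))" by simp
    moreover have "- ln (s i j) \<le> 1 / s i j - 1"
      using ln_le_minus_one[of "1 / s i j"] spos[of i j] by (simp add: ln_div)
    then have "s i j * - ln (s i j) \<le> s i j * (1 / s i j - 1)"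
      using spos[of i j] by (intro mult_left_mono) auto
    then have "s i j * - ln (s i j) \<le> 1" using spos[of i j] by (simp add: algebra_simps)
    then have "\<tau> * (s i j * - ln (s i j)) \<le> \<tau> * 1" using \<tau> by (intro mult_left_mono) auto
    then have "- (s i j * (\<tau> * ln (s i j))) \<le> \<tau>" by (simp add: mult_ac)
    ultimately show ?thesis by (simp add: algebra_simps)
  qed
  have "(\<Sum>i\<in>I. \<Sum>j\<in>J. a i * s i j * c i j) = (\<Sum>i\<in>I. a i * (\<Sum>j\<in>J. s i j * c i j))"
    by (simp add: sum_distrib_left mult.assoc)
  also have "\<dots> \<le> (\<Sum>i\<in>I. a i * (\<Sum>j\<in>J. s i j * \<psi> i + s i j * \<phi> j + \<tau>))"
    by (intro sum_mono mult_left_mono a cost)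
  also have "\<dots> = (\<Sum>i\<in>I. a i * (\<psi> i + (\<Sum>j\<in>J. s i j * \<phi> j) + e))"
    using J Jne s1 by (simp add: sum.distrib \<tau>_def flip: sum_distrib_right)
  also have "\<dots> = (\<Sum>i\<in>I. a i * \<psi> i) + (\<Sum>i\<in>I. \<Sum>j\<in>J. a i * s i j * \<phi> j) + e"
    using a(2) by (simp add: distrib_left sum.distrib sum_distrib_left mult.assoc flip: sum_distrib_right)
  also have "(\<Sum>i\<in>I. \<Sum>j\<in>J. a i * s i j * \<phi> j) = (\<Sum>j\<in>J. b j * \<phi> j)"
    by (subst sum.swap) (simp add: marg flip: sum_distrib_right)
  finally show ?thesis using that[of s \<psi> \<phi>] spos s1 marg feas by (auto intro: less_imp_le)
qed

text \<open>A finite Borel partition into small cells, given by the function \<open>r\<close> that names the cell of a point: the index of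
the first ball of a finite cover that contains it.\<close>

lemma finite_borel_classifier:
  fixes X :: "'a::{metric_space, second_countable_topology} set"
  assumes X: "compact X" and "\<delta> > 0"
  obtains r :: "'a \<Rightarrow> nat" and N p where "r \<in> measurable (borel_on X) (count_space UNIV)"
    "\<And>x. x \<in> X \<Longrightarrow> r x < N" "\<And>x. x \<in> X \<Longrightarrow> dist x (p (r x)) < \<delta>" "\<And>i. i < N \<Longrightarrow> p i \<in> X"
proof -
  obtain F where F: "finite F" "F \<subseteq> X" "X \<subseteq> (\<Union>x\<in>F. ball x \<delta>)"
    using seq_compact_imp_totally_bounded[of X] X \<open>\<delta> > 0\<close> compact_imp_seq_compact by blast
  obtain xs where xs: "set xs = F" using F(1) finite_list by blast
  define r where "r = (\<lambda>x. LEAST i. i < length xs \<and> dist x (xs ! i) < \<delta>)"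
  have r: "r x < length xs \<and> dist x (xs ! r x) < \<delta>" if "x \<in> X" for x
  proof -
    have "x \<in> (\<Union>y\<in>F. ball y \<delta>)" using F(3) that by (rule subsetD)
    then obtain y where "y \<in> F" "x \<in> ball y \<delta>" by (rule UN_E)
    then have "y \<in> set xs" "dist x y < \<delta>" by (simp_all add: xs dist_commute)
    then have "\<exists>i. i < length xs \<and> dist x (xs ! i) < \<delta>" by (auto simp: in_set_conv_nth)
    then show ?thesis unfolding r_def by (rule LeastI_ex)
  qed
  moreover have "r \<in> measurable (borel_on X) (count_space UNIV)"
    unfolding r_def by (intro measurable_restrict_space1) measurable
  ultimately show ?thesis using that[of r "length xs" "\<lambda>i. xs ! i"] F(2) xs by (auto simp: subset_eq)
qed

lemma integral_finite_range:
  fixes r :: "'a \<Rightarrow> nat" and u :: "nat \<Rightarrow> real"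
  assumes "prob_space M" and r: "r \<in> measurable M (count_space UNIV)" "\<And>x. x \<in> space M \<Longrightarrow> r x < N"
  shows "integrable M (\<lambda>x. u (r x))"
    and "(\<integral>x. u (r x) \<partial>M) = (\<Sum>i<N. measure M {x \<in> space M. r x = i} * u i)"
    and "(\<And>i. i < N \<Longrightarrow> u i \<ge> 0) \<Longrightarrow>
      (\<integral>\<^sup>+x. ennreal (u (r x)) \<partial>M) = ennreal (\<Sum>i<N. measure M {x \<in> space M. r x = i} * u i)"
proof -
  interpret prob_space M by fact
  have A: "{x \<in> space M. r x = i} \<in> sets M" for i using r(1) by measurable
  have eq: "u (r x) = (\<Sum>i<N. u i * indicator {x \<in> space M. r x = i} x)" if "x \<in> space M" for x
  proof -
    have "(\<Sum>i<N. u i * indicator {x \<in> space M. r x = i} x) = (\<Sum>i<N. if i = r x then u i else 0)"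
      using that by (intro sum.cong) (auto simp: indicator_def)
    then show ?thesis using r(2)[OF that] by simp
  qed
  have i: "integrable M (\<lambda>x. \<Sum>i<N. u i * indicator {x \<in> space M. r x = i} x)"
    using A by (intro Bochner_Integration.integrable_sum integrable_mult_right) (auto simp: integrable_indicator_iff emeasure_eq_measure)
  then show int: "integrable M (\<lambda>x. u (r x))"
    using eq by (subst Bochner_Integration.integrable_cong[OF refl]) auto
  have "(\<integral>x. u (r x) \<partial>M) = (\<integral>x. (\<Sum>i<N. u i * indicator {x \<in> space M. r x = i} x) \<partial>M)"
    using eq by (intro Bochner_Integration.integral_cong) auto
  also have "\<dots> = (\<Sum>i<N. measure M {x \<in> space M. r x = i} * u i)"
    using A by (subst Bochner_Integration.integral_sum) (auto simp: integrable_indicator_iff emeasure_eq_measure mult.commute)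
  finally show *: "(\<integral>x. u (r x) \<partial>M) = (\<Sum>i<N. measure M {x \<in> space M. r x = i} * u i)" .
  assume "\<And>i. i < N \<Longrightarrow> u i \<ge> 0"
  then show "(\<integral>\<^sup>+x. ennreal (u (r x)) \<partial>M) = ennreal (\<Sum>i<N. measure M {x \<in> space M. r x = i} * u i)"
    using r(2) by (subst nn_integral_eq_integral[OF int]) (auto simp: *)
qed

text \<open>Cut \<open>X\<close> into cells on which the uniformly continuous cost varies by at most \<open>e / 4\<close> and solve the finite problem
between the cell masses. Its solution is spread over the cells in proportion to \<open>\<mu> \<otimes> \<nu>\<close>, which keeps the marginals
and changes the cost by at most \<open>e / 4\<close>; the dual step functions are lowered by \<open>e / 4\<close> to stay below \<open>c\<close>.\<close>

lemma approximate_transport_duality: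
  fixes X :: "'a::{metric_space, second_countable_topology} set" and c :: "'a \<Rightarrow> 'a \<Rightarrow> real"
  assumes X: "compact X" and c: "continuous_on (X \<times> X) (\<lambda>z. c (fst z) (snd z))"
    and \<mu>: "\<mu> \<in> borel_probs X" and \<nu>: "\<nu> \<in> borel_probs X" and e: "e > 0"
  obtains \<gamma> \<psi> \<phi> where "\<gamma> \<in> couplings X \<mu> \<nu>" "integrable \<mu> \<psi>" "integrable \<nu> \<phi>"
    "bounded (\<psi> ` X)" "\<And>x z. x \<in> X \<Longrightarrow> z \<in> X \<Longrightarrow> \<psi> x + \<phi> z \<le> c x z"
    "(\<integral>z. c (fst z) (snd z) \<partial>\<gamma>) \<le> (\<integral>x. \<psi> x \<partial>\<mu>) + (\<integral>z. \<phi> z \<partial>\<nu>) + e"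
proof -
  interpret \<mu>: prob_space \<mu> using borel_probsD[OF \<mu>] by simp
  interpret \<nu>: prob_space \<nu> using borel_probsD[OF \<nu>] by simp
  interpret P: pair_prob_space \<mu> \<nu> ..
  have sp: "space \<mu> = X" "space \<nu> = X" using borel_probsD(3) \<mu> \<nu> by auto
  obtain d where d: "d > 0" "\<And>z z'. z \<in> X \<times> X \<Longrightarrow> z' \<in> X \<times> X \<Longrightarrow> dist z' z < d \<Longrightarrow>
      \<bar>c (fst z') (snd z') - c (fst z) (snd z)\<bar> < e / 4"
  proof -
    have "uniformly_continuous_on (X \<times> X) (\<lambda>z. c (fst z) (snd z))"
      using c X compact_uniformly_continuous compact_Times by blast
    then show ?thesis
      unfolding uniformly_continuous_on_def dist_real_def using that e
      by (metis divide_pos_pos zero_less_numeral)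
  qed
  have "d / 2 > 0" using d by simp
  then obtain r :: "'a \<Rightarrow> nat" and N p where r: "r \<in> measurable (borel_on X) (count_space UNIV)"
    "\<And>x. x \<in> X \<Longrightarrow> r x < N" "\<And>x. x \<in> X \<Longrightarrow> dist x (p (r x)) < d / 2" "\<And>i. i < N \<Longrightarrow> p i \<in> X"
    by (rule finite_borel_classifier[OF X]) blast
  define k where "k = (\<lambda>i j. c (p i) (p j))"
  have k: "\<bar>c x z - k (r x) (r z)\<bar> \<le> e / 4" if "x \<in> X" "z \<in> X" for x z
  proof -
    have "dist (x, z) (p (r x), p (r z)) \<le> dist x (p (r x)) + dist z (p (r z))"
      by (simp add: dist_Pair_Pair sqrt_sum_squares_le_sum)
    also have "\<dots> < d" using r(3)[OF that(1)] r(3)[OF that(2)] by simp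
    finally show ?thesis
      using d(2)[of "(p (r x), p (r z))" "(x, z)"] that r by (simp add: k_def)
  qed
  have r\<mu>: "r \<in> measurable \<mu> (count_space UNIV)" "\<And>x. x \<in> space \<mu> \<Longrightarrow> r x < N"
    and r\<nu>: "r \<in> measurable \<nu> (count_space UNIV)" "\<And>x. x \<in> space \<nu> \<Longrightarrow> r x < N"
    using r by (simp_all add: sp measurable_borel_probs[OF \<mu>] measurable_borel_probs[OF \<nu>])
  note int\<mu> = integral_finite_range[OF \<mu>.prob_space_axioms r\<mu>]
  note int\<nu> = integral_finite_range[OF \<nu>.prob_space_axioms r\<nu>]
  define a where "a = (\<lambda>i. measure \<mu> {x \<in> space \<mu>. r x = i})"
  define b where "b = (\<lambda>j. measure \<nu> {x \<in> space \<nu>. r x = j})"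
  define J where "J = {j. j < N \<and> b j > 0}"
  have J: "finite J" "J \<subseteq> {..<N}" by (auto simp: J_def)
  have bJ: "b j = 0" if "j \<notin> J" "j < N" for j
    using that measure_nonneg[of \<nu>] by (auto simp: J_def b_def less_le)
  have aN: "sum a {..<N} = 1" using int\<mu>(2)[of "\<lambda>_. 1"] by (simp add: a_def \<mu>.prob_space)
  have "sum b {..<N} = 1" using int\<nu>(2)[of "\<lambda>_. 1"] by (simp add: b_def \<nu>.prob_space)
  moreover have sumJ: "(\<Sum>j<N. b j * g j) = (\<Sum>j\<in>J. b j * g j)" for g :: "nat \<Rightarrow> real"
    using J bJ by (intro sum.mono_neutral_right) auto
  ultimately have bN: "sum b J = 1" using sumJ[of "\<lambda>_. 1"] by simp
  have "e / 4 > 0" using e by simp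
  have a0: "0 \<le> a i" if "i \<in> {..<N}" for i by (simp add: a_def)
  have b0: "0 < b j" if "j \<in> J" for j using that by (simp add: J_def)
  obtain s \<phi> \<psi> where s: "\<And>i j. i \<in> {..<N} \<Longrightarrow> j \<in> J \<Longrightarrow> s i j \<ge> 0"
    "\<And>i. i \<in> {..<N} \<Longrightarrow> (\<Sum>j\<in>J. s i j) = 1" "\<And>j. j \<in> J \<Longrightarrow> (\<Sum>i<N. a i * s i j) = b j"
    and feas: "\<And>i j. i \<in> {..<N} \<Longrightarrow> j \<in> J \<Longrightarrow> \<psi> i + \<phi> j \<le> k i j"
    and gap: "(\<Sum>i<N. \<Sum>j\<in>J. a i * s i j * k i j) \<le> (\<Sum>i<N. a i * \<psi> i) + (\<Sum>j\<in>J. b j * \<phi> j) + e / 4"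
    by (rule finite_transport_duality[OF finite_lessThan J(1) a0 aN b0 bN \<open>e / 4 > 0\<close>, of k])
      ((assumption)+, (rule that; assumption))
  \<comment> \<open>On cells without \<open>\<nu>\<close>-mass any small enough value keeps the pair feasible.\<close>
  define \<eta> where "\<eta> = (\<lambda>j. if j \<in> J then \<phi> j else - (\<Sum>i<N. \<bar>k i j\<bar> + \<bar>\<psi> i\<bar>))"
  have feas': "\<psi> i + \<eta> j \<le> k i j" if "i < N" for i j
  proof (cases "j \<in> J")
    case False
    have "\<bar>k i j\<bar> + \<bar>\<psi> i\<bar> \<le> (\<Sum>i<N. \<bar>k i j\<bar> + \<bar>\<psi> i\<bar>)"
      using that by (intro member_le_sum[of i "{..<N}" "\<lambda>i. \<bar>k i j\<bar> + \<bar>\<psi> i\<bar>"]) auto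
    then show ?thesis using False by (simp add: \<eta>_def)
  qed (use feas that in \<open>simp add: \<eta>_def\<close>)
  define W where "W = (\<lambda>i j. if j \<in> J then s i j / b j else 0)"
  have W0: "W i j \<ge> 0" if "i < N" for i j using s(1)[of i j] that by (auto simp: W_def J_def)
  have bW: "b j * W i j = (if j \<in> J then s i j else 0)" for i j by (simp add: W_def J_def)
  define w where "w = (\<lambda>z. W (r (fst z)) (r (snd z)))"
  have meas: "(\<lambda>z. u (r (fst z)) (r (snd z))) \<in> borel_measurable (\<mu> \<Otimes>\<^sub>M \<nu>)" for u :: "nat \<Rightarrow> nat \<Rightarrow> real"
  proof -
    have 1: "(\<lambda>z. r (fst z)) \<in> measurable (\<mu> \<Otimes>\<^sub>M \<nu>) (count_space UNIV)"
      by (rule measurable_compose[OF measurable_fst r\<mu>(1)])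
    have 2: "(\<lambda>z. r (snd z)) \<in> measurable (\<mu> \<Otimes>\<^sub>M \<nu>) (count_space UNIV)"
      by (rule measurable_compose[OF measurable_snd r\<nu>(1)])
    show ?thesis
      by (rule measurable_compose_countable[OF measurable_compose_countable[OF _ 2] 1]) simp
  qed
  have w: "w \<in> borel_measurable (\<mu> \<Otimes>\<^sub>M \<nu>)" unfolding w_def by (rule meas)
  let ?\<gamma> = "density (\<mu> \<Otimes>\<^sub>M \<nu>) (\<lambda>z. ennreal (w z))"
  have \<gamma>: "?\<gamma> \<in> couplings X \<mu> \<nu>"
  proof (rule density_coupling[OF \<mu> \<nu>])
    show "(\<lambda>z. ennreal (w z)) \<in> borel_measurable (\<mu> \<Otimes>\<^sub>M \<nu>)" using w by measurable
    fix x assume "x \<in> X"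
    then have x: "r x < N" using r by simp
    have "(\<integral>\<^sup>+z. ennreal (w (x, z)) \<partial>\<nu>) = ennreal (\<Sum>j<N. b j * W (r x) j)"
      using int\<nu>(3)[of "W (r x)"] W0 x by (simp add: w_def b_def)
    also have "(\<Sum>j<N. b j * W (r x) j) = 1"
      using s(2)[of "r x"] x by (simp add: sumJ) (simp add: bW)
    finally show "(\<integral>\<^sup>+z. ennreal (w (x, z)) \<partial>\<nu>) = 1" by simp
  next
    have "AE z in \<nu>. r z \<noteq> j" if "j \<in> {..<N} - J" for j
    proof (rule AE_I')
      have "{z \<in> space \<nu>. r z = j} \<in> sets \<nu>" using r\<nu>(1) by measurable
      moreover have "measure \<nu> {z \<in> space \<nu>. r z = j} = 0" using bJ[of j] that by (simp add: b_def)
      ultimately show "{z \<in> space \<nu>. r z = j} \<in> null_sets \<nu>" by (auto simp: \<nu>.emeasure_eq_measure)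
    qed auto
    then have "AE z in \<nu>. \<forall>j\<in>{..<N} - J. r z \<noteq> j" by (simp add: AE_finite_all)
    then show "AE z in \<nu>. (\<integral>\<^sup>+x. ennreal (w (x, z)) \<partial>\<mu>) = 1"
      using AE_space
    proof eventually_elim
      fix z assume "\<forall>j\<in>{..<N} - J. r z \<noteq> j" "z \<in> space \<nu>"
      then have z: "r z \<in> J" using r\<nu>(2) by auto
      have "(\<integral>\<^sup>+x. ennreal (w (x, z)) \<partial>\<mu>) = ennreal (\<Sum>i<N. a i * W i (r z))"
        using int\<mu>(3)[of "\<lambda>i. W i (r z)"] W0 by (simp add: w_def a_def)
      also have "(\<Sum>i<N. a i * W i (r z)) = (\<Sum>i<N. a i * s i (r z)) / b (r z)"
        using z by (simp add: W_def sum_divide_distrib)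
      also have "\<dots> = 1" using s(3)[OF z] z by (simp add: J_def)
      finally show "(\<integral>\<^sup>+x. ennreal (w (x, z)) \<partial>\<mu>) = 1" by simp
    qed
  qed
  note sp\<gamma> = borel_probsD(3)[OF couplingsD(1)[OF \<gamma>]]
  interpret \<gamma>: prob_space ?\<gamma> using borel_probsD(1)[OF couplingsD(1)[OF \<gamma>]] .
  have w0: "w z \<ge> 0" if "z \<in> space (\<mu> \<Otimes>\<^sub>M \<nu>)" for z
    using that W0 r by (auto simp: w_def space_pair_measure sp)
  have ints: "integrable ?\<gamma> (\<lambda>z. k (r (fst z)) (r (snd z)))"
  proof (rule \<gamma>.integrable_const_bound[where B = "\<Sum>i<N. \<Sum>j<N. \<bar>k i j\<bar>"])
    show "AE z in ?\<gamma>. norm (k (r (fst z)) (r (snd z))) \<le> (\<Sum>i<N. \<Sum>j<N. \<bar>k i j\<bar>)"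
    proof (rule AE_I2)
      fix z assume "z \<in> space ?\<gamma>"
      then have z: "r (fst z) < N" "r (snd z) < N" unfolding sp\<gamma> using r by auto
      have "\<bar>k (r (fst z)) (r (snd z))\<bar> \<le> (\<Sum>j<N. \<bar>k (r (fst z)) j\<bar>)"
        using z by (intro member_le_sum) auto
      also have "\<dots> \<le> (\<Sum>i<N. \<Sum>j<N. \<bar>k i j\<bar>)"
        using z by (intro member_le_sum[of "r (fst z)" "{..<N}" "\<lambda>i. \<Sum>j<N. \<bar>k i j\<bar>"]) (auto intro: sum_nonneg)
      finally show "norm (k (r (fst z)) (r (snd z))) \<le> (\<Sum>i<N. \<Sum>j<N. \<bar>k i j\<bar>)" by simp
    qed
  qed (simp add: meas)
  then have intp: "integrable (\<mu> \<Otimes>\<^sub>M \<nu>) (\<lambda>z. w z * k (r (fst z)) (r (snd z)))"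
    using w w0 meas[of k] by (subst (asm) integrable_density) auto
  have "(\<integral>z. k (r (fst z)) (r (snd z)) \<partial>?\<gamma>) = (\<integral>z. w z * k (r (fst z)) (r (snd z)) \<partial>(\<mu> \<Otimes>\<^sub>M \<nu>))"
    using w w0 meas[of k] by (subst integral_density) auto
  also have "\<dots> = (\<integral>x. \<integral>z. W (r x) (r z) * k (r x) (r z) \<partial>\<nu> \<partial>\<mu>)"
    using P.integral_fst'[OF intp] by (simp add: w_def)
  also have "\<dots> = (\<Sum>i<N. a i * (\<Sum>j<N. b j * (W i j * k i j)))"
    using int\<nu>(2)[of "\<lambda>j. W i j * k i j" for i] int\<mu>(2)[of "\<lambda>i. \<Sum>j<N. b j * (W i j * k i j)"]
    by (simp add: a_def b_def)
  also have "\<dots> = (\<Sum>i<N. \<Sum>j\<in>J. a i * s i j * k i j)"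
    unfolding sumJ by (simp add: bW sum_distrib_left mult.assoc[symmetric])
  finally have eqk: "(\<integral>z. k (r (fst z)) (r (snd z)) \<partial>?\<gamma>) = (\<Sum>i<N. \<Sum>j\<in>J. a i * s i j * k i j)" .
  have "(\<integral>z. c (fst z) (snd z) \<partial>?\<gamma>) \<le> (\<integral>z. k (r (fst z)) (r (snd z)) + e / 4 \<partial>?\<gamma>)"
  proof (intro integral_mono Bochner_Integration.integrable_add ints)
    show "integrable ?\<gamma> (\<lambda>z. c (fst z) (snd z))" by (rule coupling_cost_integrable[OF X c \<gamma>])
    fix z assume "z \<in> space ?\<gamma>"
    then have "fst z \<in> X" "snd z \<in> X" unfolding sp\<gamma> by auto
    from k[OF this] show "c (fst z) (snd z) \<le> k (r (fst z)) (r (snd z)) + e / 4" by linarith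
  qed simp
  also have "\<dots> = (\<Sum>i<N. \<Sum>j\<in>J. a i * s i j * k i j) + e / 4"
    using ints \<gamma>.prob_space by (simp add: eqk)
  also have "\<dots> \<le> (\<Sum>i<N. a i * \<psi> i) + (\<Sum>j\<in>J. b j * \<phi> j) + e / 2" using gap by simp
  also have "(\<Sum>j\<in>J. b j * \<phi> j) = (\<Sum>j\<in>J. b j * \<eta> j)" by (simp add: \<eta>_def)
  also have "(\<Sum>j\<in>J. b j * \<eta> j) = (\<integral>z. \<eta> (r z) \<partial>\<nu>)"
    unfolding sumJ[symmetric] using int\<nu>(2)[of \<eta>] by (simp only: b_def)
  also have "(\<Sum>i<N. a i * \<psi> i) = (\<integral>x. \<psi> (r x) - e / 4 \<partial>\<mu>) + e / 4"
    using int\<mu>(1)[of \<psi>] int\<mu>(2)[of \<psi>] \<mu>.prob_space by (simp add: a_def)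
  finally have cost: "(\<integral>z. c (fst z) (snd z) \<partial>?\<gamma>) \<le> (\<integral>x. \<psi> (r x) - e / 4 \<partial>\<mu>) + (\<integral>z. \<eta> (r z) \<partial>\<nu>) + e"
    using e by simp
  have feas'': "(\<psi> (r x) - e / 4) + \<eta> (r z) \<le> c x z" if "x \<in> X" "z \<in> X" for x z
    using k[OF that] feas'[of "r x" "r z"] r(2)[OF that(1)] by linarith
  have bdd: "bounded ((\<lambda>x. \<psi> (r x) - e / 4) ` X)"
  proof (rule finite_imp_bounded, rule finite_subset)
    show "(\<lambda>x. \<psi> (r x) - e / 4) ` X \<subseteq> (\<lambda>i. \<psi> i - e / 4) ` {..<N}"
    proof (rule image_subsetI)
      fix x assume "x \<in> X"
      then show "\<psi> (r x) - e / 4 \<in> (\<lambda>i. \<psi> i - e / 4) ` {..<N}"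
        by (intro image_eqI[of _ _ "r x"] refl) (simp add: r(2))
    qed
  qed simp
  show ?thesis
    by (rule that[OF \<gamma> int\<mu>(1)[of "\<lambda>i. \<psi> i - e / 4"] int\<nu>(1)[of \<eta>] bdd feas'' cost])
qed

section \<open>Minimizers in the quadratic transform\<close>

definition c_transform :: "'a set \<Rightarrow> ('a \<Rightarrow> 'a \<Rightarrow> real) \<Rightarrow> ('a \<Rightarrow> real) \<Rightarrow> 'a \<Rightarrow> real" where
  "c_transform X c \<phi> x = (INF y\<in>X. c x y - \<phi> y)"

lemma c2_transform_eq: "c2_transform X = c_transform X c2"
  by (simp add: fun_eq_iff c2_transform_def c_transform_def)

lemma bdd_below_cost_diff:
  fixes c :: "'a::topological_space \<Rightarrow> 'a \<Rightarrow> real"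
  assumes "compact X" "continuous_on (X \<times> X) (\<lambda>z. c (fst z) (snd z))" "bounded (\<phi> ` X)" "x \<in> X"
  shows "bdd_below ((\<lambda>y. c x y - \<phi> y) ` X)"
proof -
  have "bounded ((\<lambda>z. c (fst z) (snd z)) ` (X \<times> X))"
    using assms by (intro compact_imp_bounded compact_continuous_image compact_Times)
  then obtain B where B: "\<And>z. z \<in> X \<times> X \<Longrightarrow> \<bar>c (fst z) (snd z)\<bar> \<le> B"
    unfolding bounded_iff by fastforce
  obtain C where C: "\<And>y. y \<in> X \<Longrightarrow> \<bar>\<phi> y\<bar> \<le> C" using assms(3) unfolding bounded_iff by auto
  have "- B - C \<le> c x y - \<phi> y" if "y \<in> X" for y
    using B[of "(x, y)"] C[OF that] that assms(4) by auto
  then show ?thesis by (rule bdd_belowI2)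
qed

lemma c_transform_le:
  fixes c :: "'a::topological_space \<Rightarrow> 'a \<Rightarrow> real"
  assumes "compact X" "continuous_on (X \<times> X) (\<lambda>z. c (fst z) (snd z))" "bounded (\<phi> ` X)"
    and "x \<in> X" "y \<in> X"
  shows "c_transform X c \<phi> x \<le> c x y - \<phi> y"
  unfolding c_transform_def using assms by (intro cINF_lower bdd_below_cost_diff)

lemma c_transform_greatest:
  assumes "X \<noteq> {}" "\<And>y. y \<in> X \<Longrightarrow> m \<le> c x y - \<phi> y"
  shows "m \<le> c_transform X c \<phi> x"
  unfolding c_transform_def using assms by (intro cINF_greatest)

text \<open>An infimum of \<open>L\<close>-Lipschitz functions of \<open>x\<close> is \<open>L\<close>-Lipschitz.\<close>

lemma lipschitz_on_c_transform:
  fixes c :: "'a::metric_space \<Rightarrow> 'a \<Rightarrow> real"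
  assumes X: "compact X" and c: "continuous_on (X \<times> X) (\<lambda>z. c (fst z) (snd z))" and \<phi>: "bounded (\<phi> ` X)"
    and lip: "\<And>y. y \<in> X \<Longrightarrow> L-lipschitz_on X (\<lambda>x. c x y)" and "L \<ge> 0"
  shows "L-lipschitz_on X (c_transform X c \<phi>)"
proof (rule lipschitz_onI)
  have le: "c_transform X c \<phi> x - L * dist x x' \<le> c_transform X c \<phi> x'" if x: "x \<in> X" "x' \<in> X" for x x'
  proof (rule c_transform_greatest)
    fix y assume y: "y \<in> X"
    have "c x y - c x' y \<le> L * dist x x'"
      using lipschitz_onD[OF lip[OF y] x] by (simp add: dist_real_def)
    then show "c_transform X c \<phi> x - L * dist x x' \<le> c x' y - \<phi> y"
      using c_transform_le[OF X c \<phi> x(1) y] by simp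
  qed (use x in auto)
  fix x x' assume x: "x \<in> X" "x' \<in> X"
  show "dist (c_transform X c \<phi> x) (c_transform X c \<phi> x') \<le> L * dist x x'"
    using le[OF x] le[OF x(2,1)] by (simp add: dist_real_def dist_commute abs_le_iff)
qed fact

lemma c2_inner: "c2 x y = 1 / 2 * (x \<bullet> x) - x \<bullet> y + 1 / 2 * (y \<bullet> y)" for x y :: "'a::real_inner"
  by (simp add: c2_def power2_norm_eq_inner inner_diff inner_commute algebra_simps)

lemma continuous_on_c2: "continuous_on A (\<lambda>z. c2 (fst z) (snd z))"
  unfolding c2_def by (intro continuous_intros)

lemma bounded_continuous_image:
  "compact X \<Longrightarrow> continuous_on X \<phi> \<Longrightarrow> bounded (\<phi> ` X)"
  by (intro compact_imp_bounded compact_continuous_image)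

lemma c2_transform_le:
  fixes X :: "'a::real_inner set"
  assumes "compact X" "continuous_on X \<phi>" "x \<in> X" "y \<in> X"
  shows "c2_transform X \<phi> x \<le> c2 x y - \<phi> y"
  unfolding c2_transform_eq using assms by (intro c_transform_le continuous_on_c2 bounded_continuous_image)

lemma c2_transform_greatest:
  assumes "X \<noteq> {}" "\<And>y. y \<in> X \<Longrightarrow> m \<le> c2 x y - \<phi> y"
  shows "m \<le> c2_transform X \<phi> x"
  unfolding c2_transform_eq using assms by (intro c_transform_greatest)

lemma c2_transform_attained:
  fixes X :: "'a::real_inner set"
  assumes "compact X" "continuous_on X \<phi>" "x \<in> X"
  obtains y where "y \<in> X" "c2 x y - \<phi> y = c2_transform X \<phi> x"
proof -
  have "continuous_on X (\<lambda>y. c2 x y - \<phi> y)"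
    unfolding c2_def using assms by (intro continuous_intros)
  then obtain y where y: "y \<in> X" "\<And>y'. y' \<in> X \<Longrightarrow> c2 x y - \<phi> y \<le> c2 x y' - \<phi> y'"
    using continuous_attains_inf[of X "\<lambda>y. c2 x y - \<phi> y"] assms by auto
  have "c2 x y - \<phi> y \<le> c2_transform X \<phi> x"
    using y assms by (intro c2_transform_greatest) auto
  with c2_transform_le[OF assms y(1)] y(1) that show ?thesis by force
qed

lemma continuous_on_c2_transform:
  fixes X :: "'a::real_inner set"
  assumes X: "compact X" and \<phi>: "continuous_on X \<phi>"
  shows "continuous_on X (c2_transform X \<phi>)"
proof -
  obtain R where R: "\<And>x. x \<in> X \<Longrightarrow> norm x \<le> R"
    using compact_imp_bounded[OF X] by (auto simp: bounded_iff)
  define D where "D = max 0 (2 * R)"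
  have D: "norm (x - y) \<le> D" if "x \<in> X" "y \<in> X" for x y
    using norm_triangle_ineq4[of x y] R[OF that(1)] R[OF that(2)] by (simp add: D_def)
  have "D-lipschitz_on X (c2_transform X \<phi>)"
    unfolding c2_transform_eq
  proof (rule lipschitz_on_c_transform[OF X continuous_on_c2 bounded_continuous_image[OF X \<phi>]])
    fix y assume y: "y \<in> X"
    show "D-lipschitz_on X (\<lambda>x. c2 x y)"
    proof (rule lipschitz_onI)
      fix x x' assume x: "x \<in> X" "x' \<in> X"
      have "c2 x y - c2 x' y = 1 / 2 * ((norm (x - y) + norm (x' - y)) * (norm (x - y) - norm (x' - y)))"
        by (simp add: c2_def power2_eq_square algebra_simps)
      then have "\<bar>c2 x y - c2 x' y\<bar> = \<bar>1 / 2 * ((norm (x - y) + norm (x' - y)) * (norm (x - y) - norm (x' - y)))\<bar>"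
        by (rule arg_cong)
      also have "\<dots> = 1 / 2 * ((norm (x - y) + norm (x' - y)) * \<bar>norm (x - y) - norm (x' - y)\<bar>)"
        by (simp add: abs_mult)
      also have "\<dots> \<le> 1 / 2 * ((D + D) * norm ((x - y) - (x' - y)))"
        using D[OF x(1) y] D[OF x(2) y]
        by (intro mult_left_mono mult_mono add_mono norm_triangle_ineq3) (auto simp: D_def)
      finally show "dist (c2 x y) (c2 x' y) \<le> D * dist x x'"
        by (simp add: dist_real_def dist_norm)
    qed (simp add: D_def)
  qed (simp add: D_def)
  then show ?thesis by (rule lipschitz_on_continuous_on)
qed

definition c2_argmin :: "'a::real_normed_vector set \<Rightarrow> ('a \<Rightarrow> real) \<Rightarrow> 'a \<Rightarrow> 'a set" where
  "c2_argmin X \<phi> x = {y \<in> X. c2 x y - \<phi> y = c2_transform X \<phi> x}"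

text \<open>Two-point cyclical monotonicity: exchanging \<open>y\<close> and \<open>y'\<close> does not decrease the total cost.\<close>

lemma c2_argmin_monotone:
  fixes X :: "'a::real_inner set"
  assumes "compact X" "continuous_on X \<phi>" "x \<in> X" "x' \<in> X"
    and "y \<in> c2_argmin X \<phi> x" "y' \<in> c2_argmin X \<phi> x'"
  shows "0 \<le> (y' - y) \<bullet> (x' - x)"
proof -
  have "c2 x y - \<phi> y \<le> c2 x y' - \<phi> y'" "c2 x' y' - \<phi> y' \<le> c2 x' y - \<phi> y"
    using assms c2_transform_le[of X \<phi>] by (auto simp: c2_argmin_def)
  then have "c2 x y + c2 x' y' \<le> c2 x y' + c2 x' y" by simp
  then show ?thesis by (simp add: c2_inner inner_diff inner_commute algebra_simps)
qed

text \<open>Both sets are projections of compact sets, because the graph of the minimizers is closed.\<close>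

lemma compact_c2_argmin_jump:
  fixes X :: "'a::euclidean_space set"
  assumes X: "compact X" and \<phi>: "continuous_on X \<phi>"
  shows "compact {x \<in> X. \<exists>y\<in>c2_argmin X \<phi> x. \<exists>y'\<in>c2_argmin X \<phi> x. \<delta> \<le> (y' - y) \<bullet> b}" (is "compact ?E")
    and "closed C \<Longrightarrow> compact {x \<in> X. \<exists>y\<in>c2_argmin X \<phi> x. y \<in> C}" (is "_ \<Longrightarrow> compact ?F")
proof -
  define Q where "Q = X \<times> X \<times> X"
  define G1 where "G1 = {z \<in> Q. c2 (fst z) (fst (snd z)) - \<phi> (fst (snd z)) - c2_transform X \<phi> (fst z) = 0}"
  define G2 where "G2 = {z \<in> Q. c2 (fst z) (snd (snd z)) - \<phi> (snd (snd z)) - c2_transform X \<phi> (fst z) = 0}"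
  define H where "H = {z :: 'a \<times> 'a \<times> 'a. \<delta> \<le> (snd (snd z) - fst (snd z)) \<bullet> b}"
  have cont: "continuous_on Q (\<lambda>z. f (g z))" if "continuous_on X f" "continuous_on Q g" "g ` Q \<subseteq> X"
    for f :: "'a \<Rightarrow> real" and g
    using that by (rule continuous_on_compose2)
  have c1: "continuous_on Q (\<lambda>z. \<phi> (fst (snd z)))" "continuous_on Q (\<lambda>z. \<phi> (snd (snd z)))"
    by (rule cont[OF \<phi>]; auto simp: Q_def intro!: continuous_intros)+
  have c2: "continuous_on Q (\<lambda>z. c2_transform X \<phi> (fst z))"
    by (rule cont[OF continuous_on_c2_transform[OF X \<phi>]]) (auto simp: Q_def intro!: continuous_intros)
  have Q: "compact Q" unfolding Q_def using X by (intro compact_Times)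
  have G: "closed G1" "closed G2"
    unfolding G1_def G2_def c2_def
    by (intro continuous_closed_preimage_constant[OF _ compact_imp_closed[OF Q]] continuous_intros c1 c2)+
  have H: "closed H"
    unfolding H_def by (intro closed_Collect_le continuous_intros)
  have "?E = fst ` (Q \<inter> (G1 \<inter> G2 \<inter> H))"
  proof (intro set_eqI iffI)
    fix x assume "x \<in> ?E"
    then obtain y y' where "x \<in> X" "y \<in> c2_argmin X \<phi> x" "y' \<in> c2_argmin X \<phi> x" "\<delta> \<le> (y' - y) \<bullet> b" by blast
    then have "(x, y, y') \<in> Q \<inter> (G1 \<inter> G2 \<inter> H)" by (simp add: c2_argmin_def Q_def G1_def G2_def H_def)
    then show "x \<in> fst ` (Q \<inter> (G1 \<inter> G2 \<inter> H))" by (rule image_eqI[rotated]) simp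
  next
    fix x assume "x \<in> fst ` (Q \<inter> (G1 \<inter> G2 \<inter> H))"
    then obtain z where "z \<in> Q \<inter> (G1 \<inter> G2 \<inter> H)" "x = fst z" by (rule imageE)
    then have "x \<in> X" "fst (snd z) \<in> c2_argmin X \<phi> x" "snd (snd z) \<in> c2_argmin X \<phi> x"
      "\<delta> \<le> (snd (snd z) - fst (snd z)) \<bullet> b"
      by (auto simp: c2_argmin_def Q_def G1_def G2_def H_def)
    then show "x \<in> ?E" by blast
  qed
  moreover have "compact (fst ` (Q \<inter> (G1 \<inter> G2 \<inter> H)))"
    using G H by (intro compact_continuous_image compact_Int_closed[OF Q] closed_Int continuous_intros)
  ultimately show "compact ?E" by simp
  assume C: "closed C"
  have C': "closed ((\<lambda>z :: 'a \<times> 'a \<times> 'a. fst (snd z)) -` C)"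
    by (intro closed_vimage[OF C] continuous_intros)
  have "?F = fst ` (Q \<inter> (G1 \<inter> (\<lambda>z. fst (snd z)) -` C))"
  proof (intro set_eqI iffI)
    fix x assume "x \<in> ?F"
    then obtain y where "x \<in> X" "y \<in> c2_argmin X \<phi> x" "y \<in> C" by blast
    then have "(x, y, y) \<in> Q \<inter> (G1 \<inter> (\<lambda>z. fst (snd z)) -` C)" by (simp add: c2_argmin_def Q_def G1_def)
    then show "x \<in> fst ` (Q \<inter> (G1 \<inter> (\<lambda>z. fst (snd z)) -` C))" by (rule image_eqI[rotated]) simp
  next
    fix x assume "x \<in> fst ` (Q \<inter> (G1 \<inter> (\<lambda>z. fst (snd z)) -` C))"
    then obtain z where "z \<in> Q \<inter> (G1 \<inter> (\<lambda>z. fst (snd z)) -` C)" "x = fst z" by (rule imageE)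
    then have "x \<in> X" "fst (snd z) \<in> c2_argmin X \<phi> x" "fst (snd z) \<in> C"
      by (auto simp: c2_argmin_def Q_def G1_def)
    then show "x \<in> ?F" by blast
  qed
  moreover have "compact (fst ` (Q \<inter> (G1 \<inter> (\<lambda>z. fst (snd z)) -` C)))"
    by (intro compact_continuous_image compact_Int_closed[OF Q closed_Int[OF G(1) C']] continuous_intros)
  ultimately show "compact ?F" by simp
qed

text \<open>The translates of \<open>E\<close> by \<open>- t k *\<^sub>R b\<close> lie in one ball, all have the measure of \<open>E\<close>, and cover no point more
than \<open>K\<close> times. So \<open>n\<close> times the measure of \<open>E\<close> stays below \<open>K\<close> times the measure of the ball for every \<open>n\<close>.\<close>

lemma null_sets_lborel_bounded_overlap:
  fixes E :: "'a::euclidean_space set" and t :: "nat \<Rightarrow> real"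
  assumes E: "compact E" and t: "\<And>k. t k \<in> {0..1}"
    and overlap: "\<And>x n. card {k. k < n \<and> x + t k *\<^sub>R b \<in> E} \<le> K"
  shows "E \<in> null_sets lborel"
proof -
  obtain R where R: "\<And>x. x \<in> E \<Longrightarrow> norm x \<le> R" using compact_imp_bounded[OF E] by (auto simp: bounded_iff)
  define B where "B = cball (0 :: 'a) (R + norm b)"
  define F where "F = (\<lambda>k. (+) (- t k *\<^sub>R b) ` E)"
  have F: "x \<in> F k \<longleftrightarrow> x + t k *\<^sub>R b \<in> E" for x k
    unfolding F_def by (auto simp: image_iff) (metis add.commute add_diff_cancel)
  have FB: "F k \<subseteq> B" for k
  proof
    fix x assume "x \<in> F k"
    then have "norm (x + t k *\<^sub>R b) \<le> R" using F R by blast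
    moreover have "norm (t k *\<^sub>R b) \<le> norm b" using t[of k] by (simp add: mult_left_le_one_le)
    ultimately show "x \<in> B" using norm_triangle_ineq4[of "x + t k *\<^sub>R b" "t k *\<^sub>R b"] by (simp add: B_def)
  qed
  have lm: "E \<in> lmeasurable" "B \<in> lmeasurable" using E by (auto simp: B_def lmeasurable_compact)
  have "compact (F k)" for k unfolding F_def by (rule compact_translation[OF E])
  then have lmF: "F k \<in> lmeasurable" for k by (rule lmeasurable_compact)
  have intF: "integrable lebesgue (indicator (F k) :: 'a \<Rightarrow> real)" for k
    by (rule integrable_real_indicator) (metis fmeasurableD fmeasurableD2 infinity_ennreal_def less_top lmF)+
  have mF: "measure lebesgue (F k) = measure lebesgue E" for k unfolding F_def by (rule measure_translation)
  have le: "real n * measure lebesgue E \<le> real K * measure lebesgue B" for n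
  proof -
    have "real n * measure lebesgue E = (\<Sum>k<n. \<integral>x. indicator (F k) x \<partial>lebesgue)"
      using lmF mF by (simp add: fmeasurableD)
    also have "\<dots> = (\<integral>x. (\<Sum>k<n. indicator (F k) x) \<partial>lebesgue)"
      by (intro Bochner_Integration.integral_sum[symmetric] intF)
    also have "\<dots> \<le> (\<integral>x. real K * indicator B x \<partial>lebesgue)"
    proof (rule integral_mono)
      show "integrable lebesgue (\<lambda>x. \<Sum>k<n. indicator (F k) x :: real)"
        by (intro Bochner_Integration.integrable_sum intF)
      show "integrable lebesgue (\<lambda>x. real K * indicator B x)"
        using lm by (intro integrable_mult_right) (auto simp: integrable_indicator_iff fmeasurable_def)
      fix x :: 'a
      have "(\<Sum>k<n. indicator (F k) x :: real) = real (card {k. k < n \<and> x \<in> F k})"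
        by (simp add: indicator_def sum.If_cases Int_def conj_commute)
      moreover have "{k. k < n \<and> x \<in> F k} = {}" if "x \<notin> B" using that FB by auto
      ultimately show "(\<Sum>k<n. indicator (F k) x) \<le> real K * indicator B x"
        using overlap[of n x] by (cases "x \<in> B") (auto simp: F)
    qed
    also have "\<dots> = real K * measure lebesgue B" using lm by (simp add: fmeasurableD)
    finally show ?thesis .
  qed
  have "measure lebesgue E = 0"
  proof (rule ccontr)
    assume "measure lebesgue E \<noteq> 0"
    then have "measure lebesgue E > 0" by (simp add: less_le)
    then obtain n where "real K * measure lebesgue B < real n * measure lebesgue E" using reals_Archimedean3 by blast
    with le[of n] show False by simp
  qed
  then have "E \<in> null_sets lebesgue" using lm(1) by (auto simp: null_sets_def emeasure_eq_measure2)
  then show ?thesis using E by (simp add: null_sets_completion_iff borel_compact)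
qed

text \<open>On a line in direction \<open>b\<close> the coordinates \<open>y \<bullet> b\<close> of the minimizers increase with the parameter, and they increase
by at least \<open>\<delta>\<close> across each point of the set. As they are bounded, each line carries a bounded number of such points,
and the translates of the set along \<open>b\<close> have bounded overlap.\<close>

lemma c2_argmin_jump_null:
  fixes X :: "'a::euclidean_space set"
  assumes X: "compact X" and \<phi>: "continuous_on X \<phi>" and \<delta>: "\<delta> > 0"
  shows "{x \<in> X. \<exists>y\<in>c2_argmin X \<phi> x. \<exists>y'\<in>c2_argmin X \<phi> x. \<delta> \<le> (y' - y) \<bullet> b} \<in> null_sets lborel"
    (is "?E \<in> _")
proof -
  obtain R where R: "\<And>x. x \<in> X \<Longrightarrow> norm x \<le> R" using compact_imp_bounded[OF X] by (auto simp: bounded_iff)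
  define t where "t = (\<lambda>k. 1 / (real k + 1))"
  define M where "M = {\<lfloor>- (R * norm b) / \<delta>\<rfloor>..\<lfloor>R * norm b / \<delta>\<rfloor>}"
  show ?thesis
  proof (rule null_sets_lborel_bounded_overlap[of _ t b "card M"])
    show "compact ?E" by (rule compact_c2_argmin_jump[OF X \<phi>])
    show "t k \<in> {0..1}" for k by (simp add: t_def)
    fix x n
    define A where "A = {k. k < n \<and> x + t k *\<^sub>R b \<in> ?E}"
    have "\<forall>k\<in>A. \<exists>y y'. y \<in> c2_argmin X \<phi> (x + t k *\<^sub>R b) \<and> y' \<in> c2_argmin X \<phi> (x + t k *\<^sub>R b) \<and>
        \<delta> \<le> (y' - y) \<bullet> b"
      by (auto simp: A_def)
    then obtain y y' where y: "\<And>k. k \<in> A \<Longrightarrow> y k \<in> c2_argmin X \<phi> (x + t k *\<^sub>R b)"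
      "\<And>k. k \<in> A \<Longrightarrow> y' k \<in> c2_argmin X \<phi> (x + t k *\<^sub>R b)" "\<And>k. k \<in> A \<Longrightarrow> \<delta> \<le> (y' k - y k) \<bullet> b"
      by metis
    have sep: "\<delta> \<le> y k \<bullet> b - y j \<bullet> b" if "k \<in> A" "j \<in> A" "k < j" for k j
    proof -
      have "t j < t k" using that by (simp add: t_def field_simps)
      have "x + t k *\<^sub>R b \<in> X" "x + t j *\<^sub>R b \<in> X" using that by (auto simp: A_def)
      then have "0 \<le> (y k - y' j) \<bullet> ((x + t k *\<^sub>R b) - (x + t j *\<^sub>R b))"
        using y that by (intro c2_argmin_monotone[OF X \<phi>])
      also have "\<dots> = (t k - t j) * ((y k - y' j) \<bullet> b)" by (simp add: inner_diff algebra_simps)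
      finally have "0 \<le> (y k - y' j) \<bullet> b" using \<open>t j < t k\<close> by (simp add: zero_le_mult_iff)
      then show ?thesis using y(3)[OF that(2)] by (simp add: inner_diff)
    qed
    \<comment> \<open>The coordinates are \<open>\<delta>\<close>-separated, so after division by \<open>\<delta>\<close> their floors are distinct integers in \<open>M\<close>.\<close>
    define g where "g = (\<lambda>k. \<lfloor>y k \<bullet> b / \<delta>\<rfloor>)"
    have g_less: "g j < g k" if "k \<in> A" "j \<in> A" "k < j" for k j
    proof -
      have "(y j \<bullet> b + \<delta>) / \<delta> \<le> y k \<bullet> b / \<delta>"
        using sep[OF that] \<delta> by (intro divide_right_mono) auto
      then have "y j \<bullet> b / \<delta> + 1 \<le> y k \<bullet> b / \<delta>" using \<delta> by (simp add: add_divide_distrib)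
      then show ?thesis unfolding g_def by linarith
    qed
    have "inj_on g A"
      by (rule inj_onI) (metis g_less less_irrefl linorder_neqE_nat)
    moreover have "g ` A \<subseteq> M"
    proof
      fix m assume "m \<in> g ` A"
      then obtain k where k: "k \<in> A" "m = g k" by auto
      have "norm (y k) \<le> R" using y(1)[OF k(1)] R by (simp add: c2_argmin_def)
      then have "\<bar>y k \<bullet> b\<bar> \<le> R * norm b"
        using Cauchy_Schwarz_ineq2[of "y k" b] mult_right_mono[of "norm (y k)" R "norm b"] by simp
      then have "- (R * norm b) \<le> y k \<bullet> b" "y k \<bullet> b \<le> R * norm b" by linarith+
      then have "- (R * norm b) / \<delta> \<le> y k \<bullet> b / \<delta>" "y k \<bullet> b / \<delta> \<le> R * norm b / \<delta>"
        using \<delta> by (intro divide_right_mono; simp)+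
      then show "m \<in> M" unfolding k(2) g_def M_def by (auto intro: floor_mono)
    qed
    ultimately show "card {k. k < n \<and> x + t k *\<^sub>R b \<in> ?E} \<le> card M"
      unfolding A_def[symmetric] by (intro card_inj_on_le) (auto simp: M_def)
  qed
qed

text \<open>Two distinct minimizers differ in some coordinate, hence by \<open>1 / (k + 1)\<close> in some basis direction for some \<open>k\<close>.\<close>

lemma c2_argmin_nonunique_null:
  fixes X :: "'a::euclidean_space set"
  assumes X: "compact X" and \<phi>: "continuous_on X \<phi>"
  shows "{x \<in> X. \<exists>y\<in>c2_argmin X \<phi> x. \<exists>y'\<in>c2_argmin X \<phi> x. y \<noteq> y'} \<in> null_sets lborel"
    (is "?N \<in> _")
proof -
  define E where "E = (\<lambda>b (k::nat). {x \<in> X. \<exists>y\<in>c2_argmin X \<phi> x. \<exists>y'\<in>c2_argmin X \<phi> x.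
      1 / (real k + 1) \<le> (y' - y) \<bullet> b})"
  have "E b k \<in> null_sets lborel" for b k
    unfolding E_def by (rule c2_argmin_jump_null[OF X \<phi>]) simp
  then have "(\<Union>b\<in>Basis. \<Union>k. E b k) \<in> null_sets lborel"
    by (intro null_sets_UN' null_sets_UN) (auto simp: countable_finite)
  also have "(\<Union>b\<in>Basis. \<Union>k. E b k) = ?N"
  proof (intro set_eqI iffI)
    fix x assume "x \<in> (\<Union>b\<in>Basis. \<Union>k. E b k)"
    then obtain b k y y' where *: "x \<in> X" "y \<in> c2_argmin X \<phi> x" "y' \<in> c2_argmin X \<phi> x"
      "1 / (real k + 1) \<le> (y' - y) \<bullet> b" unfolding E_def by blast
    have "0 < 1 / (real k + 1)" by simp
    then have "y \<noteq> y'" using *(4) by auto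
    with * show "x \<in> ?N" by blast
  next
    fix x assume "x \<in> ?N"
    then obtain y y' where *: "x \<in> X" "y \<in> c2_argmin X \<phi> x" "y' \<in> c2_argmin X \<phi> x" "y \<noteq> y'" by blast
    then obtain b where b: "b \<in> Basis" "y \<bullet> b \<noteq> y' \<bullet> b" by (metis euclidean_eqI)
    have in_E: "x \<in> (\<Union>b\<in>Basis. \<Union>k. E b k)"
      if "u \<in> c2_argmin X \<phi> x" "v \<in> c2_argmin X \<phi> x" "u \<bullet> b < v \<bullet> b" for u v
    proof -
      obtain k where "inverse (real (Suc k)) < v \<bullet> b - u \<bullet> b"
        using reals_Archimedean[of "v \<bullet> b - u \<bullet> b"] \<open>u \<bullet> b < v \<bullet> b\<close> by auto
      then have "1 / (real k + 1) \<le> (v - u) \<bullet> b"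
        by (simp add: inverse_eq_divide inner_diff add.commute)
      then have "x \<in> E b k" unfolding E_def using *(1) that by blast
      then show ?thesis using b(1) by blast
    qed
    then show "x \<in> (\<Union>b\<in>Basis. \<Union>k. E b k)"
      using * b(2) in_E[of y y'] in_E[of y' y] by (cases "y \<bullet> b < y' \<bullet> b") auto
  qed
  finally show ?thesis .
qed

text \<open>The minimizer where it is unique. The value elsewhere, a constant in \<open>X\<close>, makes the map Borel with values in \<open>X\<close>.\<close>

definition c2_argmin_map :: "'a::real_normed_vector set \<Rightarrow> ('a \<Rightarrow> real) \<Rightarrow> 'a \<Rightarrow> 'a" where
  "c2_argmin_map X \<phi> x =
     (if \<exists>y. c2_argmin X \<phi> x = {y} then THE y. c2_argmin X \<phi> x = {y} else SOME y. y \<in> X)"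

abbreviation argmin_target :: "'a::real_normed_vector set \<Rightarrow> 'a measure \<Rightarrow> ('a \<Rightarrow> real) \<Rightarrow> 'a measure" where
  "argmin_target X \<mu> \<phi> \<equiv> distr \<mu> (borel_on X) (c2_argmin_map X \<phi>)"

lemma c2_argmin_map_eq: "c2_argmin X \<phi> x = {y} \<Longrightarrow> c2_argmin_map X \<phi> x = y"
  by (auto simp: c2_argmin_map_def)

lemma c2_argmin_map_in:
  assumes "X \<noteq> {}"
  shows "c2_argmin_map X \<phi> x \<in> X"
proof (cases "\<exists>y. c2_argmin X \<phi> x = {y}")
  case True
  then obtain y where y: "c2_argmin X \<phi> x = {y}" by blast
  then have "y \<in> X" by (auto simp: c2_argmin_def)
  then show ?thesis using c2_argmin_map_eq[OF y] by simp
qed (use assms in \<open>simp add: c2_argmin_map_def some_in_eq\<close>)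

lemma c2_argmin_nonempty:
  fixes X :: "'a::real_inner set"
  assumes "compact X" "continuous_on X \<phi>" "x \<in> X"
  shows "c2_argmin X \<phi> x \<noteq> {}"
  using c2_transform_attained[OF assms] by (auto simp: c2_argmin_def)

lemma c2_argmin_map_measurable:
  fixes X :: "'a::euclidean_space set"
  assumes X: "compact X" and \<phi>: "continuous_on X \<phi>"
  shows "c2_argmin_map X \<phi> \<in> measurable (borel_on X) (borel_on X)"
proof (rule measurable_restrict_space2)
  let ?T = "c2_argmin_map X \<phi>"
  show "?T \<in> space (borel_on X) \<rightarrow> X"
    by (intro funcsetI c2_argmin_map_in) (auto simp: space_restrict_space)
  define N where "N = {x \<in> X. \<exists>y\<in>c2_argmin X \<phi> x. \<exists>y'\<in>c2_argmin X \<phi> x. y \<noteq> y'}"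
  have N: "N \<in> sets borel" using c2_argmin_nonunique_null[OF X \<phi>] by (auto simp: N_def dest: null_setsD2)
  have Xb: "X \<in> sets borel" using X by (rule borel_compact)
  have single: "\<exists>y. c2_argmin X \<phi> x = {y}" if "x \<in> X - N" for x
    using that c2_argmin_nonempty[OF X \<phi>, of x] unfolding N_def by blast
  define y0 where "y0 = (SOME y. y \<in> X)"
  have TN: "?T x = y0" if "x \<in> N" for x
  proof -
    have "\<not> (\<exists>y. c2_argmin X \<phi> x = {y})" using that unfolding N_def by auto
    then show ?thesis by (simp add: c2_argmin_map_def y0_def)
  qed
  show "?T \<in> measurable (borel_on X) borel"
  proof (rule borel_measurableI)
    fix S :: "'a set" assume "open S"
    define F where "F = {x \<in> X. \<exists>y\<in>c2_argmin X \<phi> x. y \<in> - S}"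
    have F: "F \<in> sets borel"
      unfolding F_def using \<open>open S\<close> by (intro borel_compact compact_c2_argmin_jump[OF X \<phi>]) (simp add: closed_Compl)
    have "?T -` S \<inter> X = (X - N - F) \<union> (if y0 \<in> S then N else {})"
    proof (intro set_eqI)
      fix x
      show "x \<in> ?T -` S \<inter> X \<longleftrightarrow> x \<in> (X - N - F) \<union> (if y0 \<in> S then N else {})"
      proof (cases "x \<in> X - N")
        case True
        then obtain y where y: "c2_argmin X \<phi> x = {y}" using single by blast
        then show ?thesis using True c2_argmin_map_eq[OF y] by (auto simp: F_def)
      next
        case False
        then show ?thesis using TN[of x] by (auto simp: N_def)
      qed
    qed
    then show "?T -` S \<inter> space (borel_on X) \<in> sets (borel_on X)"
      using N F Xb by (auto simp: space_restrict_space sets_restrict_space_iff)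
  qed
qed

lemma AE_c2_argmin_singleton:
  fixes X :: "'a::euclidean_space set"
  assumes X: "compact X" and \<phi>: "continuous_on X \<phi>" and \<mu>: "\<mu> \<in> borel_probs X"
    and ac: "absolutely_continuous (restrict_space lborel X) \<mu>"
  shows "AE x in \<mu>. c2_argmin X \<phi> x = {c2_argmin_map X \<phi> x}"
proof -
  define N where "N = {x \<in> X. \<exists>y\<in>c2_argmin X \<phi> x. \<exists>y'\<in>c2_argmin X \<phi> x. y \<noteq> y'}"
  have "N \<in> null_sets (restrict_space lborel X)"
    using c2_argmin_nonunique_null[OF X \<phi>] X
    by (subst null_sets_restrict_space) (auto simp: N_def borel_compact)
  then have "N \<in> null_sets \<mu>" using ac by (auto simp: absolutely_continuous_def)
  then show ?thesis
  proof (rule AE_I')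
    show "{x \<in> space \<mu>. c2_argmin X \<phi> x \<noteq> {c2_argmin_map X \<phi> x}} \<subseteq> N"
    proof (clarsimp simp: borel_probsD(3)[OF \<mu>])
      fix x assume x: "x \<in> X" "c2_argmin X \<phi> x \<noteq> {c2_argmin_map X \<phi> x}"
      then have "\<nexists>y. c2_argmin X \<phi> x = {y}" using c2_argmin_map_eq[of X \<phi> x] by metis
      then show "x \<in> N" using c2_argmin_nonempty[OF X \<phi> x(1)] x(1) unfolding N_def by blast
    qed
  qed
qed

text \<open>Danskin's envelope theorem. The minimizer \<open>y\<close> of the unperturbed problem gives \<open>\<eta> y \<le> q t\<close>, the minimizer \<open>z\<close> of the
perturbed one gives \<open>q t \<le> \<eta> z\<close>, and for small \<open>t\<close> such a \<open>z\<close> cannot stay in the compact set where \<open>\<eta>\<close> exceeds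
\<open>\<eta> y\<close> by a fixed amount, because the unperturbed cost has a positive excess there.\<close>

lemma c2_transform_directional_derivative:
  fixes X :: "'a::euclidean_space set"
  assumes X: "compact X" and \<phi>: "continuous_on X \<phi>" and \<eta>: "continuous_on X \<eta>"
    and x: "x \<in> X" and y: "c2_argmin X \<phi> x = {y}"
    and B: "\<And>z. z \<in> X \<Longrightarrow> \<bar>\<eta> z\<bar> \<le> B"
  defines "q \<equiv> (\<lambda>t. (c2_transform X \<phi> x - c2_transform X (\<lambda>z. \<phi> z + t * \<eta> z) x) / t)"
  shows "\<And>t. 0 < t \<Longrightarrow> \<bar>q t\<bar> \<le> B" and "(q \<longlongrightarrow> \<eta> y) (at_right 0)"
proof -
  have y': "y \<in> X" "c2 x y - \<phi> y = c2_transform X \<phi> x" using y by (auto simp: c2_argmin_def)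
  have ct: "continuous_on X (\<lambda>z. \<phi> z + t * \<eta> z)" for t by (intro continuous_intros \<phi> \<eta>)
  have lower: "\<eta> y \<le> q t" if "t > 0" for t
  proof -
    have "c2_transform X (\<lambda>z. \<phi> z + t * \<eta> z) x \<le> c2_transform X \<phi> x - t * \<eta> y"
      using c2_transform_le[OF X ct x y'(1), of t] y'(2) by simp
    then show ?thesis using that by (simp add: q_def pos_le_divide_eq mult.commute)
  qed
  have upper: "\<exists>z\<in>X. q t \<le> \<eta> z \<and> c2 x z - \<phi> z - c2_transform X \<phi> x \<le> t * (\<eta> z - \<eta> y)"
    if "t > 0" for t
  proof -
    obtain z where z: "z \<in> X" "c2 x z - (\<phi> z + t * \<eta> z) = c2_transform X (\<lambda>z. \<phi> z + t * \<eta> z) x"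
      using c2_transform_attained[OF X ct x] by metis
    have "c2_transform X \<phi> x \<le> c2 x z - \<phi> z" by (rule c2_transform_le[OF X \<phi> x z(1)])
    then have "q t \<le> \<eta> z" using z(2) that by (simp add: q_def pos_divide_le_eq mult.commute)
    have "t * \<eta> y \<le> t * q t" using lower[OF that] that by (intro mult_left_mono) auto
    moreover have "t * q t = c2_transform X \<phi> x - c2_transform X (\<lambda>z. \<phi> z + t * \<eta> z) x"
      using that by (simp add: q_def)
    ultimately have "c2 x z - \<phi> z - c2_transform X \<phi> x \<le> t * (\<eta> z - \<eta> y)"
      using z(2) by (simp add: right_diff_distrib)
    with \<open>q t \<le> \<eta> z\<close> show ?thesis using z(1) by blast
  qed
  show "\<bar>q t\<bar> \<le> B" if "0 < t" for t
    using lower[OF that] upper[OF that] B[OF y'(1)] B by (auto simp: abs_le_iff intro: order_trans)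
  show "(q \<longlongrightarrow> \<eta> y) (at_right 0)"
  proof (rule order_tendstoI)
    fix a assume "a < \<eta> y"
    show "\<forall>\<^sub>F t in at_right 0. a < q t"
      using eventually_at_right_less[of 0] by eventually_elim (use lower \<open>a < \<eta> y\<close> in force)
  next
    fix a assume a: "\<eta> y < a"
    define C where "C = {z \<in> X. a \<le> \<eta> z}"
    have "closed C"
      unfolding C_def using X \<eta> by (intro continuous_on_closed_Collect_le continuous_intros compact_imp_closed)
    then have C: "compact C" using compact_Int_closed[OF X, of C] by (simp add: C_def Int_def conj_commute cong: conj_cong)
    obtain \<kappa> where \<kappa>: "\<kappa> > 0" "\<And>z. z \<in> C \<Longrightarrow> \<kappa> \<le> c2 x z - \<phi> z - c2_transform X \<phi> x"
    proof (cases "C = {}")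
      case True
      then show ?thesis using that[of 1] by simp
    next
      case False
      have "continuous_on C (\<lambda>z. c2 x z - \<phi> z - c2_transform X \<phi> x)"
        unfolding c2_def by (intro continuous_intros continuous_on_subset[OF \<phi>]) (auto simp: C_def)
      then obtain z where z: "z \<in> C" "\<And>z'. z' \<in> C \<Longrightarrow> c2 x z - \<phi> z - c2_transform X \<phi> x \<le> c2 x z' - \<phi> z' - c2_transform X \<phi> x"
        using continuous_attains_inf[OF C False] by blast
      have "z \<in> X" "z \<noteq> y" using z(1) a by (auto simp: C_def)
      then have "c2 x z - \<phi> z \<noteq> c2_transform X \<phi> x" using y by (auto simp: c2_argmin_def)
      then have "c2 x z - \<phi> z - c2_transform X \<phi> x > 0"
        using c2_transform_le[OF X \<phi> x \<open>z \<in> X\<close>] by simp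
      then show ?thesis using that z(2) by blast
    qed
    have "B \<ge> 0" using B[OF y'(1)] by simp
    have "\<forall>\<^sub>F t in at_right 0. t < \<kappa> / (2 * B + 1)"
      using \<kappa>(1) \<open>B \<ge> 0\<close> by (intro eventually_at_rightI[of 0 "\<kappa> / (2 * B + 1)"]) auto
    then show "\<forall>\<^sub>F t in at_right 0. q t < a"
      using eventually_at_right_less[of 0]
    proof eventually_elim
      fix t :: real assume t: "t < \<kappa> / (2 * B + 1)" "0 < t"
      obtain z where z: "z \<in> X" "q t \<le> \<eta> z" "c2 x z - \<phi> z - c2_transform X \<phi> x \<le> t * (\<eta> z - \<eta> y)"
        using upper[OF t(2)] by blast
      have "t * (\<eta> z - \<eta> y) \<le> t * (2 * B + 1)"
        using B[OF z(1)] B[OF y'(1)] t(2) by (intro mult_left_mono) auto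
      also have "\<dots> < \<kappa>" using t(1) \<open>B \<ge> 0\<close> by (simp add: pos_less_divide_eq)
      finally have "z \<notin> C" using z(3) \<kappa>(2)[of z] by auto
      then show "q t < a" using z by (simp add: C_def)
    qed
  qed
qed

text \<open>The integrated form of the envelope theorem, stated as the only consequence that optimality arguments need: the
difference quotients dominate \<open>a\<close>, so does their limit.\<close>

lemma c2_transform_first_variation:
  fixes X :: "'a::euclidean_space set"
  assumes X: "compact X" and \<phi>: "continuous_on X \<phi>" and \<eta>: "continuous_on X \<eta>"
    and \<mu>: "\<mu> \<in> borel_probs X" and ac: "absolutely_continuous (restrict_space lborel X) \<mu>"
    and step: "\<And>t. 0 < t \<Longrightarrow> t \<le> 1 \<Longrightarrow> t * a \<le> (\<integral>x. c2_transform X \<phi> x \<partial>\<mu>) - (\<integral>x. c2_transform X (\<lambda>z. \<phi> z + t * \<eta> z) x \<partial>\<mu>)"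
  shows "a \<le> (\<integral>x. \<eta> (c2_argmin_map X \<phi> x) \<partial>\<mu>)"
proof -
  interpret prob_space \<mu> using borel_probsD[OF \<mu>] by simp
  obtain B where B: "\<And>z. z \<in> X \<Longrightarrow> \<bar>\<eta> z\<bar> \<le> B"
    using bounded_continuous_image[OF X \<eta>] by (auto simp: bounded_iff)
  define t where "t = (\<lambda>n. 1 / (real n + 1))"
  have t: "0 < t n" "t n \<le> 1" for n by (auto simp: t_def)
  have tlim: "filterlim t (at_right 0) sequentially"
    unfolding filterlim_at using t(1) LIMSEQ_inverse_real_of_nat
    by (auto simp: t_def inverse_eq_divide add.commute)
  define q where "q = (\<lambda>n x. (c2_transform X \<phi> x - c2_transform X (\<lambda>z. \<phi> z + t n * \<eta> z) x) / t n)"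
  have cont: "continuous_on X (c2_transform X (\<lambda>z. \<phi> z + s * \<eta> z))" for s
    by (intro continuous_on_c2_transform X continuous_intros \<phi> \<eta>)
  note int = continuous_on_integrable_borel_probs[OF \<mu> X]
  note AE = AE_c2_argmin_singleton[OF X \<phi> \<mu> ac]
  have "(\<lambda>n. \<integral>x. q n x \<partial>\<mu>) \<longlonglongrightarrow> (\<integral>x. \<eta> (c2_argmin_map X \<phi> x) \<partial>\<mu>)"
  proof (rule integral_dominated_convergence[where w = "\<lambda>_. B"])
    have "c2_argmin_map X \<phi> \<in> measurable \<mu> (borel_on X)"
      using c2_argmin_map_measurable[OF X \<phi>] by (simp add: measurable_borel_probs[OF \<mu>])
    then show "(\<lambda>x. \<eta> (c2_argmin_map X \<phi> x)) \<in> borel_measurable \<mu>"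
      by (rule measurable_compose[OF _ borel_measurable_continuous_on_restrict[OF \<eta>]])
    show "q n \<in> borel_measurable \<mu>" for n
      unfolding q_def using t(1)[of n]
      by (intro continuous_on_measurable_borel_probs[OF \<mu>] continuous_intros cont continuous_on_c2_transform X \<phi>) auto
    show "AE x in \<mu>. (\<lambda>n. q n x) \<longlonglongrightarrow> \<eta> (c2_argmin_map X \<phi> x)"
      using AE AE_space
    proof eventually_elim
      fix x assume "c2_argmin X \<phi> x = {c2_argmin_map X \<phi> x}" "x \<in> space \<mu>"
      then show "(\<lambda>n. q n x) \<longlonglongrightarrow> \<eta> (c2_argmin_map X \<phi> x)"
        unfolding q_def using borel_probsD(3)[OF \<mu>]
        by (intro filterlim_compose[OF c2_transform_directional_derivative(2)[OF X \<phi> \<eta> _ _ B] tlim]) auto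
    qed
    show "AE x in \<mu>. norm (q n x) \<le> B" for n
      using AE AE_space
    proof eventually_elim
      fix x assume "c2_argmin X \<phi> x = {c2_argmin_map X \<phi> x}" "x \<in> space \<mu>"
      then show "norm (q n x) \<le> B"
        using c2_transform_directional_derivative(1)[OF X \<phi> \<eta> _ _ B t(1)] borel_probsD(3)[OF \<mu>]
        by (simp add: q_def)
    qed
  qed simp
  moreover have "a \<le> (\<integral>x. q n x \<partial>\<mu>)" for n
  proof -
    have "(\<integral>x. q n x \<partial>\<mu>) = ((\<integral>x. c2_transform X \<phi> x \<partial>\<mu>) - (\<integral>x. c2_transform X (\<lambda>z. \<phi> z + t n * \<eta> z) x \<partial>\<mu>)) / t n"
      unfolding q_def
      using int[OF cont[of "t n"]] int[OF continuous_on_c2_transform[OF X \<phi>]] by simp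
    then show ?thesis using step[OF t(1,2)[of n]] t(1)[of n] by (simp add: pos_le_divide_eq mult.commute)
  qed
  ultimately show ?thesis by (intro LIMSEQ_le_const) auto
qed

section \<open>The dual functional on Lipschitz functions\<close>

lemma c2_transform_add_const:
  fixes X :: "'a::real_inner set"
  assumes X: "compact X" and \<phi>: "continuous_on X \<phi>" and x: "x \<in> X"
  shows "c2_transform X (\<lambda>y. \<phi> y + k) x = c2_transform X \<phi> x - k"
proof (rule antisym)
  have c: "continuous_on X (\<lambda>y. \<phi> y + k)" by (intro continuous_intros \<phi>)
  have "c2_transform X (\<lambda>y. \<phi> y + k) x + k \<le> c2_transform X \<phi> x"
  proof (rule c2_transform_greatest)
    fix y assume "y \<in> X"
    from c2_transform_le[OF X c x this]
    show "c2_transform X (\<lambda>y. \<phi> y + k) x + k \<le> c2 x y - \<phi> y" by simp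
  qed (use x in auto)
  then show "c2_transform X (\<lambda>y. \<phi> y + k) x \<le> c2_transform X \<phi> x - k" by simp
  show "c2_transform X \<phi> x - k \<le> c2_transform X (\<lambda>y. \<phi> y + k) x"
    using x c2_transform_le[OF X \<phi> x] by (intro c2_transform_greatest) auto
qed

lemma c2_transform_antimono:
  fixes X :: "'a::real_inner set"
  assumes X: "compact X" and \<phi>: "continuous_on X \<phi>" and x: "x \<in> X"
    and le: "\<And>y. y \<in> X \<Longrightarrow> \<phi>' y \<le> \<phi> y + e"
  shows "c2_transform X \<phi> x - e \<le> c2_transform X \<phi>' x"
proof (rule c2_transform_greatest)
  fix y assume "y \<in> X"
  then show "c2_transform X \<phi> x - e \<le> c2 x y - \<phi>' y"
    using c2_transform_le[OF X \<phi> x, of y] le[of y] by simp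
qed (use x in auto)

text \<open>For \<open>\<rho> = \<nu>\<close> this is the functional that is maximized over Lipschitz functions; equality with the transport cost
of \<open>c2\<close> means that \<open>\<phi>\<close> is a Kantorovich potential for \<open>(\<mu>, \<rho>)\<close>.\<close>

definition dual_value :: "'a::real_normed_vector set \<Rightarrow> 'a measure \<Rightarrow> 'a measure \<Rightarrow> ('a \<Rightarrow> real) \<Rightarrow> real" where
  "dual_value X \<mu> \<rho> \<phi> = (\<integral>x. c2_transform X \<phi> x \<partial>\<mu>) + (\<integral>x. \<phi> x \<partial>\<rho>)"

lemma kantorovich_potential_iff:
  fixes X :: "'a::euclidean_space set"
  assumes "compact X" "\<mu> \<in> borel_probs X" "\<rho> \<in> borel_probs X"
  shows "kantorovich_potential X \<mu> \<rho> \<phi> \<longleftrightarrow>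
    continuous_on X \<phi> \<and> dual_value X \<mu> \<rho> \<phi> = transport_cost X c2 \<mu> \<rho>"
  unfolding kantorovich_potential_def dual_value_def half_wasserstein2_sq[OF assms] ..

lemma dual_value_le:
  fixes X :: "'a::euclidean_space set"
  assumes X: "compact X" and \<phi>: "continuous_on X \<phi>"
    and \<mu>: "\<mu> \<in> borel_probs X" and \<rho>: "\<rho> \<in> borel_probs X"
  shows "dual_value X \<mu> \<rho> \<phi> \<le> transport_cost X c2 \<mu> \<rho>"
  unfolding dual_value_def
proof (rule dual_le_transport_cost[OF X continuous_on_c2 \<mu> \<rho>])
  show "integrable \<mu> (c2_transform X \<phi>)" "integrable \<rho> \<phi>"
    using continuous_on_integrable_borel_probs X \<mu> \<rho> \<phi> continuous_on_c2_transform[OF X \<phi>] by blast+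
  fix x y assume "x \<in> X" "y \<in> X"
  from c2_transform_le[OF X \<phi> this] show "c2_transform X \<phi> x + \<phi> y \<le> c2 x y" by simp
qed

lemma dual_value_add:
  fixes X :: "'a::euclidean_space set"
  assumes X: "compact X" and \<phi>: "continuous_on X \<phi>" and \<eta>: "continuous_on X \<eta>"
    and \<rho>: "\<rho> \<in> borel_probs X"
  shows "dual_value X \<mu> \<rho> (\<lambda>z. \<phi> z + t * \<eta> z) =
    (\<integral>x. c2_transform X (\<lambda>z. \<phi> z + t * \<eta> z) x \<partial>\<mu>) + (\<integral>x. \<phi> x \<partial>\<rho>) + t * (\<integral>x. \<eta> x \<partial>\<rho>)"
  unfolding dual_value_def
  using continuous_on_integrable_borel_probs[OF \<rho> X \<phi>] continuous_on_integrable_borel_probs[OF \<rho> X \<eta>] by simp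

lemma dual_value_add_const:
  fixes X :: "'a::euclidean_space set"
  assumes X: "compact X" and \<phi>: "continuous_on X \<phi>"
    and \<mu>: "\<mu> \<in> borel_probs X" and \<rho>: "\<rho> \<in> borel_probs X"
  shows "dual_value X \<mu> \<rho> (\<lambda>y. \<phi> y + k) = dual_value X \<mu> \<rho> \<phi>"
proof -
  interpret \<mu>: prob_space \<mu> using borel_probsD[OF \<mu>] by simp
  interpret \<rho>: prob_space \<rho> using borel_probsD[OF \<rho>] by simp
  have "(\<integral>x. c2_transform X (\<lambda>y. \<phi> y + k) x \<partial>\<mu>) = (\<integral>x. c2_transform X \<phi> x - k \<partial>\<mu>)"
    using c2_transform_add_const[OF X \<phi>] borel_probsD(3)[OF \<mu>]
    by (intro Bochner_Integration.integral_cong) auto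
  then show ?thesis
    using continuous_on_integrable_borel_probs[OF \<mu> X continuous_on_c2_transform[OF X \<phi>]]
      continuous_on_integrable_borel_probs[OF \<rho> X \<phi>]
    by (simp add: dual_value_def \<mu>.prob_space \<rho>.prob_space)
qed

lemma dual_value_uniform:
  fixes X :: "'a::euclidean_space set"
  assumes X: "compact X" and \<phi>: "continuous_on X \<phi>" and \<phi>': "continuous_on X \<phi>'"
    and \<mu>: "\<mu> \<in> borel_probs X" and \<rho>: "\<rho> \<in> borel_probs X"
    and le: "\<And>y. y \<in> X \<Longrightarrow> \<bar>\<phi> y - \<phi>' y\<bar> \<le> e"
  shows "dual_value X \<mu> \<rho> \<phi> \<le> dual_value X \<mu> \<rho> \<phi>' + 2 * e"
proof -
  interpret \<mu>: prob_space \<mu> using borel_probsD[OF \<mu>] by simp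
  interpret \<rho>: prob_space \<rho> using borel_probsD[OF \<rho>] by simp
  note i = continuous_on_integrable_borel_probs[OF \<mu> X] continuous_on_integrable_borel_probs[OF \<rho> X]
  have le': "\<phi>' y \<le> \<phi> y + e" "\<phi> y \<le> \<phi>' y + e" if "y \<in> X" for y using le[OF that] by linarith+
  have "(\<integral>x. c2_transform X \<phi> x \<partial>\<mu>) \<le> (\<integral>x. c2_transform X \<phi>' x + e \<partial>\<mu>)"
  proof (intro integral_mono i Bochner_Integration.integrable_add continuous_on_c2_transform X \<phi> \<phi>' continuous_intros)
    fix x assume "x \<in> space \<mu>"
    then have "x \<in> X" using borel_probsD(3)[OF \<mu>] by simp
    from c2_transform_antimono[OF X \<phi> this le'(1)]
    show "c2_transform X \<phi> x \<le> c2_transform X \<phi>' x + e" by simp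
  qed
  moreover have "(\<integral>x. \<phi> x \<partial>\<rho>) \<le> (\<integral>x. \<phi>' x + e \<partial>\<rho>)"
    using le' borel_probsD(3)[OF \<rho>] by (intro integral_mono i continuous_intros \<phi> \<phi>') auto
  ultimately show ?thesis
    using i(1)[OF continuous_on_c2_transform[OF X \<phi>']] i(2)[OF \<phi>']
    by (simp add: dual_value_def \<mu>.prob_space \<rho>.prob_space)
qed

text \<open>The dual functional ignores additive constants, so the functions can be made to vanish at one point, where
Arzela-Ascoli applies. The same limit serves all \<open>\<rho>\<close>: in \<open>D_fun_minimal\<close> it has to be a potential for one
measure and a maximizer for another.\<close>

lemma lipschitz_dual_value_compact:
  fixes X :: "'a::euclidean_space set" and f :: "nat \<Rightarrow> 'a \<Rightarrow> real"
  assumes X: "compact X" and \<mu>: "\<mu> \<in> borel_probs X"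
    and f: "\<And>n. L-lipschitz_on X (f n)"
  obtains g k where "L-lipschitz_on X g" "strict_mono k"
    "\<And>\<rho>. \<rho> \<in> borel_probs X \<Longrightarrow> (\<lambda>n. dual_value X \<mu> \<rho> (f (k n))) \<longlonglongrightarrow> dual_value X \<mu> \<rho> g"
proof -
  obtain x0 where x0: "x0 \<in> X" using borel_probs_nonempty[OF \<mu>] by blast
  have L: "L \<ge> 0" using lipschitz_on_nonneg[OF f[of 0]] .
  obtain R where R: "\<And>x. x \<in> X \<Longrightarrow> dist x x0 \<le> R"
    using compact_imp_bounded[OF X] bounded_any_center[of X x0] by (auto simp: dist_commute)
  define h where "h = (\<lambda>n x. f n x + - f n x0)"
  have hL: "L-lipschitz_on X (h n)" for n
    using f[of n] unfolding h_def lipschitz_on_def by (simp add: dist_real_def)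
  have hdist: "\<bar>h n x - h n y\<bar> \<le> L * dist x y" if "x \<in> X" "y \<in> X" for n x y
    using lipschitz_onD[OF hL that] by (simp add: dist_real_def)
  obtain g and k :: "nat \<Rightarrow> nat" where gk: "continuous_on X g" "strict_mono k"
    "\<And>e. 0 < e \<Longrightarrow> \<exists>N. \<forall>n x. n \<ge> N \<and> x \<in> X \<longrightarrow> norm (h (k n) x - g x) < e"
  proof (rule Arzela_Ascoli[of X h "L * R"])
    show "norm (h n x) \<le> L * R" if "x \<in> X" for n x
    proof -
      have "\<bar>h n x\<bar> \<le> L * dist x x0" using hdist[OF that x0, of n] by (simp add: h_def)
      also have "\<dots> \<le> L * R" using R[OF that] L by (intro mult_left_mono) auto
      finally show ?thesis by simp
    qed
    show "\<exists>d>0. \<forall>n y. y \<in> X \<and> norm (x - y) < d \<longrightarrow> norm (h n x - h n y) < e"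
      if "x \<in> X" "0 < e" for x e
    proof (intro exI[of _ "e / (L + 1)"] conjI allI impI)
      show "e / (L + 1) > 0" using L that by simp
      fix n y assume y: "y \<in> X \<and> norm (x - y) < e / (L + 1)"
      have "\<bar>h n x - h n y\<bar> \<le> L * dist x y" using hdist that(1) y by blast
      also have "\<dots> \<le> (L + 1) * dist x y" by (intro mult_right_mono) auto
      also have "\<dots> < e" using y L by (simp add: dist_norm pos_less_divide_eq mult.commute)
      finally show "norm (h n x - h n y) < e" by simp
    qed
  qed (use X that in auto)
  have lim: "(\<lambda>n. h (k n) x) \<longlonglongrightarrow> g x" if "x \<in> X" for x
  proof (rule LIMSEQ_I)
    fix e :: real assume "0 < e"
    from gk(3)[OF this] show "\<exists>N. \<forall>n\<ge>N. norm (h (k n) x - g x) < e" using that by blast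
  qed
  have "L-lipschitz_on X g"
  proof (rule lipschitz_onI)
    fix x y assume xy: "x \<in> X" "y \<in> X"
    have "(\<lambda>n. \<bar>h (k n) x - h (k n) y\<bar>) \<longlonglongrightarrow> \<bar>g x - g y\<bar>"
      using xy by (intro tendsto_intros lim)
    then show "dist (g x) (g y) \<le> L * dist x y"
      unfolding dist_real_def by (rule LIMSEQ_le_const2) (use hdist[OF xy] in auto)
  qed fact
  moreover note gk(2)
  moreover have "(\<lambda>n. dual_value X \<mu> \<rho> (f (k n))) \<longlonglongrightarrow> dual_value X \<mu> \<rho> g"
    if \<rho>: "\<rho> \<in> borel_probs X" for \<rho>
  proof (rule LIMSEQ_I)
    fix e :: real assume "e > 0"
    then obtain N where N: "\<And>n x. n \<ge> N \<Longrightarrow> x \<in> X \<Longrightarrow> \<bar>h (k n) x - g x\<bar> < e / 4"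
      using gk(3)[of "e / 4"] by auto
    have hc: "continuous_on X (h n)" for n by (rule lipschitz_on_continuous_on[OF hL])
    have "norm (dual_value X \<mu> \<rho> (f (k n)) - dual_value X \<mu> \<rho> g) < e" if "n \<ge> N" for n
    proof -
      have "dual_value X \<mu> \<rho> (f (k n)) = dual_value X \<mu> \<rho> (h (k n))"
        unfolding h_def by (rule dual_value_add_const[OF X lipschitz_on_continuous_on[OF f] \<mu> \<rho>, symmetric])
      moreover have "dual_value X \<mu> \<rho> (h (k n)) \<le> dual_value X \<mu> \<rho> g + 2 * (e / 4)"
        using N[OF that] by (intro dual_value_uniform[OF X hc gk(1) \<mu> \<rho>]) (auto intro: less_imp_le)
      moreover have "dual_value X \<mu> \<rho> g \<le> dual_value X \<mu> \<rho> (h (k n)) + 2 * (e / 4)"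
        using N[OF that] by (intro dual_value_uniform[OF X gk(1) hc \<mu> \<rho>]) (auto simp: abs_minus_commute intro: less_imp_le)
      ultimately show ?thesis using \<open>e > 0\<close> by (simp add: abs_less_iff)
    qed
    then show "\<exists>N. \<forall>n\<ge>N. norm (dual_value X \<mu> \<rho> (f (k n)) - dual_value X \<mu> \<rho> g) < e" by blast
  qed
  ultimately show ?thesis using that by blast
qed

lemma lipschitz_dual_value_attains_max:
  fixes X :: "'a::euclidean_space set"
  assumes X: "compact X" and \<mu>: "\<mu> \<in> borel_probs X" and \<nu>: "\<nu> \<in> borel_probs X" and L: "L \<ge> 0"
  obtains \<phi> where "L-lipschitz_on X \<phi>"
    "\<And>\<phi>'. L-lipschitz_on X \<phi>' \<Longrightarrow> dual_value X \<mu> \<nu> \<phi>' \<le> dual_value X \<mu> \<nu> \<phi>"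
proof -
  define V where "V = dual_value X \<mu> \<nu> ` {\<phi>. L-lipschitz_on X \<phi>}"
  have "L-lipschitz_on X (\<lambda>_. 0 :: real)" using L by (simp add: lipschitz_on_def)
  then have V: "V \<noteq> {}" by (auto simp: V_def)
  have bdd: "bdd_above V"
    using dual_value_le[OF X lipschitz_on_continuous_on \<mu> \<nu>] unfolding V_def by (auto intro!: bdd_aboveI2)
  have "\<exists>\<phi>. L-lipschitz_on X \<phi> \<and> Sup V - 1 / real (Suc n) < dual_value X \<mu> \<nu> \<phi>" for n
    using less_cSup_iff[OF V bdd, of "Sup V - 1 / real (Suc n)"] by (auto simp: V_def)
  then obtain f where f: "\<And>n. L-lipschitz_on X (f n)"
    "\<And>n. Sup V - 1 / real (Suc n) < dual_value X \<mu> \<nu> (f n)" by metis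
  obtain g k where g: "L-lipschitz_on X g" "strict_mono k"
    "\<And>\<rho>. \<rho> \<in> borel_probs X \<Longrightarrow> (\<lambda>n. dual_value X \<mu> \<rho> (f (k n))) \<longlonglongrightarrow> dual_value X \<mu> \<rho> g"
    by (rule lipschitz_dual_value_compact[OF X \<mu> f(1)]) (rule that; assumption)
  have "(\<lambda>n. Sup V - 1 / real (Suc n)) \<longlonglongrightarrow> Sup V - 0"
    by (intro tendsto_intros LIMSEQ_Suc lim_1_over_n)
  then have "(\<lambda>n. Sup V - 1 / real (Suc (k n))) \<longlonglongrightarrow> Sup V"
    using LIMSEQ_subseq_LIMSEQ[OF _ g(2)] by (simp only: comp_def diff_zero)
  then have "Sup V \<le> dual_value X \<mu> \<nu> g"
    by (rule LIMSEQ_le[OF _ g(3)[OF \<nu>]]) (use f(2) in \<open>auto intro: less_imp_le\<close>)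
  then show ?thesis
    using that[OF g(1)] cSup_upper[OF _ bdd] order_trans unfolding V_def by blast
qed

text \<open>Almost everywhere \<open>c2 x (T x) = \<phi>\<^sup>c x + \<phi> (T x)\<close>. Integration gives a plan and a dual pair of equal value, so both
are optimal by weak duality.\<close>

lemma potential_of_argmin_map:
  fixes X :: "'a::euclidean_space set"
  assumes X: "compact X" and \<phi>: "continuous_on X \<phi>" and \<mu>: "\<mu> \<in> borel_probs X"
    and ac: "absolutely_continuous (restrict_space lborel X) \<mu>"
  defines "\<rho> \<equiv> argmin_target X \<mu> \<phi>"
  shows "\<rho> \<in> borel_probs X" "dual_value X \<mu> \<rho> \<phi> = transport_cost X c2 \<mu> \<rho>"
    "(\<integral>x. c2 x (c2_argmin_map X \<phi> x) \<partial>\<mu>) = transport_cost X c2 \<mu> \<rho>"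
proof -
  let ?T = "c2_argmin_map X \<phi>"
  have T: "?T \<in> measurable \<mu> (borel_on X)"
    using c2_argmin_map_measurable[OF X \<phi>] by (simp add: measurable_borel_probs[OF \<mu>])
  show \<rho>: "\<rho> \<in> borel_probs X" unfolding \<rho>_def by (rule map_coupling(3)[OF \<mu> T])
  have \<phi>m: "\<phi> \<in> borel_measurable (borel_on X)"
    by (rule borel_measurable_continuous_on_restrict[OF \<phi>])
  have i: "integrable \<mu> (\<lambda>x. \<phi> (?T x))"
    using continuous_on_integrable_borel_probs[OF \<rho> X \<phi>] integrable_distr_eq[OF T \<phi>m] by (simp add: \<rho>_def)
  have i': "integrable \<mu> (c2_transform X \<phi>)"
    by (rule continuous_on_integrable_borel_probs[OF \<mu> X continuous_on_c2_transform[OF X \<phi>]])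
  have "(\<integral>x. c2 x (?T x) \<partial>\<mu>) = (\<integral>x. c2_transform X \<phi> x + \<phi> (?T x) \<partial>\<mu>)"
  proof (rule integral_cong_AE)
    show "(\<lambda>x. c2 x (?T x)) \<in> borel_measurable \<mu>"
      using transport_cost_map_le(2)[OF X continuous_on_c2 \<mu> T] by (rule borel_measurable_integrable)
    show "AE x in \<mu>. c2 x (?T x) = c2_transform X \<phi> x + \<phi> (?T x)"
      using AE_c2_argmin_singleton[OF X \<phi> \<mu> ac]
    proof eventually_elim
      fix x assume "c2_argmin X \<phi> x = {?T x}"
      then have "?T x \<in> c2_argmin X \<phi> x" by simp
      then show "c2 x (?T x) = c2_transform X \<phi> x + \<phi> (?T x)" by (simp add: c2_argmin_def)
    qed
  qed (use i i' in auto)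
  also have "\<dots> = dual_value X \<mu> \<rho> \<phi>"
    using i i' integral_distr[OF T \<phi>m] by (simp add: dual_value_def \<rho>_def)
  finally have eq: "(\<integral>x. c2 x (?T x) \<partial>\<mu>) = dual_value X \<mu> \<rho> \<phi>" .
  have "dual_value X \<mu> \<rho> \<phi> \<le> transport_cost X c2 \<mu> \<rho>" by (rule dual_value_le[OF X \<phi> \<mu> \<rho>])
  moreover have "transport_cost X c2 \<mu> \<rho> \<le> (\<integral>x. c2 x (?T x) \<partial>\<mu>)"
    unfolding \<rho>_def by (rule transport_cost_map_le(1)[OF X continuous_on_c2 \<mu> T])
  ultimately show "dual_value X \<mu> \<rho> \<phi> = transport_cost X c2 \<mu> \<rho>"
    "(\<integral>x. c2 x (?T x) \<partial>\<mu>) = transport_cost X c2 \<mu> \<rho>"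
    using eq by simp_all
qed

text \<open>A potential \<open>\<phi>\<close> for \<open>\<rho>\<close> maximizes the dual functional of \<open>\<rho>\<close> over all continuous functions. The first variation in
the directions \<open>\<eta>\<close> and \<open>- \<eta>\<close> identifies \<open>\<integral> \<eta> d\<rho>\<close>.\<close>

lemma potential_determines_target:
  fixes X :: "'a::euclidean_space set"
  assumes X: "compact X" and \<phi>: "continuous_on X \<phi>" and \<mu>: "\<mu> \<in> borel_probs X"
    and ac: "absolutely_continuous (restrict_space lborel X) \<mu>" and \<rho>: "\<rho> \<in> borel_probs X"
    and opt: "dual_value X \<mu> \<rho> \<phi> = transport_cost X c2 \<mu> \<rho>"
  shows "\<rho> = argmin_target X \<mu> \<phi>"
proof (rule borel_probs_eqI[OF X \<rho> potential_of_argmin_map(1)[OF X \<phi> \<mu> ac]])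
  let ?T = "c2_argmin_map X \<phi>"
  have T: "?T \<in> measurable \<mu> (borel_on X)"
    using c2_argmin_map_measurable[OF X \<phi>] by (simp add: measurable_borel_probs[OF \<mu>])
  have le: "(\<integral>x. \<eta> x \<partial>\<rho>) \<le> (\<integral>x. \<eta> (?T x) \<partial>\<mu>)" if \<eta>: "continuous_on X \<eta>" for \<eta> :: "'a \<Rightarrow> real"
  proof (rule c2_transform_first_variation[OF X \<phi> \<eta> \<mu> ac])
    fix t :: real
    have "continuous_on X (\<lambda>z. \<phi> z + t * \<eta> z)" by (intro continuous_intros \<phi> \<eta>)
    then have "dual_value X \<mu> \<rho> (\<lambda>z. \<phi> z + t * \<eta> z) \<le> dual_value X \<mu> \<rho> \<phi>"
      unfolding opt by (rule dual_value_le[OF X _ \<mu> \<rho>])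
    then show "t * (\<integral>x. \<eta> x \<partial>\<rho>) \<le>
        (\<integral>x. c2_transform X \<phi> x \<partial>\<mu>) - (\<integral>x. c2_transform X (\<lambda>z. \<phi> z + t * \<eta> z) x \<partial>\<mu>)"
      unfolding dual_value_add[OF X \<phi> \<eta> \<rho>] by (simp add: dual_value_def)
  qed
  fix f :: "'a \<Rightarrow> real" and L assume "L-lipschitz_on UNIV f"
  then have f: "continuous_on X f"
    using lipschitz_on_continuous_on continuous_on_subset by blast
  have "(\<integral>x. f (?T x) \<partial>\<mu>) = (\<integral>x. f x \<partial>distr \<mu> (borel_on X) ?T)"
    by (rule integral_distr[OF T borel_measurable_continuous_on_restrict[OF f], symmetric])
  moreover have "continuous_on X (\<lambda>x. - f x)" by (intro continuous_intros f)
  ultimately show "(\<integral>x. f x \<partial>\<rho>) = (\<integral>x. f x \<partial>distr \<mu> (borel_on X) ?T)"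
    using le[OF f] le[of "\<lambda>x. - f x"] by simp
qed

text \<open>The segment from \<open>\<phi>\<close> to \<open>\<phi>'\<close> stays in the convex set of \<open>L\<close>-Lipschitz functions, along which the dual functional
cannot increase at \<open>\<phi>\<close>.\<close>

lemma maximal_dual_value_first_order:
  fixes X :: "'a::euclidean_space set"
  assumes X: "compact X" and \<phi>: "L-lipschitz_on X \<phi>" and \<mu>: "\<mu> \<in> borel_probs X"
    and ac: "absolutely_continuous (restrict_space lborel X) \<mu>" and \<nu>: "\<nu> \<in> borel_probs X"
    and max: "\<And>\<phi>'. L-lipschitz_on X \<phi>' \<Longrightarrow> dual_value X \<mu> \<nu> \<phi>' \<le> dual_value X \<mu> \<nu> \<phi>"
    and \<phi>': "L-lipschitz_on X \<phi>'"
  defines "\<rho> \<equiv> argmin_target X \<mu> \<phi>"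
  shows "(\<integral>x. \<phi>' x \<partial>\<nu>) - (\<integral>x. \<phi>' x \<partial>\<rho>) \<le> (\<integral>x. \<phi> x \<partial>\<nu>) - (\<integral>x. \<phi> x \<partial>\<rho>)"
proof -
  let ?T = "c2_argmin_map X \<phi>" and ?\<eta> = "\<lambda>x. \<phi>' x - \<phi> x"
  have c: "continuous_on X \<phi>" "continuous_on X \<phi>'" using \<phi> \<phi>' lipschitz_on_continuous_on by blast+
  have T: "?T \<in> measurable \<mu> (borel_on X)"
    using c2_argmin_map_measurable[OF X c(1)] by (simp add: measurable_borel_probs[OF \<mu>])
  have \<eta>: "continuous_on X ?\<eta>" by (intro continuous_intros c)
  have \<rho>: "\<rho> \<in> borel_probs X" unfolding \<rho>_def by (rule map_coupling(3)[OF \<mu> T])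
  have "(\<integral>x. ?\<eta> x \<partial>\<nu>) \<le> (\<integral>x. ?\<eta> (?T x) \<partial>\<mu>)"
  proof (rule c2_transform_first_variation[OF X c(1) \<eta> \<mu> ac])
    fix t :: real assume t: "0 < t" "t \<le> 1"
    have "L-lipschitz_on X (\<lambda>z. \<phi> z + t * ?\<eta> z)"
    proof (rule lipschitz_onI)
      fix x y assume xy: "x \<in> X" "y \<in> X"
      have "(\<phi> x + t * ?\<eta> x) - (\<phi> y + t * ?\<eta> y) = (1 - t) * (\<phi> x - \<phi> y) + t * (\<phi>' x - \<phi>' y)"
        by (simp add: algebra_simps)
      then have "\<bar>(\<phi> x + t * ?\<eta> x) - (\<phi> y + t * ?\<eta> y)\<bar> \<le> (1 - t) * \<bar>\<phi> x - \<phi> y\<bar> + t * \<bar>\<phi>' x - \<phi>' y\<bar>"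
        using t abs_triangle_ineq[of "(1 - t) * (\<phi> x - \<phi> y)" "t * (\<phi>' x - \<phi>' y)"] by (simp add: abs_mult)
      also have "\<dots> \<le> (1 - t) * (L * dist x y) + t * (L * dist x y)"
        using t lipschitz_onD[OF \<phi> xy] lipschitz_onD[OF \<phi>' xy]
        by (intro add_mono mult_left_mono) (auto simp: dist_real_def)
      finally show "dist (\<phi> x + t * ?\<eta> x) (\<phi> y + t * ?\<eta> y) \<le> L * dist x y"
        by (simp add: dist_real_def algebra_simps)
    qed (rule lipschitz_on_nonneg[OF \<phi>])
    from max[OF this] show "t * (\<integral>x. ?\<eta> x \<partial>\<nu>) \<le>
        (\<integral>x. c2_transform X \<phi> x \<partial>\<mu>) - (\<integral>x. c2_transform X (\<lambda>z. \<phi> z + t * ?\<eta> z) x \<partial>\<mu>)"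
      unfolding dual_value_add[OF X c(1) \<eta> \<nu>] by (simp add: dual_value_def)
  qed
  also have "\<dots> = (\<integral>x. ?\<eta> x \<partial>\<rho>)"
    unfolding \<rho>_def by (rule integral_distr[OF T borel_measurable_continuous_on_restrict[OF \<eta>], symmetric])
  finally show ?thesis
    using c continuous_on_integrable_borel_probs[OF \<nu> X] continuous_on_integrable_borel_probs[OF \<rho> X] by simp
qed

section \<open>The Huber cost and the Kantorovich-Rubinstein formula\<close>

lemma huber_eq_min:
  "huber lam x y = min (norm (x - y)) lam * norm (x - y) - (min (norm (x - y)) lam)\<^sup>2 / 2"
  by (simp add: huber_def min_def power2_eq_square)

lemma continuous_on_huber: "continuous_on A (\<lambda>z. huber lam (fst z) (snd z))"
  unfolding huber_eq_min by (intro continuous_intros) simp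

lemma huber_sym: "huber lam x y = huber lam y x"
  by (simp add: huber_def norm_minus_commute)

lemma huber_le_c2: "huber lam x y \<le> c2 x y"
proof -
  have "0 \<le> (norm (x - y) - lam)\<^sup>2" by simp
  then show ?thesis by (auto simp: huber_def c2_def power2_eq_square algebra_simps)
qed

lemma huber_profile_lipschitz:
  fixes r s lam :: real
  assumes "0 \<le> s" "s \<le> r" "0 \<le> lam"
  shows "(min r lam * r - (min r lam)\<^sup>2 / 2) - (min s lam * s - (min s lam)\<^sup>2 / 2) \<in> {0..lam * (r - s)}"
proof -
  consider "r \<le> lam" | "s \<le> lam" "lam < r" | "lam < s" by linarith
  then show ?thesis
  proof cases
    case 1
    have "0 \<le> (r - s) * (r + s)" using assms by simp
    moreover have "(r - s) * (r + s) \<le> (r - s) * (2 * lam)" using 1 assms by (intro mult_left_mono) auto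
    ultimately show ?thesis using 1 assms by (simp add: min_def power2_eq_square algebra_simps)
  next
    case 2
    have "0 \<le> (lam - s) * (lam - s)" by simp
    moreover have "lam * lam \<le> lam * r" using 2 assms by (intro mult_left_mono) auto
    moreover have "s * s \<le> lam * lam" using 2 assms by (intro mult_mono) auto
    ultimately show ?thesis using 2 assms by (simp add: min_def power2_eq_square algebra_simps)
  next
    case 3
    have "0 \<le> lam * (r - s)" using assms by simp
    then show ?thesis using 3 assms by (simp add: min_def algebra_simps)
  qed
qed

lemma lipschitz_on_huber:
  assumes "lam \<ge> 0"
  shows "lam-lipschitz_on X (\<lambda>x. huber lam x y)"
proof (rule lipschitz_onI)
  fix x x' :: 'a
  have *: "\<bar>huber lam x y - huber lam x' y\<bar> \<le> lam * norm (x - x')"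
    if "norm (x' - y) \<le> norm (x - y)" for x x' :: 'a
  proof -
    have "\<bar>huber lam x y - huber lam x' y\<bar> \<le> lam * (norm (x - y) - norm (x' - y))"
      using huber_profile_lipschitz[OF norm_ge_zero that assms] by (simp add: huber_eq_min)
    also have "\<dots> \<le> lam * norm (x - x')"
      using norm_triangle_ineq2[of "x - y" "x' - y"] assms by (intro mult_left_mono) auto
    finally show ?thesis .
  qed
  show "dist (huber lam x y) (huber lam x' y) \<le> lam * dist x x'"
    using *[of x' x] *[of x x'] by (cases "norm (x' - y) \<le> norm (x - y)")
      (auto simp: dist_real_def dist_norm abs_minus_commute norm_minus_commute)
qed fact

text \<open>The step functions of the approximate duality improve when they are replaced by their \<open>c\<close>-transforms: \<open>\<phi> = \<psi>\<^sup>c\<close>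
dominates the second function, and \<open>\<phi>\<^sup>c\<close> dominates \<open>\<psi>\<close>. Transforms inherit the Lipschitz constant of the cost.\<close>

lemma lipschitz_approximate_dual:
  fixes X :: "'a::euclidean_space set" and c :: "'a \<Rightarrow> 'a \<Rightarrow> real"
  assumes X: "compact X" and c: "continuous_on (X \<times> X) (\<lambda>z. c (fst z) (snd z))"
    and sym: "\<And>x y. c x y = c y x" and lip: "\<And>y. y \<in> X \<Longrightarrow> L-lipschitz_on X (\<lambda>x. c x y)"
    and \<mu>: "\<mu> \<in> borel_probs X" and \<nu>: "\<nu> \<in> borel_probs X" and "e > 0"
  obtains \<phi> where "L-lipschitz_on X \<phi>" "L-lipschitz_on X (c_transform X c \<phi>)"
    "transport_cost X c \<mu> \<nu> \<le> (\<integral>x. c_transform X c \<phi> x \<partial>\<mu>) + (\<integral>x. \<phi> x \<partial>\<nu>) + e"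
proof -
  have ne: "X \<noteq> {}" using borel_probs_nonempty[OF \<mu>] .
  then have L: "L \<ge> 0" using lip lipschitz_on_nonneg by blast
  obtain \<gamma> \<psi> \<phi>0 where \<gamma>: "\<gamma> \<in> couplings X \<mu> \<nu>" and i: "integrable \<mu> \<psi>" "integrable \<nu> \<phi>0"
    and \<psi>: "bounded (\<psi> ` X)" and feas: "\<And>x z. x \<in> X \<Longrightarrow> z \<in> X \<Longrightarrow> \<psi> x + \<phi>0 z \<le> c x z"
    and gap: "(\<integral>z. c (fst z) (snd z) \<partial>\<gamma>) \<le> (\<integral>x. \<psi> x \<partial>\<mu>) + (\<integral>z. \<phi>0 z \<partial>\<nu>) + e"
    by (rule approximate_transport_duality[OF X c \<mu> \<nu> \<open>e > 0\<close>]) blast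
  define \<phi> where "\<phi> = c_transform X c \<psi>"
  have \<phi>: "L-lipschitz_on X \<phi>"
    unfolding \<phi>_def by (rule lipschitz_on_c_transform[OF X c \<psi> lip L])
  have \<phi>b: "bounded (\<phi> ` X)"
    by (rule bounded_continuous_image[OF X lipschitz_on_continuous_on[OF \<phi>]])
  have \<phi>c: "L-lipschitz_on X (c_transform X c \<phi>)"
    by (rule lipschitz_on_c_transform[OF X c \<phi>b lip L])
  have "\<phi>0 z \<le> \<phi> z" if "z \<in> X" for z
    unfolding \<phi>_def
  proof (rule c_transform_greatest[OF ne])
    fix x assume "x \<in> X"
    from feas[OF this that] show "\<phi>0 z \<le> c z x - \<psi> x" by (simp add: sym[of z x])
  qed
  then have 1: "(\<integral>z. \<phi>0 z \<partial>\<nu>) \<le> (\<integral>z. \<phi> z \<partial>\<nu>)"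
    using i(2) borel_probsD(3)[OF \<nu>] continuous_on_integrable_borel_probs[OF \<nu> X lipschitz_on_continuous_on[OF \<phi>]]
    by (intro integral_mono) auto
  have "\<psi> x \<le> c_transform X c \<phi> x" if "x \<in> X" for x
  proof (rule c_transform_greatest[OF ne])
    fix y assume "y \<in> X"
    from c_transform_le[OF X c \<psi> this that] show "\<psi> x \<le> c x y - \<phi> y"
      by (simp add: \<phi>_def sym[of y x])
  qed
  then have 2: "(\<integral>x. \<psi> x \<partial>\<mu>) \<le> (\<integral>x. c_transform X c \<phi> x \<partial>\<mu>)"
    using i(1) borel_probsD(3)[OF \<mu>] continuous_on_integrable_borel_probs[OF \<mu> X lipschitz_on_continuous_on[OF \<phi>c]]
    by (intro integral_mono) auto
  show ?thesis
    using that[OF \<phi> \<phi>c] 1 2 gap transport_cost_le[OF X c \<gamma>] by simp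
qed

text \<open>A transform for the Huber cost lies below the one for \<open>c2\<close>, because the Huber cost does.\<close>

lemma huber_cost_le_dual_value:
  fixes X :: "'a::euclidean_space set"
  assumes X: "compact X" and \<mu>: "\<mu> \<in> borel_probs X" and \<nu>: "\<nu> \<in> borel_probs X" and "lam \<ge> 0"
    and V: "\<And>\<phi>. lam-lipschitz_on X \<phi> \<Longrightarrow> dual_value X \<mu> \<nu> \<phi> \<le> V"
  shows "transport_cost X (huber lam) \<mu> \<nu> \<le> V"
proof (rule field_le_epsilon)
  fix e :: real assume "e > 0"
  obtain \<phi> where \<phi>: "lam-lipschitz_on X \<phi>" "lam-lipschitz_on X (c_transform X (huber lam) \<phi>)"
    "transport_cost X (huber lam) \<mu> \<nu> \<le> (\<integral>x. c_transform X (huber lam) \<phi> x \<partial>\<mu>) + (\<integral>x. \<phi> x \<partial>\<nu>) + e"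
    by (rule lipschitz_approximate_dual[OF X continuous_on_huber huber_sym lipschitz_on_huber \<mu> \<nu> \<open>e > 0\<close>])
      (use \<open>lam \<ge> 0\<close> in blast)+
  note \<phi>c = lipschitz_on_continuous_on[OF \<phi>(1)]
  have "c_transform X (huber lam) \<phi> x \<le> c2_transform X \<phi> x" if "x \<in> X" for x
  proof (rule c2_transform_greatest)
    fix y assume "y \<in> X"
    from c_transform_le[OF X continuous_on_huber bounded_continuous_image[OF X \<phi>c] that this, of lam]
    show "c_transform X (huber lam) \<phi> x \<le> c2 x y - \<phi> y" using huber_le_c2[of lam x y] by simp
  qed (use that in auto)
  then have "(\<integral>x. c_transform X (huber lam) \<phi> x \<partial>\<mu>) \<le> (\<integral>x. c2_transform X \<phi> x \<partial>\<mu>)"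
    using borel_probsD(3)[OF \<mu>] lipschitz_on_continuous_on[OF \<phi>(2)] continuous_on_c2_transform[OF X \<phi>c]
    by (intro integral_mono continuous_on_integrable_borel_probs[OF \<mu> X]) auto
  then show "transport_cost X (huber lam) \<mu> \<nu> \<le> V + e"
    using \<phi>(3) V[OF \<phi>(1)] by (simp add: dual_value_def)
qed

text \<open>For the distance the transform of a 1-Lipschitz \<open>\<phi>\<close> is at most \<open>- \<phi>\<close>, as \<open>y = x\<close> is admissible in the infimum.\<close>

lemma kantorovich_rubinstein_le:
  fixes X :: "'a::euclidean_space set"
  assumes X: "compact X" and \<mu>: "\<mu> \<in> borel_probs X" and \<nu>: "\<nu> \<in> borel_probs X" and L: "L > 0"
    and V: "\<And>\<phi>. L-lipschitz_on X \<phi> \<Longrightarrow> (\<integral>x. \<phi> x \<partial>\<nu>) - (\<integral>x. \<phi> x \<partial>\<mu>) \<le> V"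
  shows "L * wasserstein X 1 \<mu> \<nu> \<le> V"
proof -
  have "wasserstein X 1 \<mu> \<nu> \<le> V / L"
  proof (rule field_le_epsilon)
    fix e :: real assume "e > 0"
    have c: "continuous_on A (\<lambda>z. norm (fst z - snd z))" for A :: "('a \<times> 'a) set"
      by (intro continuous_intros)
    have "1-lipschitz_on X (\<lambda>x. norm (x - y))" for y
      using norm_triangle_ineq3[of "a - y" "b - y" for a b] by (intro lipschitz_onI) (auto simp: dist_real_def dist_norm)
    then obtain \<phi> where \<phi>: "1-lipschitz_on X \<phi>" "1-lipschitz_on X (c_transform X (\<lambda>x y. norm (x - y)) \<phi>)"
      "transport_cost X (\<lambda>x y. norm (x - y)) \<mu> \<nu>
        \<le> (\<integral>x. c_transform X (\<lambda>x y. norm (x - y)) \<phi> x \<partial>\<mu>) + (\<integral>x. \<phi> x \<partial>\<nu>) + e"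
      using lipschitz_approximate_dual[OF X c norm_minus_commute _ \<mu> \<nu> \<open>e > 0\<close>] by blast
    note \<phi>c = lipschitz_on_continuous_on[OF \<phi>(1)]
    have "c_transform X (\<lambda>x y. norm (x - y)) \<phi> x \<le> - \<phi> x" if "x \<in> X" for x
      using c_transform_le[OF X c bounded_continuous_image[OF X \<phi>c] that that] by simp
    then have "(\<integral>x. c_transform X (\<lambda>x y. norm (x - y)) \<phi> x \<partial>\<mu>) \<le> (\<integral>x. - \<phi> x \<partial>\<mu>)"
      using borel_probsD(3)[OF \<mu>] lipschitz_on_continuous_on[OF \<phi>(2)] \<phi>c
      by (intro integral_mono continuous_on_integrable_borel_probs[OF \<mu> X] continuous_intros) auto
    moreover have "L-lipschitz_on X (\<lambda>x. L * \<phi> x)"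
      using lipschitz_on_cmult_real[OF \<phi>(1), of L] L by simp
    from V[OF this] have "L * ((\<integral>x. \<phi> x \<partial>\<nu>) - (\<integral>x. \<phi> x \<partial>\<mu>)) \<le> V" by (simp add: right_diff_distrib)
    then have "(\<integral>x. \<phi> x \<partial>\<nu>) - (\<integral>x. \<phi> x \<partial>\<mu>) \<le> V / L" using L by (simp add: pos_le_divide_eq mult.commute)
    ultimately show "wasserstein X 1 \<mu> \<nu> \<le> V / L + e"
      using \<phi>(3) by (simp add: wasserstein1[OF \<mu> \<nu>])
  qed
  then show ?thesis using L by (simp add: pos_le_divide_eq mult.commute)
qed

lemma wasserstein_nonneg: "0 \<le> wasserstein X p \<mu> \<nu>"
  by (simp add: wasserstein_def)

lemma lipschitz_le_wasserstein1:
  fixes X :: "'a::euclidean_space set"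
  assumes X: "compact X" and \<mu>: "\<mu> \<in> borel_probs X" and \<nu>: "\<nu> \<in> borel_probs X"
    and \<phi>: "L-lipschitz_on X \<phi>"
  shows "(\<integral>x. \<phi> x \<partial>\<nu>) - (\<integral>x. \<phi> x \<partial>\<mu>) \<le> L * wasserstein X 1 \<mu> \<nu>"
proof -
  have L: "L \<ge> 0" using lipschitz_on_nonneg[OF \<phi>] .
  note \<phi>c = lipschitz_on_continuous_on[OF \<phi>]
  have c: "continuous_on A (\<lambda>z. norm (fst z - snd z))" for A :: "('a \<times> 'a) set"
    by (intro continuous_intros)
  have "(\<integral>x. \<phi> x \<partial>\<nu>) - (\<integral>x. \<phi> x \<partial>\<mu>) \<le> L * (\<integral>z. norm (fst z - snd z) \<partial>\<gamma>)"
    if \<gamma>: "\<gamma> \<in> couplings X \<mu> \<nu>" for \<gamma>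
  proof -
    have "(\<integral>x. - \<phi> x \<partial>\<mu>) + (\<integral>x. \<phi> x \<partial>\<nu>) \<le> (\<integral>z. L * norm (fst z - snd z) \<partial>\<gamma>)"
    proof (rule coupling_dual_le[OF X _ \<gamma>])
      show "continuous_on (X \<times> X) (\<lambda>z. L * norm (fst z - snd z))" by (intro continuous_intros)
      show "integrable \<mu> (\<lambda>x. - \<phi> x)" "integrable \<nu> \<phi>"
        by (intro continuous_on_integrable_borel_probs[OF \<mu> X] continuous_on_integrable_borel_probs[OF \<nu> X]
            continuous_intros \<phi>c)+
      show "- \<phi> x + \<phi> y \<le> L * norm (x - y)" if "x \<in> X" "y \<in> X" for x y
        using lipschitz_onD[OF \<phi> that] by (simp add: dist_real_def dist_norm)
    qed
    then show ?thesis by simp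
  qed
  note le = this
  show ?thesis
  proof (cases "L = 0")
    case True
    obtain \<gamma> where "\<gamma> \<in> couplings X \<mu> \<nu>" using couplings_nonempty[OF \<mu> \<nu>] by blast
    from le[OF this] show ?thesis by (simp add: True)
  next
    case False
    then have "L > 0" using L by simp
    have "((\<integral>x. \<phi> x \<partial>\<nu>) - (\<integral>x. \<phi> x \<partial>\<mu>)) / L \<le> wasserstein X 1 \<mu> \<nu>"
      unfolding wasserstein1[OF \<mu> \<nu>]
      using le \<open>L > 0\<close> by (intro transport_cost_greatest[OF \<mu> \<nu>]) (simp add: pos_divide_le_eq mult.commute)
    then show ?thesis using \<open>L > 0\<close> by (simp add: pos_divide_le_eq mult.commute)
  qed
qed

lemma wasserstein1_eq_0_imp_eq:
  fixes X :: "'a::euclidean_space set"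
  assumes X: "compact X" and \<mu>: "\<mu> \<in> borel_probs X" and \<nu>: "\<nu> \<in> borel_probs X"
    and "wasserstein X 1 \<mu> \<nu> \<le> 0"
  shows "\<mu> = \<nu>"
proof (rule borel_probs_eqI[OF X \<mu> \<nu>])
  fix f :: "'a \<Rightarrow> real" and L assume f: "L-lipschitz_on UNIV f"
  have W: "wasserstein X 1 \<mu> \<nu> = 0" using assms(4) wasserstein_nonneg[of X 1 \<mu> \<nu>] by linarith
  have "L-lipschitz_on X f" by (rule lipschitz_on_subset[OF f]) simp
  moreover from this have "L-lipschitz_on X (\<lambda>x. - f x)" by (simp add: lipschitz_on_def dist_minus)
  ultimately show "(\<integral>x. f x \<partial>\<mu>) = (\<integral>x. f x \<partial>\<nu>)"
    using lipschitz_le_wasserstein1[OF X \<mu> \<nu>, of L f] lipschitz_le_wasserstein1[OF X \<mu> \<nu>, of L "\<lambda>x. - f x"]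
    by (simp add: W)
qed

text \<open>For \<open>z\<close> farther than \<open>lam\<close> from \<open>x\<close> test the infimum at the point of the segment at distance \<open>lam\<close> from \<open>x\<close>, and
go on to \<open>z\<close> with the Lipschitz bound. The Huber cost is the sum of these two contributions.\<close>

lemma c2_transform_add_le_huber:
  fixes X :: "'a::euclidean_space set"
  assumes X: "compact X" "convex X" and \<phi>: "lam-lipschitz_on X \<phi>" and lam: "lam > 0" and xz: "x \<in> X" "z \<in> X"
  shows "c2_transform X \<phi> x + \<phi> z \<le> huber lam x z"
proof (cases "norm (x - z) \<le> lam")
  case True
  then show ?thesis
    using c2_transform_le[OF X(1) lipschitz_on_continuous_on[OF \<phi>] xz] by (simp add: huber_def c2_def)
next
  case False
  define r where "r = norm (x - z)"
  define y where "y = (1 - lam / r) *\<^sub>R x + (lam / r) *\<^sub>R z"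
  have r: "r > lam" "r > 0" using False lam by (auto simp: r_def)
  have y: "y \<in> X" unfolding y_def using r lam by (intro convexD[OF X(2) xz]) auto
  have "x - y = (lam / r) *\<^sub>R (x - z)" "y - z = (1 - lam / r) *\<^sub>R (x - z)"
    by (simp_all add: y_def algebra_simps)
  then have n: "norm (x - y) = lam" "norm (y - z) = r - lam"
    using r lam by (simp_all add: r_def[symmetric] left_diff_distrib)
  have "\<phi> z - \<phi> y \<le> lam * (r - lam)"
    using lipschitz_onD[OF \<phi> y xz(2)] n by (simp add: dist_real_def dist_norm)
  moreover have "c2_transform X \<phi> x \<le> lam\<^sup>2 / 2 - \<phi> y"
    using c2_transform_le[OF X(1) lipschitz_on_continuous_on[OF \<phi>] xz(1) y] n by (simp add: c2_def)
  ultimately show ?thesis using False by (simp add: huber_def r_def[symmetric] power2_eq_square algebra_simps)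
qed

text \<open>Otherwise the point \<open>z\<close> of the segment at distance \<open>lam\<close> from \<open>x\<close> does better: moving from \<open>y\<close> back to \<open>z\<close> saves
\<open>(r\<^sup>2 - lam\<^sup>2) / 2\<close> in the quadratic cost and loses at most \<open>lam * (r - lam)\<close> in \<open>\<phi>\<close>.\<close>

lemma c2_argmin_dist_le:
  fixes X :: "'a::euclidean_space set"
  assumes X: "compact X" "convex X" and \<phi>: "lam-lipschitz_on X \<phi>" and x: "x \<in> X" and y: "y \<in> c2_argmin X \<phi> x"
  shows "norm (x - y) \<le> lam"
proof (rule ccontr)
  assume "\<not> norm (x - y) \<le> lam"
  define r where "r = norm (x - y)"
  have lam: "lam \<ge> 0" using lipschitz_on_nonneg[OF \<phi>] .
  have r: "r > lam" "r > 0" using \<open>\<not> _\<close> lam by (auto simp: r_def)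
  have y': "y \<in> X" "c2 x y - \<phi> y = c2_transform X \<phi> x" using y by (auto simp: c2_argmin_def)
  define s where "s = 1 - lam / r"
  have s: "0 < s" "s \<le> 1" using r lam by (auto simp: s_def)
  define z where "z = (1 - s) *\<^sub>R y + s *\<^sub>R x"
  have z: "z \<in> X" unfolding z_def using s by (intro convexD[OF X(2) y'(1) x]) auto
  have "x - z = (1 - s) *\<^sub>R (x - y)" "y - z = - (s *\<^sub>R (x - y))"
    by (simp_all add: z_def algebra_simps)
  then have n: "norm (x - z) = lam" "norm (y - z) = r - lam"
    using s r lam by (simp_all add: r_def[symmetric] s_def left_diff_distrib)
  have "c2 x y - \<phi> y \<le> c2 x z - \<phi> z"
    using c2_transform_le[OF X(1) lipschitz_on_continuous_on[OF \<phi>] x z] y'(2) by simp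
  moreover have "\<phi> y - \<phi> z \<le> lam * (r - lam)"
    using lipschitz_onD[OF \<phi> y'(1) z] n by (simp add: dist_real_def dist_norm)
  ultimately have "r * r \<le> lam * lam + 2 * (lam * (r - lam))"
    by (simp add: c2_def n r_def[symmetric] power2_eq_square)
  then have "(r - lam) * (r - lam) \<le> 0" by (simp add: algebra_simps)
  then show False using r mult_pos_pos[of "r - lam" "r - lam"] by linarith
qed

section \<open>The regularized problem and the Bregman divergence\<close>

lemma open_Int_sets_restrict_borel:
  assumes "open U"
  shows "U \<inter> S \<in> sets (borel_on S)"
  unfolding sets_restrict_space using assms by (intro image_eqI[of _ _ U]) auto

text \<open>The complement of the support is covered by the null members of a countable basis.\<close>

lemma AE_in_measure_support:
  fixes S :: "'a::second_countable_topology set"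
  assumes \<gamma>: "\<gamma> \<in> borel_probs S"
  shows "AE z in \<gamma>. z \<in> measure_support \<gamma>"
proof -
  obtain \<B> :: "'a set set" where \<B>: "countable \<B>" "topological_basis \<B>" using ex_countable_basis by blast
  define \<N> where "\<N> = {U \<in> \<B>. emeasure \<gamma> (U \<inter> space \<gamma>) = 0}"
  have meas: "U \<inter> space \<gamma> \<in> sets \<gamma>" if "open U" for U
    unfolding borel_probsD(2,3)[OF \<gamma>] by (rule open_Int_sets_restrict_borel[OF that])
  have "(\<Union>U\<in>\<N>. U \<inter> space \<gamma>) \<in> null_sets \<gamma>"
  proof (rule null_sets_UN')
    show "countable \<N>" using \<B>(1) by (rule countable_subset[rotated]) (auto simp: \<N>_def)
    show "U \<inter> space \<gamma> \<in> null_sets \<gamma>" if "U \<in> \<N>" for U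
      using that meas topological_basis_open[OF \<B>(2)] by (auto simp: \<N>_def null_sets_def)
  qed
  then show ?thesis
  proof (rule AE_I')
    show "{z \<in> space \<gamma>. z \<notin> measure_support \<gamma>} \<subseteq> (\<Union>U\<in>\<N>. U \<inter> space \<gamma>)"
    proof
      fix z assume "z \<in> {z \<in> space \<gamma>. z \<notin> measure_support \<gamma>}"
      then obtain U where z: "z \<in> space \<gamma>" and U: "open U" "z \<in> U" "emeasure \<gamma> (U \<inter> space \<gamma>) = 0"
        by (auto simp: measure_support_def)
      obtain V where V: "V \<in> \<B>" "z \<in> V" "V \<subseteq> U" using topological_basisE[OF \<B>(2) U(1,2)] by blast
      have "emeasure \<gamma> (V \<inter> space \<gamma>) \<le> emeasure \<gamma> (U \<inter> space \<gamma>)"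
        using V(3) by (intro emeasure_mono meas U(1)) auto
      then show "z \<in> (\<Union>U\<in>\<N>. U \<inter> space \<gamma>)" using U(3) V z by (auto simp: \<N>_def)
    qed
  qed
qed

text \<open>The sum of the two weak duality inequalities, with the equality case.\<close>

lemma regularized_cost_ge:
  fixes X :: "'a::euclidean_space set"
  assumes X: "compact X" and \<phi>: "lam-lipschitz_on X \<phi>" and \<mu>: "\<mu> \<in> borel_probs X"
    and ac: "absolutely_continuous (restrict_space lborel X) \<mu>" and \<nu>: "\<nu> \<in> borel_probs X"
    and \<rho>: "\<rho> \<in> borel_probs X"
  shows "dual_value X \<mu> \<nu> \<phi> \<le> transport_cost X c2 \<mu> \<rho> + lam * wasserstein X 1 \<rho> \<nu>"
    and "transport_cost X c2 \<mu> \<rho> + lam * wasserstein X 1 \<rho> \<nu> \<le> dual_value X \<mu> \<nu> \<phi> \<Longrightarrow>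
      \<rho> = argmin_target X \<mu> \<phi>"
proof -
  note \<phi>c = lipschitz_on_continuous_on[OF \<phi>]
  have 1: "dual_value X \<mu> \<rho> \<phi> \<le> transport_cost X c2 \<mu> \<rho>" by (rule dual_value_le[OF X \<phi>c \<mu> \<rho>])
  have 2: "(\<integral>x. \<phi> x \<partial>\<nu>) - (\<integral>x. \<phi> x \<partial>\<rho>) \<le> lam * wasserstein X 1 \<rho> \<nu>"
    by (rule lipschitz_le_wasserstein1[OF X \<rho> \<nu> \<phi>])
  have 3: "dual_value X \<mu> \<nu> \<phi> = dual_value X \<mu> \<rho> \<phi> + ((\<integral>x. \<phi> x \<partial>\<nu>) - (\<integral>x. \<phi> x \<partial>\<rho>))"
    by (simp add: dual_value_def)
  show "dual_value X \<mu> \<nu> \<phi> \<le> transport_cost X c2 \<mu> \<rho> + lam * wasserstein X 1 \<rho> \<nu>"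
    using 1 2 3 by linarith
  assume "transport_cost X c2 \<mu> \<rho> + lam * wasserstein X 1 \<rho> \<nu> \<le> dual_value X \<mu> \<nu> \<phi>"
  then have "dual_value X \<mu> \<rho> \<phi> = transport_cost X c2 \<mu> \<rho>" using 1 2 3 by linarith
  then show "\<rho> = argmin_target X \<mu> \<phi>"
    by (rule potential_determines_target[OF X \<phi>c \<mu> ac \<rho>])
qed

text \<open>The first order condition makes \<open>\<phi>\<close> optimal in the Kantorovich-Rubinstein formula for \<open>(\<rho>, \<nu>)\<close>, so both inequalities
behind the lower bound are equalities at \<open>\<rho>\<close>.\<close>

lemma maximal_potential_solves:
  fixes X :: "'a::euclidean_space set"
  assumes X: "compact X" and lam: "lam > 0" and \<phi>: "lam-lipschitz_on X \<phi>" and \<mu>: "\<mu> \<in> borel_probs X"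
    and ac: "absolutely_continuous (restrict_space lborel X) \<mu>" and \<nu>: "\<nu> \<in> borel_probs X"
    and max: "\<And>\<phi>'. lam-lipschitz_on X \<phi>' \<Longrightarrow> dual_value X \<mu> \<nu> \<phi>' \<le> dual_value X \<mu> \<nu> \<phi>"
  defines "\<rho> \<equiv> argmin_target X \<mu> \<phi>"
  shows "(\<integral>x. \<phi> x \<partial>\<nu>) - (\<integral>x. \<phi> x \<partial>\<rho>) = lam * wasserstein X 1 \<rho> \<nu>"
    and "transport_cost X c2 \<mu> \<rho> + lam * wasserstein X 1 \<rho> \<nu> = dual_value X \<mu> \<nu> \<phi>"
proof -
  note \<phi>c = lipschitz_on_continuous_on[OF \<phi>]
  note \<rho> = potential_of_argmin_map[OF X \<phi>c \<mu> ac, folded \<rho>_def]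
  show *: "(\<integral>x. \<phi> x \<partial>\<nu>) - (\<integral>x. \<phi> x \<partial>\<rho>) = lam * wasserstein X 1 \<rho> \<nu>"
  proof (rule antisym)
    show "(\<integral>x. \<phi> x \<partial>\<nu>) - (\<integral>x. \<phi> x \<partial>\<rho>) \<le> lam * wasserstein X 1 \<rho> \<nu>"
      by (rule lipschitz_le_wasserstein1[OF X \<rho>(1) \<nu> \<phi>])
    show "lam * wasserstein X 1 \<rho> \<nu> \<le> (\<integral>x. \<phi> x \<partial>\<nu>) - (\<integral>x. \<phi> x \<partial>\<rho>)"
      by (rule kantorovich_rubinstein_le[OF X \<rho>(1) \<nu> lam])
        (rule maximal_dual_value_first_order[OF X \<phi> \<mu> ac \<nu> max, folded \<rho>_def])
  qed
  show "transport_cost X c2 \<mu> \<rho> + lam * wasserstein X 1 \<rho> \<nu> = dual_value X \<mu> \<nu> \<phi>"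
    using \<rho>(2) * by (simp add: dual_value_def)
qed

text \<open>An optimal map and a potential have the same value, so the nonnegative defect \<open>c2 x (T x) - \<phi>\<^sup>c x - \<phi> (T x)\<close> vanishes
almost everywhere, and \<open>T x\<close> is a minimizer.\<close>

lemma optimal_map_AE_eq_argmin:
  fixes X :: "'a::euclidean_space set"
  assumes X: "compact X" and \<phi>: "continuous_on X \<phi>" and \<mu>: "\<mu> \<in> borel_probs X"
    and ac: "absolutely_continuous (restrict_space lborel X) \<mu>" and \<rho>: "\<rho> \<in> borel_probs X"
    and opt: "dual_value X \<mu> \<rho> \<phi> = transport_cost X c2 \<mu> \<rho>" and T: "optimal_map X \<mu> \<rho> T"
  shows "AE x in \<mu>. T x = c2_argmin_map X \<phi> x"
proof -
  have Tm: "T \<in> measurable \<mu> (borel_on X)" and T\<rho>: "\<rho> = distr \<mu> (borel_on X) T"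
    and Tc: "(\<integral>x. c2 x (T x) \<partial>\<mu>) = transport_cost X c2 \<mu> \<rho>"
    using T unfolding optimal_map_def half_wasserstein2_sq[OF X \<mu> \<rho>] by simp_all
  have \<phi>m: "\<phi> \<in> borel_measurable (borel_on X)"
    by (rule borel_measurable_continuous_on_restrict[OF \<phi>])
  have i1: "integrable \<mu> (\<lambda>x. c2 x (T x))" by (rule transport_cost_map_le(2)[OF X continuous_on_c2 \<mu> Tm])
  have i2: "integrable \<mu> (c2_transform X \<phi>)"
    by (rule continuous_on_integrable_borel_probs[OF \<mu> X continuous_on_c2_transform[OF X \<phi>]])
  have i3: "integrable \<mu> (\<lambda>x. \<phi> (T x))"
    using continuous_on_integrable_borel_probs[OF \<rho> X \<phi>] integrable_distr_eq[OF Tm \<phi>m] by (simp add: T\<rho>)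
  define h where "h = (\<lambda>x. c2 x (T x) - c2_transform X \<phi> x - \<phi> (T x))"
  have TX: "T x \<in> X" if "x \<in> X" for x
    using measurable_space[OF Tm, of x] that borel_probsD(3)[OF \<mu>] by (simp add: space_restrict_space)
  have "0 \<le> h x" if "x \<in> X" for x
    using c2_transform_le[OF X \<phi> that TX[OF that]] by (simp add: h_def)
  then have "AE x in \<mu>. 0 \<le> h x" using borel_probsD(3)[OF \<mu>] by (intro AE_I2) auto
  moreover have "integrable \<mu> h" unfolding h_def by (intro Bochner_Integration.integrable_diff i1 i2 i3)
  moreover have "(\<integral>x. h x \<partial>\<mu>) = 0"
    using i1 i2 i3 Tc opt integral_distr[OF Tm \<phi>m] by (simp add: h_def dual_value_def T\<rho>)
  ultimately have "AE x in \<mu>. h x = 0" using integral_nonneg_eq_0_iff_AE by blast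
  then show ?thesis
    using AE_c2_argmin_singleton[OF X \<phi> \<mu> ac] AE_space
  proof eventually_elim
    fix x assume x: "h x = 0" "c2_argmin X \<phi> x = {c2_argmin_map X \<phi> x}" "x \<in> space \<mu>"
    from x(1,3) have "T x \<in> c2_argmin X \<phi> x"
      using TX borel_probsD(3)[OF \<mu>] by (simp add: c2_argmin_def h_def)
    then show "T x = c2_argmin_map X \<phi> x" unfolding x(2) by simp
  qed
qed

lemma lipschitz_argmin_map_dist_le:
  fixes X :: "'a::euclidean_space set"
  assumes X: "compact X" "convex X" and \<phi>: "lam-lipschitz_on X \<phi>" and \<mu>: "\<mu> \<in> borel_probs X"
    and ac: "absolutely_continuous (restrict_space lborel X) \<mu>"
  shows "AE x in \<mu>. norm (x - c2_argmin_map X \<phi> x) \<le> lam"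
  using AE_c2_argmin_singleton[OF X(1) lipschitz_on_continuous_on[OF \<phi>] \<mu> ac] AE_space
proof eventually_elim
  fix x assume x: "c2_argmin X \<phi> x = {c2_argmin_map X \<phi> x}" "x \<in> space \<mu>"
  then have "x \<in> X" using borel_probsD(3)[OF \<mu>] by simp
  then show "norm (x - c2_argmin_map X \<phi> x) \<le> lam"
    using x(1) by (intro c2_argmin_dist_le[OF X \<phi>]) auto
qed

text \<open>The plan carried by the graph of the map moves no point farther than \<open>lam\<close>, so its Huber cost is its quadratic cost.
This is the value of a dual pair that is also admissible for the Huber cost.\<close>

lemma lipschitz_argmin_target_in_B_set:
  fixes X :: "'a::euclidean_space set"
  assumes X: "compact X" "convex X" and lam: "lam > 0" and \<phi>: "lam-lipschitz_on X \<phi>"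
    and \<mu>: "\<mu> \<in> borel_probs X" and ac: "absolutely_continuous (restrict_space lborel X) \<mu>"
  shows "argmin_target X \<mu> \<phi> \<in> B_set X lam \<mu>" (is "?\<rho> \<in> _")
proof -
  let ?T = "c2_argmin_map X \<phi>"
  let ?\<gamma> = "distr \<mu> (borel_on (X \<times> X)) (\<lambda>x. (x, ?T x))"
  note \<phi>c = lipschitz_on_continuous_on[OF \<phi>]
  have T: "?T \<in> measurable \<mu> (borel_on X)"
    using c2_argmin_map_measurable[OF X(1) \<phi>c] by (simp add: measurable_borel_probs[OF \<mu>])
  note \<rho> = potential_of_argmin_map[OF X(1) \<phi>c \<mu> ac] and m = map_coupling[OF \<mu> T]
  note near = lipschitz_argmin_map_dist_le[OF X \<phi> \<mu> ac]
  have hm: "(\<lambda>z. huber lam (fst z) (snd z)) \<in> borel_measurable (borel_on (X \<times> X))"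
    by (rule borel_measurable_continuous_on_restrict[OF continuous_on_huber])
  have "(\<integral>z. huber lam (fst z) (snd z) \<partial>?\<gamma>) = (\<integral>x. huber lam x (?T x) \<partial>\<mu>)"
    by (simp add: integral_distr[OF m(2) hm])
  also have "\<dots> = (\<integral>x. c2 x (?T x) \<partial>\<mu>)"
  proof (rule integral_cong_AE)
    show "(\<lambda>x. huber lam x (?T x)) \<in> borel_measurable \<mu>" "(\<lambda>x. c2 x (?T x)) \<in> borel_measurable \<mu>"
      using transport_cost_map_le(2)[OF X(1) continuous_on_huber \<mu> T, of lam]
        transport_cost_map_le(2)[OF X(1) continuous_on_c2 \<mu> T]
      by (simp_all add: borel_measurable_integrable)
    show "AE x in \<mu>. huber lam x (?T x) = c2 x (?T x)"
      using near by eventually_elim (simp add: huber_def c2_def)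
  qed
  also have "\<dots> = dual_value X \<mu> ?\<rho> \<phi>" using \<rho> by simp
  also have "\<dots> \<le> transport_cost X (huber lam) \<mu> ?\<rho>"
    unfolding dual_value_def
    by (intro dual_le_transport_cost[OF X(1) continuous_on_huber \<mu> \<rho>(1)] c2_transform_add_le_huber[OF X \<phi> lam]
        continuous_on_integrable_borel_probs[OF \<mu> X(1)] continuous_on_integrable_borel_probs[OF \<rho>(1) X(1)]
        continuous_on_c2_transform[OF X(1)] \<phi>c)
  finally have "(\<integral>z. huber lam (fst z) (snd z) \<partial>?\<gamma>) \<le> transport_cost X (huber lam) \<mu> ?\<rho>" .
  moreover have "transport_cost X (huber lam) \<mu> ?\<rho> \<le> (\<integral>z. huber lam (fst z) (snd z) \<partial>?\<gamma>)"
    by (rule transport_cost_le[OF X(1) continuous_on_huber m(1)])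
  moreover have "measure_support ?\<gamma> \<subseteq> {(x, y). norm (x - y) \<le> lam}"
  proof
    fix z assume z: "z \<in> measure_support ?\<gamma>"
    define U where "U = {z :: 'a \<times> 'a. lam < norm (fst z - snd z)}"
    have U: "open U" unfolding U_def by (intro open_Collect_less continuous_intros)
    have Us: "U \<inter> X \<times> X \<in> sets (borel_on (X \<times> X))"
      by (rule open_Int_sets_restrict_borel[OF U])
    then have "emeasure ?\<gamma> (U \<inter> X \<times> X) = emeasure \<mu> ((\<lambda>x. (x, ?T x)) -` (U \<inter> X \<times> X) \<inter> space \<mu>)"
      by (rule emeasure_distr[OF m(2)])
    also have "\<dots> = 0"
    proof -
      have "AE x in \<mu>. x \<notin> (\<lambda>x. (x, ?T x)) -` (U \<inter> X \<times> X) \<inter> space \<mu>"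
        using near by eventually_elim (simp add: U_def)
      then show ?thesis using AE_iff_null_sets[OF measurable_sets[OF m(2) Us]] by blast
    qed
    finally have "z \<notin> U"
      using z U by (auto simp: measure_support_def space_restrict_space)
    then show "z \<in> {(x, y). norm (x - y) \<le> lam}" by (auto simp: U_def)
  qed
  ultimately show ?thesis
    unfolding B_set_def using \<rho>(1) m(1) by (auto intro!: bexI[of _ ?\<gamma>])
qed

lemma B_set_cost_le_huber:
  fixes X :: "'a::euclidean_space set"
  assumes X: "compact X" and \<nu>: "\<nu> \<in> B_set X lam \<mu>"
  shows "transport_cost X c2 \<mu> \<nu> \<le> transport_cost X (huber lam) \<mu> \<nu>"
proof -
  obtain \<gamma> where \<gamma>: "\<gamma> \<in> couplings X \<mu> \<nu>"
    and opt: "(\<integral>z. huber lam (fst z) (snd z) \<partial>\<gamma>) = transport_cost X (huber lam) \<mu> \<nu>"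
    and supp: "measure_support \<gamma> \<subseteq> {(x, y). norm (x - y) \<le> lam}"
    using \<nu> by (auto simp: B_set_def)
  have "(\<integral>z. c2 (fst z) (snd z) \<partial>\<gamma>) = (\<integral>z. huber lam (fst z) (snd z) \<partial>\<gamma>)"
  proof (rule integral_cong_AE)
    show "AE z in \<gamma>. c2 (fst z) (snd z) = huber lam (fst z) (snd z)"
      using AE_in_measure_support[OF couplingsD(1)[OF \<gamma>]]
    proof eventually_elim
      fix z assume "z \<in> measure_support \<gamma>"
      then have "norm (fst z - snd z) \<le> lam" using supp by auto
      then show "c2 (fst z) (snd z) = huber lam (fst z) (snd z)" by (simp add: huber_def c2_def)
    qed
  qed (intro continuous_on_measurable_borel_probs[OF couplingsD(1)[OF \<gamma>]] continuous_on_c2 continuous_on_huber)+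
  then show ?thesis using transport_cost_le[OF X continuous_on_c2 \<gamma>] opt by simp
qed

lemma transport_cost_c2_sym:
  fixes X :: "'a::euclidean_space set"
  assumes "compact X" "\<mu> \<in> borel_probs X" "\<rho> \<in> borel_probs X"
  shows "transport_cost X c2 \<mu> \<rho> = transport_cost X c2 \<rho> \<mu>"
  using assms
  by (intro antisym transport_cost_sym_le[OF _ continuous_on_c2]) (simp_all add: c2_def norm_minus_commute)

text \<open>The representing measure is unique, so the infimum in the definition runs over one element.\<close>

lemma half_W2_sq_representing:
  fixes X :: "'a::euclidean_space set"
  assumes X: "compact X" and \<mu>: "\<mu> \<in> borel_probs X" and \<rho>: "\<rho> \<in> borel_probs X"
    and L: "\<And>f. continuous_on X f \<Longrightarrow> L f = as_functional \<rho> f"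
  shows "half_W2_sq X \<mu> L = ereal (transport_cost X c2 \<mu> \<rho>)"
proof -
  have "\<rho>' = \<rho>" if \<rho>': "\<rho>' \<in> borel_probs X" "\<And>f. continuous_on X f \<Longrightarrow> L f = as_functional \<rho>' f" for \<rho>'
  proof (rule borel_probs_eqI[OF X \<rho>'(1) \<rho>])
    fix f :: "'a \<Rightarrow> real" and C assume "C-lipschitz_on UNIV f"
    then have "continuous_on X f" using lipschitz_on_continuous_on continuous_on_subset by blast
    from L[OF this] \<rho>'(2)[OF this] show "(\<integral>x. f x \<partial>\<rho>') = (\<integral>x. f x \<partial>\<rho>)" by (simp add: as_functional_def)
  qed
  then have "{\<rho>' \<in> borel_probs X. \<forall>f. continuous_on X f \<longrightarrow> L f = as_functional \<rho>' f} = {\<rho>}"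
    using \<rho> L by blast
  moreover have "transport_cost X c2 \<rho> \<mu> = transport_cost X c2 \<mu> \<rho>"
    by (rule transport_cost_c2_sym[OF X \<rho> \<mu>])
  ultimately show ?thesis by (simp only: half_W2_sq_def half_wasserstein2_sq[OF X \<rho> \<mu>] image_insert image_empty cInf_singleton)
qed

lemma as_functional_signed_measure:
  fixes X :: "'a::euclidean_space set"
  assumes X: "compact X" and \<rho>: "\<rho> \<in> borel_probs X"
  shows "as_functional \<rho> \<in> signed_measures X"
proof -
  interpret prob_space \<rho> using borel_probsD[OF \<rho>] by simp
  note i = continuous_on_integrable_borel_probs[OF \<rho> X]
  have "\<bar>as_functional \<rho> f\<bar> \<le> 1 * (SUP x\<in>X. \<bar>f x\<bar>)" if f: "continuous_on X f" for f
  proof -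
    have af: "continuous_on X (\<lambda>x. \<bar>f x\<bar>)" by (intro continuous_intros f)
    have bdd: "bdd_above ((\<lambda>x. \<bar>f x\<bar>) ` X)"
      by (rule bounded_imp_bdd_above[OF bounded_continuous_image[OF X af]])
    have "\<bar>as_functional \<rho> f\<bar> \<le> (\<integral>x. \<bar>f x\<bar> \<partial>\<rho>)" unfolding as_functional_def by (rule integral_abs_bound)
    also have "\<dots> \<le> (\<integral>x. (SUP x\<in>X. \<bar>f x\<bar>) \<partial>\<rho>)"
      using borel_probsD(3)[OF \<rho>] by (intro integral_mono i[OF af] cSUP_upper bdd) auto
    finally show ?thesis by (simp add: prob_space)
  qed
  then show ?thesis
    unfolding signed_measures_def using i by (auto simp: as_functional_def intro!: exI[of _ 1])
qed

text \<open>A Kantorovich potential is a subgradient by weak duality. For the converse test the subgradient inequality at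
the image of \<open>\<mu>\<close> under the map of minimizers of \<open>\<phi>\<close>, the measure where \<open>W\<^sub>2\<^sup>2(\<mu>, \<cdot>)/2 - \<integral> \<phi> d\<cdot>\<close> takes its least
value \<open>\<integral> \<phi>\<^sup>c d\<mu>\<close>.\<close>

lemma subdifferential_half_W2_sq_iff:
  fixes X :: "'a::euclidean_space set"
  assumes X: "compact X" and \<mu>: "\<mu> \<in> borel_probs X"
    and ac: "absolutely_continuous (restrict_space lborel X) \<mu>" and \<rho>: "\<rho> \<in> borel_probs X"
  shows "\<phi> \<in> subdifferential X (half_W2_sq X \<mu>) (as_functional \<rho>) \<longleftrightarrow>
    continuous_on X \<phi> \<and> dual_value X \<mu> \<rho> \<phi> = transport_cost X c2 \<mu> \<rho>" (is "?sub \<longleftrightarrow> ?pot")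
proof
  note W = half_W2_sq_representing[OF X \<mu>]
  assume sub: ?sub
  then have \<phi>: "continuous_on X \<phi>" by (simp add: subdifferential_def)
  define \<kappa> where "\<kappa> = argmin_target X \<mu> \<phi>"
  note \<kappa> = potential_of_argmin_map[OF X \<phi> \<mu> ac, folded \<kappa>_def]
  have "half_W2_sq X \<mu> (as_functional \<kappa>) \<ge>
      half_W2_sq X \<mu> (as_functional \<rho>) + ereal (as_functional \<kappa> \<phi> - as_functional \<rho> \<phi>)"
    using sub as_functional_signed_measure[OF X \<kappa>(1)] by (simp add: subdifferential_def)
  then have "transport_cost X c2 \<mu> \<rho> + ((\<integral>x. \<phi> x \<partial>\<kappa>) - (\<integral>x. \<phi> x \<partial>\<rho>)) \<le> transport_cost X c2 \<mu> \<kappa>"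
    by (simp add: W[OF \<kappa>(1)] W[OF \<rho>] as_functional_def)
  then have "transport_cost X c2 \<mu> \<rho> \<le> dual_value X \<mu> \<rho> \<phi>"
    using \<kappa>(2) by (simp add: dual_value_def)
  then show ?pot using dual_value_le[OF X \<phi> \<mu> \<rho>] \<phi> by simp
next
  note W = half_W2_sq_representing[OF X \<mu>]
  assume pot: ?pot
  then have \<phi>: "continuous_on X \<phi>" by simp
  have "half_W2_sq X \<mu> L \<ge> half_W2_sq X \<mu> (as_functional \<rho>) + ereal (L \<phi> - as_functional \<rho> \<phi>)"
    if "L \<in> signed_measures X" for L
  proof (cases "\<exists>\<kappa>\<in>borel_probs X. \<forall>f. continuous_on X f \<longrightarrow> L f = as_functional \<kappa> f")
    case True
    then obtain \<kappa> where \<kappa>: "\<kappa> \<in> borel_probs X" "\<And>f. continuous_on X f \<Longrightarrow> L f = as_functional \<kappa> f" by blast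
    have "dual_value X \<mu> \<kappa> \<phi> \<le> transport_cost X c2 \<mu> \<kappa>" by (rule dual_value_le[OF X \<phi> \<mu> \<kappa>(1)])
    then show ?thesis
      using pot by (simp add: W[OF \<kappa>] W[OF \<rho>] \<kappa>(2)[OF \<phi>] as_functional_def dual_value_def)
  next
    case False
    then have "{\<kappa> \<in> borel_probs X. \<forall>f. continuous_on X f \<longrightarrow> L f = as_functional \<kappa> f} = {}" by blast
    then have "half_W2_sq X \<mu> L = \<infinity>" by (simp only: half_W2_sq_def) (simp add: top_ereal_def)
    then show ?thesis by simp
  qed
  then show ?sub using \<phi> by (simp add: subdifferential_def)
qed

text \<open>Every maximizer produces a minimizer of the regularized problem, and this one is unique.\<close>

lemma maximal_potential_argmin_map_target_unique:
  fixes X :: "'a::euclidean_space set"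
  assumes X: "compact X" and lam: "lam > 0" and \<mu>: "\<mu> \<in> borel_probs X"
    and ac: "absolutely_continuous (restrict_space lborel X) \<mu>" and \<nu>: "\<nu> \<in> borel_probs X"
    and \<phi>: "lam-lipschitz_on X \<phi>"
    and max: "\<And>\<phi>'. lam-lipschitz_on X \<phi>' \<Longrightarrow> dual_value X \<mu> \<nu> \<phi>' \<le> dual_value X \<mu> \<nu> \<phi>"
    and g: "lam-lipschitz_on X g" "dual_value X \<mu> \<nu> \<phi> \<le> dual_value X \<mu> \<nu> g"
  shows "argmin_target X \<mu> g = argmin_target X \<mu> \<phi>"
proof (rule regularized_cost_ge(2)[OF X \<phi> \<mu> ac \<nu> potential_of_argmin_map(1)[OF X lipschitz_on_continuous_on[OF g(1)] \<mu> ac]])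
  have max': "dual_value X \<mu> \<nu> \<phi>' \<le> dual_value X \<mu> \<nu> g" if "lam-lipschitz_on X \<phi>'" for \<phi>'
    using max[OF that] g(2) by simp
  have "dual_value X \<mu> \<nu> g \<le> dual_value X \<mu> \<nu> \<phi>" by (rule max[OF g(1)])
  then show "transport_cost X c2 \<mu> (argmin_target X \<mu> g) +
      lam * wasserstein X 1 (argmin_target X \<mu> g) \<nu> \<le> dual_value X \<mu> \<nu> \<phi>"
    using maximal_potential_solves(2)[OF X lam g(1) \<mu> ac \<nu> max'] by linarith
qed

lemma D_fun_eq:
  fixes X :: "'a::euclidean_space set"
  assumes X: "compact X" and \<mu>: "\<mu> \<in> borel_probs X"
    and ac: "absolutely_continuous (restrict_space lborel X) \<mu>" and \<nu>: "\<nu> \<in> borel_probs X"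
    and \<rho>: "\<rho> \<in> borel_probs X"
  shows "D_fun X lam \<mu> \<nu> \<rho> = ereal (transport_cost X c2 \<mu> \<nu> - transport_cost X c2 \<mu> \<rho>) -
    (SUP \<phi>\<in>{\<phi>. lam-lipschitz_on X \<phi> \<and> dual_value X \<mu> \<rho> \<phi> = transport_cost X c2 \<mu> \<rho>}.
       ereal (dual_value X \<mu> \<nu> \<phi> - transport_cost X c2 \<mu> \<rho>))"
proof -

  have set: "subdifferential X (half_W2_sq X \<mu>) (as_functional \<rho>) \<inter> {\<phi>. lam-lipschitz_on X \<phi>} =
      {\<phi>. lam-lipschitz_on X \<phi> \<and> dual_value X \<mu> \<rho> \<phi> = transport_cost X c2 \<mu> \<rho>}"
    using subdifferential_half_W2_sq_iff[OF X \<mu> ac \<rho>] lipschitz_on_continuous_on by blast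
  have val: "(\<integral>x. \<phi> x \<partial>\<nu>) - (\<integral>x. \<phi> x \<partial>\<rho>) = dual_value X \<mu> \<nu> \<phi> - dual_value X \<mu> \<rho> \<phi>" for \<phi>
    by (simp add: dual_value_def)
  show ?thesis
    unfolding D_fun_def half_wasserstein2_sq[OF X \<nu> \<mu>] half_wasserstein2_sq[OF X \<rho> \<mu>]      transport_cost_c2_sym[OF X \<nu> \<mu>] transport_cost_c2_sym[OF X \<rho> \<mu>] set val
    by (intro arg_cong2[where f = "(-)"] refl SUP_cong) simp
qed

text \<open>For a potential of \<open>\<rho>\<close> the value in the supremum is \<open>J\<close> minus the cost of \<open>\<rho>\<close>, so \<open>D\<close> equals the cost of \<open>\<nu>\<close> minus
the supremum of \<open>J\<close> over the Lipschitz potentials of \<open>\<rho>\<close>. If this supremum reaches the maximum of \<open>J\<close>, a limit of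
potentials is both a potential of \<open>\<rho>\<close> and a maximizer.\<close>

lemma D_fun_minimal:
  fixes X :: "'a::euclidean_space set"
  assumes X: "compact X" and lam: "lam > 0" and \<mu>: "\<mu> \<in> borel_probs X"
    and ac: "absolutely_continuous (restrict_space lborel X) \<mu>" and \<nu>: "\<nu> \<in> borel_probs X"
    and \<phi>: "lam-lipschitz_on X \<phi>"
    and max: "\<And>\<phi>'. lam-lipschitz_on X \<phi>' \<Longrightarrow> dual_value X \<mu> \<nu> \<phi>' \<le> dual_value X \<mu> \<nu> \<phi>"
    and \<rho>: "\<rho> \<in> borel_probs X"
  defines "\<rho>\<^sub>l \<equiv> argmin_target X \<mu> \<phi>"
  shows "D_fun X lam \<mu> \<nu> \<rho>\<^sub>l \<le> D_fun X lam \<mu> \<nu> \<rho>"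
    and "D_fun X lam \<mu> \<nu> \<rho> \<le> D_fun X lam \<mu> \<nu> \<rho>\<^sub>l \<Longrightarrow> \<rho> = \<rho>\<^sub>l"
proof -
  note \<rho>l = potential_of_argmin_map[OF X lipschitz_on_continuous_on[OF \<phi>] \<mu> ac, folded \<rho>\<^sub>l_def]
  define M where "M = dual_value X \<mu> \<nu> \<phi>"
  define a where "a = transport_cost X c2 \<mu> \<nu>"
  define w where "w = transport_cost X c2 \<mu>"
  define P where "P = (\<lambda>\<kappa>. {\<phi>. lam-lipschitz_on X \<phi> \<and> dual_value X \<mu> \<kappa> \<phi> = w \<kappa>})"
  define S where "S = (\<lambda>\<kappa>. SUP \<phi>\<in>P \<kappa>. ereal (dual_value X \<mu> \<nu> \<phi> - w \<kappa>))"
  have D: "D_fun X lam \<mu> \<nu> \<kappa> = ereal (a - w \<kappa>) - S \<kappa>" if "\<kappa> \<in> borel_probs X" for \<kappa>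
    using D_fun_eq[OF X \<mu> ac \<nu> that] by (simp add: a_def w_def P_def S_def)
  have S_le: "S \<kappa> \<le> ereal (M - w \<kappa>)" for \<kappa>
    unfolding S_def by (intro SUP_least) (auto simp: P_def M_def max)
  have "ereal (M - w \<rho>\<^sub>l) \<le> S \<rho>\<^sub>l"
    unfolding S_def using \<phi> \<rho>l(2) by (intro SUP_upper2[of \<phi>]) (auto simp: P_def M_def w_def)
  then have "S \<rho>\<^sub>l = ereal (M - w \<rho>\<^sub>l)" using S_le by (intro antisym)
  then have Dl: "D_fun X lam \<mu> \<nu> \<rho>\<^sub>l = ereal (a - M)" by (simp add: D[OF \<rho>l(1)])
  have "ereal (a - M) = ereal (a - w \<rho>) - ereal (M - w \<rho>)" by simp
  also have "\<dots> \<le> D_fun X lam \<mu> \<nu> \<rho>" unfolding D[OF \<rho>] by (intro ereal_minus_mono S_le order_refl)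
  finally show "D_fun X lam \<mu> \<nu> \<rho>\<^sub>l \<le> D_fun X lam \<mu> \<nu> \<rho>" by (simp add: Dl)
  assume "D_fun X lam \<mu> \<nu> \<rho> \<le> D_fun X lam \<mu> \<nu> \<rho>\<^sub>l"
  then have "ereal (a - w \<rho>) - S \<rho> \<le> ereal (a - M)" by (simp only: Dl D[OF \<rho>])
  \<comment> \<open>The case \<open>S \<rho> = -\<infinity>\<close>, no Lipschitz potential, is excluded because it makes the divergence infinite.\<close>
  then have S_ge: "ereal (M - w \<rho>) \<le> S \<rho>" by (cases "S \<rho>") auto
  have "\<exists>f. f \<in> P \<rho> \<and> M - 1 / real (Suc n) < dual_value X \<mu> \<nu> f" for n
  proof -
    have "ereal (M - w \<rho> - 1 / real (Suc n)) < S \<rho>"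
      by (rule less_le_trans[OF _ S_ge]) simp
    then obtain f where "f \<in> P \<rho>" "ereal (M - w \<rho> - 1 / real (Suc n)) < ereal (dual_value X \<mu> \<nu> f - w \<rho>)"
      unfolding S_def less_SUP_iff by blast
    then show ?thesis by (intro exI[of _ f]) (simp add: algebra_simps)
  qed
  then obtain f where f: "\<And>n. f n \<in> P \<rho>" "\<And>n. M - 1 / real (Suc n) < dual_value X \<mu> \<nu> (f n)" by metis
  have fL: "lam-lipschitz_on X (f n)" for n using f(1)[of n] by (simp add: P_def)
  obtain g k where g: "lam-lipschitz_on X g" "strict_mono k"
    "\<And>\<rho>. \<rho> \<in> borel_probs X \<Longrightarrow> (\<lambda>n. dual_value X \<mu> \<rho> (f (k n))) \<longlonglongrightarrow> dual_value X \<mu> \<rho> g"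
    by (rule lipschitz_dual_value_compact[OF X \<mu> fL]) (rule that; assumption)
  have "(\<lambda>n. M - 1 / real (Suc n)) \<longlonglongrightarrow> M - 0"
    by (intro tendsto_intros LIMSEQ_Suc lim_1_over_n)
  then have "(\<lambda>n. M - 1 / real (Suc (k n))) \<longlonglongrightarrow> M"
    using LIMSEQ_subseq_LIMSEQ[OF _ g(2)] by (simp only: comp_def diff_zero)
  then have Mg: "M \<le> dual_value X \<mu> \<nu> g"
    by (rule LIMSEQ_le[OF _ g(3)[OF \<nu>]]) (use f(2) in \<open>auto intro: less_imp_le\<close>)
  have "(\<lambda>n. dual_value X \<mu> \<rho> (f (k n))) \<longlonglongrightarrow> w \<rho>" using f(1) by (simp add: P_def)
  then have "dual_value X \<mu> \<rho> g = transport_cost X c2 \<mu> \<rho>"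
    using LIMSEQ_unique[OF g(3)[OF \<rho>]] by (simp add: w_def)
  then have "\<rho> = argmin_target X \<mu> g"
    by (rule potential_determines_target[OF X lipschitz_on_continuous_on[OF g(1)] \<mu> ac \<rho>])
  also have "\<dots> = \<rho>\<^sub>l"
    unfolding \<rho>\<^sub>l_def by (rule maximal_potential_argmin_map_target_unique[OF X lam \<mu> ac \<nu> \<phi> max g(1) Mg[unfolded M_def]])
  finally show "\<rho> = \<rho>\<^sub>l" .
qed

theorem theorem1p3:
  fixes \<Omega> :: "(real ^ 'n) set" and \<mu> \<nu> :: "(real ^ 'n) measure" and lam :: real
  assumes "compact \<Omega>" and "convex \<Omega>" and "\<not> negligible (interior \<Omega>)"
    and "\<mu> \<in> borel_probs \<Omega>" and "\<nu> \<in> borel_probs \<Omega>"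
    and "absolutely_continuous (restrict_space lborel \<Omega>) \<mu>"
    and "lam > 0"
  shows "\<exists>\<rho>\<^sub>l.
    (\<forall>\<rho>. is_arg_min (\<lambda>\<rho>. 1 / 2 * (wasserstein \<Omega> 2 \<mu> \<rho>)\<^sup>2 + lam * wasserstein \<Omega> 1 \<rho> \<nu>)
            (\<lambda>\<rho>. \<rho> \<in> borel_probs \<Omega>) \<rho> \<longleftrightarrow> \<rho> = \<rho>\<^sub>l) \<and>
    (\<forall>\<rho>. is_arg_min (D_fun \<Omega> lam \<mu> \<nu>) (\<lambda>\<rho>. \<rho> \<in> B_set \<Omega> lam \<mu>) \<rho> \<longleftrightarrow> \<rho> = \<rho>\<^sub>l) \<and>
    (\<nu> \<in> B_set \<Omega> lam \<mu> \<longrightarrow> \<rho>\<^sub>l = \<nu>) \<and>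
    (\<nu> \<notin> B_set \<Omega> lam \<mu> \<longrightarrow>
       (\<exists>\<phi>. kantorovich_potential \<Omega> \<mu> \<rho>\<^sub>l \<phi> \<and> lip_const \<Omega> \<phi> = ereal lam \<and>
            (\<integral>x. \<phi> x \<partial>\<nu>) - (\<integral>x. \<phi> x \<partial>\<rho>\<^sub>l) = lam * wasserstein \<Omega> 1 \<rho>\<^sub>l \<nu>)) \<and>
    (\<exists>T. optimal_map \<Omega> \<mu> \<rho>\<^sub>l T \<and>
         (\<forall>T'. optimal_map \<Omega> \<mu> \<rho>\<^sub>l T' \<longrightarrow> (AE x in \<mu>. T' x = T x)) \<and>
         esssup \<mu> (\<lambda>x. ereal (norm (x - T x))) \<le> ereal lam)"
proof -
  note \<Omega> = assms(1,2) and \<mu> = assms(4) and \<nu> = assms(5) and ac = assms(6) and lam = assms(7)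
  obtain \<phi> where \<phi>: "lam-lipschitz_on \<Omega> \<phi>"
    and max: "\<And>\<phi>'. lam-lipschitz_on \<Omega> \<phi>' \<Longrightarrow> dual_value \<Omega> \<mu> \<nu> \<phi>' \<le> dual_value \<Omega> \<mu> \<nu> \<phi>"
    using lipschitz_dual_value_attains_max[OF \<Omega>(1) \<mu> \<nu> less_imp_le[OF lam]] by metis
  note \<phi>c = lipschitz_on_continuous_on[OF \<phi>]
  define T where "T = c2_argmin_map \<Omega> \<phi>"
  define \<rho>\<^sub>l where "\<rho>\<^sub>l = distr \<mu> (restrict_space borel \<Omega>) T"
  have \<rho>l: "\<rho>\<^sub>l \<in> borel_probs \<Omega>" "dual_value \<Omega> \<mu> \<rho>\<^sub>l \<phi> = transport_cost \<Omega> c2 \<mu> \<rho>\<^sub>l"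
    "(\<integral>x. c2 x (T x) \<partial>\<mu>) = transport_cost \<Omega> c2 \<mu> \<rho>\<^sub>l"
    using potential_of_argmin_map[OF \<Omega>(1) \<phi>c \<mu> ac] by (simp_all add: \<rho>\<^sub>l_def T_def)
  have KR: "(\<integral>x. \<phi> x \<partial>\<nu>) - (\<integral>x. \<phi> x \<partial>\<rho>\<^sub>l) = lam * wasserstein \<Omega> 1 \<rho>\<^sub>l \<nu>"
    and val: "transport_cost \<Omega> c2 \<mu> \<rho>\<^sub>l + lam * wasserstein \<Omega> 1 \<rho>\<^sub>l \<nu> = dual_value \<Omega> \<mu> \<nu> \<phi>"
    using maximal_potential_solves[OF \<Omega>(1) lam \<phi> \<mu> ac \<nu> max] by (simp_all add: \<rho>\<^sub>l_def T_def)
  note ge = regularized_cost_ge[OF \<Omega>(1) \<phi> \<mu> ac \<nu>, folded T_def, folded \<rho>\<^sub>l_def]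
  define F where "F = (\<lambda>\<rho>. 1 / 2 * (wasserstein \<Omega> 2 \<mu> \<rho>)\<^sup>2 + lam * wasserstein \<Omega> 1 \<rho> \<nu>)"
  have F: "F \<rho> = transport_cost \<Omega> c2 \<mu> \<rho> + lam * wasserstein \<Omega> 1 \<rho> \<nu>" if "\<rho> \<in> borel_probs \<Omega>" for \<rho>
    unfolding F_def half_wasserstein2_sq[OF \<Omega>(1) \<mu> that] ..
  have Fmin: "F \<rho>\<^sub>l \<le> F \<rho>" if "\<rho> \<in> borel_probs \<Omega>" for \<rho>
    using ge(1)[OF that] by (simp add: F[OF that] F[OF \<rho>l(1)] val)
  have Funique: "\<rho> = \<rho>\<^sub>l" if "\<rho> \<in> borel_probs \<Omega>" "F \<rho> \<le> F \<rho>\<^sub>l" for \<rho>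
    using ge(2)[OF that(1)] that(2) by (simp add: F[OF that(1)] F[OF \<rho>l(1)] val)
  have argmin_F: "\<forall>\<rho>. is_arg_min F (\<lambda>\<rho>. \<rho> \<in> borel_probs \<Omega>) \<rho> \<longleftrightarrow> \<rho> = \<rho>\<^sub>l"
    unfolding is_arg_min_def using Fmin Funique \<rho>l(1) by (metis leD leI)

  have B: "\<rho>\<^sub>l \<in> B_set \<Omega> lam \<mu>"
    unfolding \<rho>\<^sub>l_def T_def by (rule lipschitz_argmin_target_in_B_set[OF \<Omega> lam \<phi> \<mu> ac])
  have Bp: "\<rho> \<in> borel_probs \<Omega>" if "\<rho> \<in> B_set \<Omega> lam \<mu>" for \<rho> using that by (simp add: B_set_def)
  note D = D_fun_minimal[OF \<Omega>(1) lam \<mu> ac \<nu> \<phi> max, folded T_def, folded \<rho>\<^sub>l_def]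
  have argmin_D: "\<forall>\<rho>. is_arg_min (D_fun \<Omega> lam \<mu> \<nu>) (\<lambda>\<rho>. \<rho> \<in> B_set \<Omega> lam \<mu>) \<rho> \<longleftrightarrow> \<rho> = \<rho>\<^sub>l"
    unfolding is_arg_min_def using D B Bp by (metis leD leI)

  have \<nu>_in: "\<rho>\<^sub>l = \<nu>" if "\<nu> \<in> B_set \<Omega> lam \<mu>"
  proof -
    have "transport_cost \<Omega> c2 \<mu> \<nu> \<le> transport_cost \<Omega> (huber lam) \<mu> \<nu>"
      by (rule B_set_cost_le_huber[OF \<Omega>(1) that])
    also have "\<dots> \<le> dual_value \<Omega> \<mu> \<nu> \<phi>"
      by (rule huber_cost_le_dual_value[OF \<Omega>(1) \<mu> \<nu> less_imp_le[OF lam] max])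
    finally have "transport_cost \<Omega> c2 \<mu> \<nu> \<le> dual_value \<Omega> \<mu> \<nu> \<phi>" .
    moreover have "lam * wasserstein \<Omega> 1 \<nu> \<nu> \<le> 0"
      by (rule kantorovich_rubinstein_le[OF \<Omega>(1) \<nu> \<nu> lam]) simp
    ultimately have "F \<nu> \<le> F \<rho>\<^sub>l" by (simp add: F[OF \<nu>] F[OF \<rho>l(1)] val)
    then show ?thesis using Funique[OF \<nu>] by simp
  qed

  have \<nu>_out: "kantorovich_potential \<Omega> \<mu> \<rho>\<^sub>l \<phi> \<and> lip_const \<Omega> \<phi> = ereal lam" if \<nu>B: "\<nu> \<notin> B_set \<Omega> lam \<mu>"
  proof
    show "kantorovich_potential \<Omega> \<mu> \<rho>\<^sub>l \<phi>"
      using \<rho>l(2) \<phi>c by (simp add: kantorovich_potential_iff[OF \<Omega>(1) \<mu> \<rho>l(1)])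
    have "lam \<le> L" if L: "L-lipschitz_on \<Omega> \<phi>" for L
    proof (rule ccontr)
      assume "\<not> lam \<le> L"
      have "lam * wasserstein \<Omega> 1 \<rho>\<^sub>l \<nu> \<le> L * wasserstein \<Omega> 1 \<rho>\<^sub>l \<nu>"
        using lipschitz_le_wasserstein1[OF \<Omega>(1) \<rho>l(1) \<nu> L] by (simp add: KR)
      then have "wasserstein \<Omega> 1 \<rho>\<^sub>l \<nu> \<le> 0" using \<open>\<not> lam \<le> L\<close> mult_right_le_imp_le[of lam "wasserstein \<Omega> 1 \<rho>\<^sub>l \<nu>" L] by force
      then have "\<rho>\<^sub>l = \<nu>" by (rule wasserstein1_eq_0_imp_eq[OF \<Omega>(1) \<rho>l(1) \<nu>])
      with B \<nu>B show False by simp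
    qed
    then show "lip_const \<Omega> \<phi> = ereal lam"
      unfolding lip_const_def using \<phi> by (intro antisym INF_greatest INF_lower2[of lam]) auto
  qed

  have Tm: "T \<in> measurable \<mu> (restrict_space borel \<Omega>)"
    using c2_argmin_map_measurable[OF \<Omega>(1) \<phi>c] by (simp add: T_def measurable_borel_probs[OF \<mu>])
  have "optimal_map \<Omega> \<mu> \<rho>\<^sub>l T"
    unfolding optimal_map_def half_wasserstein2_sq[OF \<Omega>(1) \<mu> \<rho>l(1)] using Tm \<rho>l(3) by (simp add: \<rho>\<^sub>l_def)
  moreover have "\<forall>T'. optimal_map \<Omega> \<mu> \<rho>\<^sub>l T' \<longrightarrow> (AE x in \<mu>. T' x = T x)"
    unfolding T_def using optimal_map_AE_eq_argmin[OF \<Omega>(1) \<phi>c \<mu> ac \<rho>l(1,2)] by blast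
  moreover have "esssup \<mu> (\<lambda>x. ereal (norm (x - T x))) \<le> ereal lam"
  proof (rule esssup_I)
    have "T \<in> borel_measurable \<mu>" using Tm by (rule measurable_restrict_space2_iff[THEN iffD1, THEN conjunct1])
    moreover have "(\<lambda>x. x) \<in> borel_measurable \<mu>"
      by (intro continuous_on_measurable_borel_probs[OF \<mu>] continuous_intros)
    ultimately show "(\<lambda>x. ereal (norm (x - T x))) \<in> borel_measurable \<mu>" by measurable
    show "AE x in \<mu>. ereal (norm (x - T x)) \<le> ereal lam"
      using lipschitz_argmin_map_dist_le[OF \<Omega> \<phi> \<mu> ac] by (simp add: T_def)
  qed
  ultimately have maps: "\<exists>T. optimal_map \<Omega> \<mu> \<rho>\<^sub>l T \<and>
      (\<forall>T'. optimal_map \<Omega> \<mu> \<rho>\<^sub>l T' \<longrightarrow> (AE x in \<mu>. T' x = T x)) \<and>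
      esssup \<mu> (\<lambda>x. ereal (norm (x - T x))) \<le> ereal lam"
    by blast
  show ?thesis
  proof (intro exI[of _ \<rho>\<^sub>l] conjI impI)
    show "\<exists>\<phi>. kantorovich_potential \<Omega> \<mu> \<rho>\<^sub>l \<phi> \<and> lip_const \<Omega> \<phi> = ereal lam \<and>
        (\<integral>x. \<phi> x \<partial>\<nu>) - (\<integral>x. \<phi> x \<partial>\<rho>\<^sub>l) = lam * wasserstein \<Omega> 1 \<rho>\<^sub>l \<nu>" if "\<nu> \<notin> B_set \<Omega> lam \<mu>"
      using \<nu>_out[OF that] KR by blast
  qed (use argmin_F[unfolded F_def] argmin_D \<nu>_in maps in blast)+
qed

end
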